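(* Let $M$ be a smooth $5$-manifold and $\mathcal H\subset TM$ a generic rank two distribution. Let $\alpha\in\Gamma((T^{-2}M)^* )$ be a generalized contact form for $\mathcal H$, let $f\in C^\infty(M,\mathbb R)$, and put $\hat\alpha=e^f\alpha$, which is again a generalized contact form. Then the pseudo-Riemannian metrics $g_\alpha$ and $g_{\hat\alpha}$ associated to $\alpha$ and $\hat\alpha$ are related by $$g_{\hat\alpha}=e^{2f}g_\alpha .$$ In particular, the conformal class of $g_\alpha$ depends only on the distribution $\mathcal H$, i.e. it is the same for all generalized contact forms $\alpha$ for $\mathcal H$.
   Context: **Generic distributions.** A rank two distribution $\mathcal H$ on a smooth $5$-manifold $M$ is generic if at each $x\in M$ the values of linear combinations of iterated Lie brackets of at most three sections of $\mathcal H$ span $T_xM$. Put $T^{-1}M=\mathcal H$; let $T^{-2}M=[\mathcal H,\mathcal H]$ be the rank $3$ subbundle spanned by sections of $\mathcal H$ and their Lie brackets; $T^{-3}M=TM$. Let $\mathrm{gr}_{-1}(TM)=T^{-1}M$, $\mathrm{gr}_{-2}(TM)=T^{-2}M/T^{-1}M$, $\mathrm{gr}_{-3}(TM)=TM/T^{-2}M$, with quotient maps $q_{-2}:T^{-2}M\to\mathrm{gr}_{-2}(TM)$ and $q_{-3}:TM\to\mathrm{gr}_{-3}(TM)$. The Levi bracket is the skew-symmetric bundle map $\{\ ,\ \}$ given by $\{\xi,\eta\}=q_{-2}([\xi,\eta])$ for $\xi,\eta\in\Gamma(T^{-1}M)$ and $\{\xi,q_{-2}(\zeta)\}=-\{q_{-2}(\zeta),\xi\}=q_{-3}([\xi,\zeta])$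 for $\xi\in\Gamma(T^{-1}M)$, $\zeta\in\Gamma(T^{-2}M)$. It induces isomorphisms $\Lambda^2T^{-1}M\cong\mathrm{gr}_{-2}(TM)$ and $T^{-1}M\otimes\mathrm{gr}_{-2}(TM)\cong\mathrm{gr}_{-3}(TM)$. **Generalized contact form.** A smooth section $\alpha$ of $(T^{-2}M)^*$ such that $\ker\alpha(x)=T^{-1}_xM$ for all $x\in M$. **Partial connection determined by $r$.** If $r\in\Gamma(T^{-2}M)$ is such that $\varphi=q_{-2}(r)$ is nowhere vanishing, then for $\xi,\eta\in\Gamma(T^{-1}M)$ let $\nabla_\xi\eta\in\Gamma(T^{-1}M)$ be the unique section with $\{\nabla_\xi\eta,\varphi\}=q_{-3}([\xi,[\eta,r]])$. It is $C^\infty$-linear in $\xi$ and satisfies the Leibniz rule in $\eta$. It induces a partial connection on $\mathrm{gr}_{-2}(TM)$ by $\nabla_\gamma\{\xi,\eta\}=\{\nabla_\gamma\xi,\eta\}+\{\xi,\nabla_\gamma\eta\}$. **Generalized Reeb field of $\alpha$.** The unique $r\in\Gamma(T^{-2}M)$ with $\alpha(r)=1$ such that $q_{-2}(r)$ is parallel for the partial connection $\nabla$ on $\mathrm{gr}_{-2}(TM)$ determined by $r$. From now on $r$ and $\nabla$ are these. **Canonical extension.** $\alpha$ extends uniquely to a one-form on $M$, again denoted $\alpha$, such that $d\alpha(r,\xi)=0$ for all $\xi\in T^{-1}M$. **Decomposition.** Each $\zeta\in\mathfrak X(M)$ can be uniquely written as $\zeta=[r,\zeta_1]+\alpha(\zeta)r+\zeta_2$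 with $\zeta_1,\zeta_2\in\Gamma(T^{-1}M)$; here $\zeta_1$ is characterized by $q_{-3}(\zeta)=\{q_{-2}(r),\zeta_1\}$. **Operators $\Phi,\Psi:\Gamma(T^{-1}M)\to\Gamma(T^{-1}M)$.** They are determined by $$\nabla_\xi\nabla_\eta\gamma-\nabla_\eta\nabla_\xi\gamma-\nabla_{[\xi,\eta]-\alpha([\xi,\eta])r}\gamma=\alpha([\xi,\eta])\Phi(\gamma),\qquad \{\Psi(\gamma),q_{-2}(r)\}=\tfrac12 q_{-3}([r,[\gamma,r]])$$ for $\xi,\eta,\gamma\in\Gamma(T^{-1}M)$. **Projection.** $\pi_{-1}:TM\to T^{-1}M$, $\pi_{-1}(\zeta)=-\tfrac25\Phi(\zeta_1)+\tfrac75\Psi(\zeta_1)+\zeta_2$ (this is $C^\infty$-linear). **Metric.** $g_\alpha(\zeta,\zeta')=d\alpha(\zeta_1,\pi_{-1}(\zeta'))-\tfrac43\alpha(\zeta)\alpha(\zeta')+d\alpha(\zeta'_1,\pi_{-1}(\zeta))$. It is a pseudo-Riemannian metric of signature $(2,3)$. The metric $g_{\hat\alpha}$ is obtained by the same construction starting from $\hat\alpha$. Conformal class means class up to multiplication by positive smooth functions. *)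

theory Defs
  imports "HOL-Analysis.Analysis" "HOL-Library.Function_Algebras"
begin

instantiation "fun" :: (type, real_vector) real_vector
begin

definition scaleR_fun :: "real \<Rightarrow> ('a \<Rightarrow> 'b) \<Rightarrow> 'a \<Rightarrow> 'b"
  where "scaleR_fun c f = (\<lambda>x. c *\<^sub>R f x)"

instance
  by standard (simp_all add: scaleR_fun_def fun_eq_iff scaleR_add_right scaleR_add_left)

end

section \<open>Smooth 5-manifolds, tangent vectors, vector fields\<close>

primrec Ck_on :: "nat \<Rightarrow> 'b::euclidean_space set \<Rightarrow> ('b \<Rightarrow> 'c::real_normed_vector) \<Rightarrow> bool" where
  "Ck_on 0 S f \<longleftrightarrow> continuous_on S f"
| "Ck_on (Suc k) S f \<longleftrightarrow>
     (\<forall>x\<in>S. f differentiable (at x)) \<and> (\<forall>v. Ck_on k S (\<lambda>x. frechet_derivative f (at x) v))"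

text \<open>Only used for open \<open>S\<close>.\<close>

definition smooth_on :: "'b::euclidean_space set \<Rightarrow> ('b \<Rightarrow> 'c::real_normed_vector) \<Rightarrow> bool"
  where "smooth_on S f \<longleftrightarrow> (\<forall>k. Ck_on k S f)"

type_synonym 'a chart = "'a set \<times> ('a \<Rightarrow> real^5)"

text \<open>The manifold is the whole type \<open>'a\<close>. The Hausdorff and second countability axioms are its type
  class constraints; the smooth structure is given by an atlas, which need not be maximal.\<close>

definition is_chart :: "'a::{t2_space,second_countable_topology} chart \<Rightarrow> bool" where
  "is_chart c \<longleftrightarrow> (case c of (U, \<phi>) \<Rightarrow>
     open U \<and> open (\<phi> ` U) \<and> homeomorphism U (\<phi> ` U) \<phi> (inv_into U \<phi>))"

definition smooth_atlas :: "'a::{t2_space,second_countable_topology} chart set \<Rightarrow> bool" where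
  "smooth_atlas A \<longleftrightarrow>
     (\<forall>c\<in>A. is_chart c) \<and> (\<Union>c\<in>A. fst c) = UNIV \<and>
     (\<forall>(U, \<phi>)\<in>A. \<forall>(V, \<psi>)\<in>A. smooth_on (\<phi> ` (U \<inter> V)) (\<psi> \<circ> inv_into U \<phi>))"

definition smooth_functions :: "'a chart set \<Rightarrow> ('a \<Rightarrow> real) set" where
  "smooth_functions A = {f. \<forall>(U, \<phi>)\<in>A. smooth_on (\<phi> ` U) (f \<circ> inv_into U \<phi>)}"

type_synonym 'a tangent = "('a \<Rightarrow> real) \<Rightarrow> real"
type_synonym 'a vfield = "'a \<Rightarrow> 'a tangent"

text \<open>Tangent vectors at \<open>x\<close> are the derivations at \<open>x\<close> of the algebra of smooth functions. As HOL
  functions are total, they are normalised to vanish on functions that are not smooth.\<close>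

definition tangent_space :: "'a chart set \<Rightarrow> 'a \<Rightarrow> 'a tangent set" where
  "tangent_space A x = {v.
     (\<forall>f\<in>smooth_functions A. \<forall>g\<in>smooth_functions A.
        v (f + g) = v f + v g \<and> v (f * g) = f x * v g + g x * v f) \<and>
     (\<forall>c. \<forall>f\<in>smooth_functions A. v (c *\<^sub>R f) = c * v f) \<and>
     (\<forall>f. f \<notin> smooth_functions A \<longrightarrow> v f = 0)}"

definition vector_fields :: "'a chart set \<Rightarrow> 'a vfield set" where
  "vector_fields A = {X. (\<forall>x. X x \<in> tangent_space A x) \<and>
     (\<forall>f\<in>smooth_functions A. (\<lambda>x. X x f) \<in> smooth_functions A)}"

text \<open>For vector fields \<open>X\<close>, \<open>Y\<close> the value on a function that is not smooth is again \<open>0\<close>.\<close>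

definition lie_bracket :: "'a vfield \<Rightarrow> 'a vfield \<Rightarrow> 'a vfield" where
  "lie_bracket X Y = (\<lambda>x f. X x (\<lambda>y. Y y f) - Y x (\<lambda>y. X y f))"

definition fscale :: "('a \<Rightarrow> real) \<Rightarrow> 'a vfield \<Rightarrow> 'a vfield" where
  "fscale h X = (\<lambda>x. h x *\<^sub>R X x)"

definition sections :: "'a chart set \<Rightarrow> ('a \<Rightarrow> 'a tangent set) \<Rightarrow> 'a vfield set" where
  "sections A W = {X \<in> vector_fields A. \<forall>x. X x \<in> W x}"

text \<open>Smooth sections of the dual \<open>W\<^sup>*\<close> of a smooth subbundle \<open>W\<close> of the tangent bundle; the
  values of \<open>\<theta> x\<close> outside \<open>W x\<close> are irrelevant.\<close>

definition dual_sections ::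
    "'a chart set \<Rightarrow> ('a \<Rightarrow> 'a tangent set) \<Rightarrow> ('a \<Rightarrow> 'a tangent \<Rightarrow> real) set" where
  "dual_sections A W = {\<theta>.
     (\<forall>x. \<forall>v\<in>W x. \<forall>w\<in>W x. \<theta> x (v + w) = \<theta> x v + \<theta> x w) \<and>
     (\<forall>x c. \<forall>v\<in>W x. \<theta> x (c *\<^sub>R v) = c * \<theta> x v) \<and>
     (\<forall>X\<in>sections A W. (\<lambda>x. \<theta> x (X x)) \<in> smooth_functions A)}"

definition pairing :: "('a \<Rightarrow> 'a tangent \<Rightarrow> real) \<Rightarrow> 'a vfield \<Rightarrow> 'a \<Rightarrow> real" where
  "pairing \<theta> X = (\<lambda>x. \<theta> x (X x))"

text \<open>The exterior derivative of a one-form, without a factor \<open>1/2\<close>.\<close>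

definition ext_deriv :: "('a \<Rightarrow> 'a tangent \<Rightarrow> real) \<Rightarrow> 'a vfield \<Rightarrow> 'a vfield \<Rightarrow> 'a \<Rightarrow> real" where
  "ext_deriv \<theta> X Y =
     (\<lambda>x. X x (pairing \<theta> Y) - Y x (pairing \<theta> X) - pairing \<theta> (lie_bracket X Y) x)"

section \<open>Generic rank two distributions\<close>

text \<open>Local frames are given by vector fields on the whole manifold. This is no restriction: cut off
  a local frame by a bump function and shrink \<open>U\<close>.\<close>

definition rank_two_distribution ::
    "'a::topological_space chart set \<Rightarrow> ('a \<Rightarrow> 'a tangent set) \<Rightarrow> bool" where
  "rank_two_distribution A H \<longleftrightarrow>
     (\<forall>x. subspace (H x) \<and> H x \<subseteq> tangent_space A x \<and> dim (H x) = 2) \<and>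
     (\<forall>x. \<exists>U. open U \<and> x \<in> U \<and>
        (\<exists>X\<in>vector_fields A. \<exists>Y\<in>vector_fields A. \<forall>y\<in>U. H y = span {X y, Y y}))"

definition generic_distribution ::
    "'a::topological_space chart set \<Rightarrow> ('a \<Rightarrow> 'a tangent set) \<Rightarrow> bool" where
  "generic_distribution A H \<longleftrightarrow> rank_two_distribution A H \<and>
     (\<forall>x. span ({X x |X. X \<in> sections A H} \<union>
                {lie_bracket X Y x |X Y. X \<in> sections A H \<and> Y \<in> sections A H} \<union>
                {lie_bracket X (lie_bracket Y Z) x |X Y Z.
                   X \<in> sections A H \<and> Y \<in> sections A H \<and> Z \<in> sections A H})
          = tangent_space A x)"

definition T2 :: "'a chart set \<Rightarrow> ('a \<Rightarrow> 'a tangent set) \<Rightarrow> 'a \<Rightarrow> 'a tangent set" where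
  "T2 A H x = span ({X x |X. X \<in> sections A H} \<union>
                    {lie_bracket X Y x |X Y. X \<in> sections A H \<and> Y \<in> sections A H})"

text \<open>Elements of quotients by \<open>W x\<close> are cosets. \<open>qmap W X\<close> is the class of \<open>X\<close>: the map
  \<open>q\<^sub>-\<^sub>2\<close> is \<open>qmap H\<close>, and \<open>q\<^sub>-\<^sub>3\<close> is \<open>qmap (T2 A H)\<close>.\<close>

type_synonym 'a qsection = "'a \<Rightarrow> 'a tangent set"

definition qmap :: "('a \<Rightarrow> 'a tangent set) \<Rightarrow> 'a vfield \<Rightarrow> 'a qsection" where
  "qmap W X = (\<lambda>x. (\<lambda>w. X x + w) ` W x)"

definition q_add :: "'a qsection \<Rightarrow> 'a qsection \<Rightarrow> 'a qsection" where
  "q_add \<phi> \<psi> = (\<lambda>x. {v + w |v w. v \<in> \<phi> x \<and> w \<in> \<psi> x})"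

text \<open>The summand \<open>w\<close> matters where \<open>h\<close> vanishes: there the product is the zero class \<open>W x\<close>.\<close>

definition q_scale ::
    "('a \<Rightarrow> 'a tangent set) \<Rightarrow> ('a \<Rightarrow> real) \<Rightarrow> 'a qsection \<Rightarrow> 'a qsection" where
  "q_scale W h \<phi> = (\<lambda>x. {h x *\<^sub>R v + w |v w. v \<in> \<phi> x \<and> w \<in> W x})"

definition gr2_sections :: "'a chart set \<Rightarrow> ('a \<Rightarrow> 'a tangent set) \<Rightarrow> 'a qsection set" where
  "gr2_sections A H = qmap H ` sections A (T2 A H)"

text \<open>The two components of the Levi bracket, on sections. The value of \<open>levi12\<close> does not depend on
  the chosen lift \<open>\<zeta>\<close> of \<open>\<phi>\<close>.\<close>

definition levi11 :: "('a \<Rightarrow> 'a tangent set) \<Rightarrow> 'a vfield \<Rightarrow> 'a vfield \<Rightarrow> 'a qsection" where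
  "levi11 H \<xi> \<eta> = qmap H (lie_bracket \<xi> \<eta>)"

definition levi12 ::
    "'a chart set \<Rightarrow> ('a \<Rightarrow> 'a tangent set) \<Rightarrow> 'a vfield \<Rightarrow> 'a qsection \<Rightarrow> 'a qsection" where
  "levi12 A H \<xi> \<phi> =
     qmap (T2 A H) (lie_bracket \<xi> (SOME \<zeta>. \<zeta> \<in> sections A (T2 A H) \<and> qmap H \<zeta> = \<phi>))"

section \<open>Partial connections and the generalized Reeb field\<close>

definition pconn ::
    "'a chart set \<Rightarrow> ('a \<Rightarrow> 'a tangent set) \<Rightarrow> 'a vfield \<Rightarrow> 'a vfield \<Rightarrow> 'a vfield \<Rightarrow> 'a vfield" where
  "pconn A H r \<xi> \<eta> = (THE \<delta>. \<delta> \<in> sections A H \<and>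
     levi12 A H \<delta> (qmap H r) = qmap (T2 A H) (lie_bracket \<xi> (lie_bracket \<eta> r)))"

text \<open>\<open>D\<close> is the partial connection on \<open>gr\<^sub>-\<^sub>2\<close> induced by the partial connection \<open>nabla\<close>
  on \<open>H\<close>; it is unique on the relevant sections, as \<open>gr\<^sub>-\<^sub>2\<close> is locally spanned by Levi brackets.\<close>

definition induced_gr2_connection ::
    "'a chart set \<Rightarrow> ('a \<Rightarrow> 'a tangent set) \<Rightarrow> ('a vfield \<Rightarrow> 'a vfield \<Rightarrow> 'a vfield) \<Rightarrow>
     ('a vfield \<Rightarrow> 'a qsection \<Rightarrow> 'a qsection) \<Rightarrow> bool" where
  "induced_gr2_connection A H nabla D \<longleftrightarrow>
     (\<forall>\<gamma>\<in>sections A H. \<forall>\<phi>\<in>gr2_sections A H. D \<gamma> \<phi> \<in> gr2_sections A H) \<and>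
     (\<forall>\<gamma>\<in>sections A H. \<forall>\<gamma>'\<in>sections A H. \<forall>\<phi>\<in>gr2_sections A H.
        D (\<gamma> + \<gamma>') \<phi> = q_add (D \<gamma> \<phi>) (D \<gamma>' \<phi>)) \<and>
     (\<forall>h\<in>smooth_functions A. \<forall>\<gamma>\<in>sections A H. \<forall>\<phi>\<in>gr2_sections A H.
        D (fscale h \<gamma>) \<phi> = q_scale H h (D \<gamma> \<phi>)) \<and>
     (\<forall>\<gamma>\<in>sections A H. \<forall>\<phi>\<in>gr2_sections A H. \<forall>\<psi>\<in>gr2_sections A H.
        D \<gamma> (q_add \<phi> \<psi>) = q_add (D \<gamma> \<phi>) (D \<gamma> \<psi>)) \<and>
     (\<forall>h\<in>smooth_functions A. \<forall>\<gamma>\<in>sections A H. \<forall>\<phi>\<in>gr2_sections A H.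
        D \<gamma> (q_scale H h \<phi>) = q_add (q_scale H (\<lambda>x. \<gamma> x h) \<phi>) (q_scale H h (D \<gamma> \<phi>))) \<and>
     (\<forall>\<gamma>\<in>sections A H. \<forall>\<xi>\<in>sections A H. \<forall>\<eta>\<in>sections A H.
        D \<gamma> (levi11 H \<xi> \<eta>) = q_add (levi11 H (nabla \<gamma> \<xi>) \<eta>) (levi11 H \<xi> (nabla \<gamma> \<eta>)))"

text \<open>\<open>q\<^sub>-\<^sub>2(r)\<close> is parallel for the connection on \<open>gr\<^sub>-\<^sub>2\<close> that is itself determined by \<open>r\<close>;
  \<open>qmap H 0\<close> is the zero section.\<close>

definition self_parallel :: "'a chart set \<Rightarrow> ('a \<Rightarrow> 'a tangent set) \<Rightarrow> 'a vfield \<Rightarrow> bool" where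
  "self_parallel A H r \<longleftrightarrow> (\<exists>D. induced_gr2_connection A H (pconn A H r) D \<and>
     (\<forall>\<gamma>\<in>sections A H. D \<gamma> (qmap H r) = qmap H 0))"

definition generalized_contact_form ::
    "'a chart set \<Rightarrow> ('a \<Rightarrow> 'a tangent set) \<Rightarrow> ('a \<Rightarrow> 'a tangent \<Rightarrow> real) \<Rightarrow> bool" where
  "generalized_contact_form A H \<alpha> \<longleftrightarrow>
     \<alpha> \<in> dual_sections A (T2 A H) \<and> (\<forall>x. {v \<in> T2 A H x. \<alpha> x v = 0} = H x)"

definition reeb_field ::
    "'a chart set \<Rightarrow> ('a \<Rightarrow> 'a tangent set) \<Rightarrow> ('a \<Rightarrow> 'a tangent \<Rightarrow> real) \<Rightarrow> 'a vfield" where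
  "reeb_field A H \<alpha> = (THE r. r \<in> sections A (T2 A H) \<and> pairing \<alpha> r = 1 \<and> self_parallel A H r)"

text \<open>The extension is normalised to \<open>0\<close> off the tangent spaces, to make it unique as a HOL
  function.\<close>

definition canonical_extension ::
    "'a chart set \<Rightarrow> ('a \<Rightarrow> 'a tangent set) \<Rightarrow> ('a \<Rightarrow> 'a tangent \<Rightarrow> real) \<Rightarrow>
     'a \<Rightarrow> 'a tangent \<Rightarrow> real" where
  "canonical_extension A H \<alpha> = (THE \<theta>.
     \<theta> \<in> dual_sections A (tangent_space A) \<and>
     (\<forall>x v. v \<notin> tangent_space A x \<longrightarrow> \<theta> x v = 0) \<and>
     (\<forall>x. \<forall>v\<in>T2 A H x. \<theta> x v = \<alpha> x v) \<and>
     (\<forall>\<xi>\<in>sections A H. ext_deriv \<theta> (reeb_field A H \<alpha>) \<xi> = 0))"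

section \<open>The metric of a generalized contact form\<close>

text \<open>The pair \<open>(\<zeta>\<^sub>1, \<zeta>\<^sub>2)\<close>.\<close>

definition decomposition ::
    "'a chart set \<Rightarrow> ('a \<Rightarrow> 'a tangent set) \<Rightarrow> ('a \<Rightarrow> 'a tangent \<Rightarrow> real) \<Rightarrow>
     'a vfield \<Rightarrow> 'a vfield \<times> 'a vfield" where
  "decomposition A H \<alpha> \<zeta> = (THE p. fst p \<in> sections A H \<and> snd p \<in> sections A H \<and>
     \<zeta> = lie_bracket (reeb_field A H \<alpha>) (fst p)
         + fscale (pairing (canonical_extension A H \<alpha>) \<zeta>) (reeb_field A H \<alpha>) + snd p)"

text \<open>Neither \<open>\<Phi>\<close> nor \<open>\<Psi>\<close> is linear over smooth functions.\<close>

definition Phi ::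
    "'a chart set \<Rightarrow> ('a \<Rightarrow> 'a tangent set) \<Rightarrow> ('a \<Rightarrow> 'a tangent \<Rightarrow> real) \<Rightarrow>
     'a vfield \<Rightarrow> 'a vfield" where
  "Phi A H \<alpha> \<gamma> = (let r = reeb_field A H \<alpha>; nabla = pconn A H r in
     THE \<delta>. \<delta> \<in> sections A H \<and> (\<forall>\<xi>\<in>sections A H. \<forall>\<eta>\<in>sections A H.
       nabla \<xi> (nabla \<eta> \<gamma>) - nabla \<eta> (nabla \<xi> \<gamma>)
         - nabla (lie_bracket \<xi> \<eta> - fscale (pairing \<alpha> (lie_bracket \<xi> \<eta>)) r) \<gamma>
       = fscale (pairing \<alpha> (lie_bracket \<xi> \<eta>)) \<delta>))"

definition Psi ::
    "'a chart set \<Rightarrow> ('a \<Rightarrow> 'a tangent set) \<Rightarrow> ('a \<Rightarrow> 'a tangent \<Rightarrow> real) \<Rightarrow>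
     'a vfield \<Rightarrow> 'a vfield" where
  "Psi A H \<alpha> \<gamma> = (let r = reeb_field A H \<alpha> in
     THE \<delta>. \<delta> \<in> sections A H \<and>
       levi12 A H \<delta> (qmap H r) =
         q_scale (T2 A H) (\<lambda>_. 1/2) (qmap (T2 A H) (lie_bracket r (lie_bracket \<gamma> r))))"

definition proj_H ::
    "'a chart set \<Rightarrow> ('a \<Rightarrow> 'a tangent set) \<Rightarrow> ('a \<Rightarrow> 'a tangent \<Rightarrow> real) \<Rightarrow>
     'a vfield \<Rightarrow> 'a vfield" where
  "proj_H A H \<alpha> \<zeta> = (let (\<zeta>1, \<zeta>2) = decomposition A H \<alpha> \<zeta> in
     (- 2/5) *\<^sub>R Phi A H \<alpha> \<zeta>1 + (7/5) *\<^sub>R Psi A H \<alpha> \<zeta>1 + \<zeta>2)"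

text \<open>Metrics are bilinear forms over smooth functions on the vector fields.\<close>

type_synonym 'a metric_tensor = "'a vfield \<Rightarrow> 'a vfield \<Rightarrow> 'a \<Rightarrow> real"

definition g_metric ::
    "'a chart set \<Rightarrow> ('a \<Rightarrow> 'a tangent set) \<Rightarrow> ('a \<Rightarrow> 'a tangent \<Rightarrow> real) \<Rightarrow> 'a metric_tensor" where
  "g_metric A H \<alpha> \<zeta> \<zeta>' =
     (let \<theta> = canonical_extension A H \<alpha>;
          \<zeta>1 = fst (decomposition A H \<alpha> \<zeta>); \<zeta>1' = fst (decomposition A H \<alpha> \<zeta>') in
      (\<lambda>x. ext_deriv \<theta> \<zeta>1 (proj_H A H \<alpha> \<zeta>') x
          - 4/3 * pairing \<theta> \<zeta> x * pairing \<theta> \<zeta>' x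
          + ext_deriv \<theta> \<zeta>1' (proj_H A H \<alpha> \<zeta>) x))"

definition conformally_equivalent ::
    "'a chart set \<Rightarrow> 'a metric_tensor \<Rightarrow> 'a metric_tensor \<Rightarrow> bool" where
  "conformally_equivalent A g g' \<longleftrightarrow>
     (\<exists>h\<in>smooth_functions A. (\<forall>x. 0 < h x) \<and>
        (\<forall>\<zeta>\<in>vector_fields A. \<forall>\<zeta>'\<in>vector_fields A. \<forall>x. g' \<zeta> \<zeta>' x = h x * g \<zeta> \<zeta>' x))"

end

theory Submission
  imports Defs
begin

text \<open>A generalized contact form \<open>\<alpha>\<close> turns the Levi bracket into two tensors: the area form
  \<open>levi \<xi> \<eta> = \<alpha> [\<xi>, \<eta>]\<close> on \<open>H\<close>, and the map \<open>part1\<close> from \<open>TM\<close> to \<open>H\<close> with kernel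
  \<open>T\<^sup>-\<^sup>2M\<close> and \<open>part1 [\<rho>, \<xi>] = \<alpha>(\<rho>) \<xi>\<close> for sections \<open>\<rho>\<close> of \<open>T\<^sup>-\<^sup>2M\<close> and \<open>\<xi>\<close> of \<open>H\<close>.
  In terms of them \<open>\<nabla>\<^sub>\<xi> \<eta> = part1 [\<xi>, [r, \<eta>]]\<close>, and \<open>r\<close> is the Reeb field iff \<open>levi\<close> is parallel.
  For \<open>\<alpha>' = h \<alpha>\<close> with \<open>w = d log \<bar>h\<bar>\<close>, the new Reeb field is \<open>(r + s) / h\<close>, where the section \<open>s\<close> of
  \<open>H\<close> is determined by \<open>levi s \<xi> = - 4 w \<xi>\<close>. With \<open>t = part1 \<zeta>\<close> one finds that \<open>part1 \<zeta>\<close> becomes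
  \<open>h t\<close>, that \<open>\<alpha> \<zeta>\<close> becomes \<open>h (\<alpha> \<zeta> + 3 w t)\<close>, and that the projection of \<open>\<zeta>\<close> to \<open>H\<close> changes by
  \<open>- \<alpha>(\<zeta>) s - 3/2 w(t) s - 3/2 w(r) t\<close>. In the metric these corrections cancel after symmetrization, up to
  the factor \<open>h\<^sup>2\<close>. As only \<open>d log \<bar>h\<bar>\<close> enters, \<open>h\<close> may change sign between components, which is needed
  to compare two arbitrary generalized contact forms.\<close>

section \<open>Smooth functions on open subsets of Euclidean space\<close>

text \<open>The definitions describe their objects by \<open>THE\<close> or \<open>SOME\<close> over
  global sections, whereas frames and normalised pairs exist only near a point. Local data are
  therefore cut off to global sections, and whatever is unique at each point is glued from local
  solutions; this is why smooth bump functions are constructed. The quotients are removed early: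
  \<alpha> identifies the second graded piece with functions and \<open>part1\<close> the third with
  \<open>H\<close>, so that the remaining equations are between functions and sections of
  \<open>H\<close>.

  The constants are forced. The changes of \<Phi>, of \<open>part1 [r, [r, t]]\<close> and of the
  \<open>H\<close>-component of \<zeta> contain the derivative terms \<open>nab r s t\<close> and
  \<open>nab r t s\<close>. If a and b are the coefficients of \<Phi>(t) and of
  \<open>part1 [r, [r, t]]\<close> in the projection, both terms cancel iff a + 2 b = 1 and 3/4 a -
  b = - 1, that is a = - 2/5 and b = 7/10, half of 7/5. What remains are multiples of s and t, and -
  4/3 is the factor for which the change of the extension compensates them in the metric.\<close>

lemma frechet_derivative_cong_open:
  fixes f g :: "'b::euclidean_space \<Rightarrow> 'c::real_normed_vector"
  assumes "open W" "x \<in> W" "\<And>y. y \<in> W \<Longrightarrow> f y = g y" "g differentiable (at x)"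
  shows "f differentiable (at x)" "frechet_derivative f (at x) = frechet_derivative g (at x)"
proof -
  have "(g has_derivative frechet_derivative g (at x)) (at x)"
    using assms(4) frechet_derivative_works by blast
  then have d: "(f has_derivative frechet_derivative g (at x)) (at x)"
    by (rule has_derivative_transform_within_open[OF _ assms(1,2)]) (use assms(3) in auto)
  then show "f differentiable (at x)"
    unfolding differentiable_def by blast
  show "frechet_derivative f (at x) = frechet_derivative g (at x)"
    using frechet_derivative_at[OF d] by simp
qed

text \<open>\<open>frechet_derivative f (at x)\<close> depends only on the germ of \<open>f\<close>
  at \<open>x\<close>, so the neighbourhood and the local model for \<open>f\<close> also serve for
  its derivatives, and the induction runs over all \<open>f\<close> at once.\<close>

lemma Ck_on_local:
  assumes "\<And>x. x \<in> S \<Longrightarrow> \<exists>W g. open W \<and> x \<in> W \<and> Ck_on k W g \<and> (\<forall>y\<in>W. f y = g y)"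
  shows "Ck_on k S f"
  using assms
proof (induction k arbitrary: f)
  case 0
  have "isCont f x" if x: "x \<in> S" for x
  proof -
    obtain W g where W: "open W" "x \<in> W" "continuous_on W g" "\<forall>y\<in>W. f y = g y"
      using 0[OF x] by auto
    then have "continuous_on W f"
      by (simp cong: continuous_on_cong_simp)
    with W show ?thesis
      using continuous_on_eq_continuous_at by blast
  qed
  then show ?case
    by (simp add: continuous_at_imp_continuous_on)
next
  case (Suc k)
  show ?case
    unfolding Ck_on.simps
  proof (intro conjI ballI allI)
    fix x assume "x \<in> S"
    then show "f differentiable (at x)"
      using Suc.prems[of x] frechet_derivative_cong_open(1)[of _ x f] Ck_on.simps(2) by metis
  next
    fix v
    show "Ck_on k S (\<lambda>x. frechet_derivative f (at x) v)"
    proof (rule Suc.IH)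
      fix x assume "x \<in> S"
      then obtain W g where W: "open W" "x \<in> W" "Ck_on (Suc k) W g" "\<forall>y\<in>W. f y = g y"
        using Suc.prems by blast
      then have "\<forall>y\<in>W. frechet_derivative f (at y) v = frechet_derivative g (at y) v"
        using frechet_derivative_cong_open(2)[of W _ f g] by simp
      with W show "\<exists>W g. open W \<and> x \<in> W \<and> Ck_on k W g \<and>
          (\<forall>y\<in>W. frechet_derivative f (at y) v = g y)"
        by (auto intro!: exI[of _ W])
    qed
  qed
qed

lemma Ck_on_cong:
  assumes "open S" "\<And>x. x \<in> S \<Longrightarrow> f x = g x" "Ck_on k S g"
  shows "Ck_on k S f"
  by (rule Ck_on_local) (use assms in auto)

lemma Ck_on_subset: "Ck_on k S f \<Longrightarrow> T \<subseteq> S \<Longrightarrow> Ck_on k T f"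
  by (induction k arbitrary: f) (auto intro: continuous_on_subset)

text \<open>Admits any formula for the derivative on the open set \<open>S\<close>; it agrees with
  \<open>frechet_derivative\<close> there, which \<open>Ck_on_cong\<close> exploits.\<close>

lemma Ck_on_SucI:
  assumes "open S" "\<And>x. x \<in> S \<Longrightarrow> (f has_derivative f' x) (at x)"
    and "\<And>v. Ck_on k S (\<lambda>x. f' x v)"
  shows "Ck_on (Suc k) S f"
  unfolding Ck_on.simps
proof (intro conjI ballI allI)
  fix x assume "x \<in> S"
  then show "f differentiable (at x)"
    using assms(2) by (auto simp: differentiable_def)
next
  fix v show "Ck_on k S (\<lambda>x. frechet_derivative f (at x) v)"
    by (rule Ck_on_cong[OF assms(1) _ assms(3)]) (simp add: frechet_derivative_at[OF assms(2), symmetric])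
qed

lemma Ck_on_SucD:
  assumes "Ck_on (Suc k) S f"
  shows "x \<in> S \<Longrightarrow> (f has_derivative frechet_derivative f (at x)) (at x)"
    and "Ck_on k S (\<lambda>x. frechet_derivative f (at x) v)"
  using assms by (simp_all flip: frechet_derivative_works)

lemma Ck_on_Suc_imp: "Ck_on (Suc k) S f \<Longrightarrow> Ck_on k S f"
proof (induction k arbitrary: f)
  case 0
  then have "\<forall>x\<in>S. isCont f x"
    using differentiable_imp_continuous_within by auto
  then show ?case
    by (simp add: continuous_at_imp_continuous_on)
next
  case (Suc k)
  show ?case
    unfolding Ck_on.simps(2)[of k]
    using Suc.IH Suc.prems[unfolded Ck_on.simps(2)[of "Suc k"]] by simp
qed

lemma Ck_on_const: "Ck_on k S (\<lambda>x. c)"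
proof (induction k arbitrary: c)
  case (Suc k)
  then show ?case by (simp add: frechet_derivative_const)
qed simp

lemma Ck_on_linear:
  assumes "bounded_linear L" "open S" "Ck_on k S f"
  shows "Ck_on k S (\<lambda>x. L (f x))"
  using assms(3)
proof (induction k arbitrary: f)
  case 0
  then show ?case
    using bounded_linear.continuous_on[OF assms(1)] by simp
next
  case (Suc k)
  show ?case
    by (rule Ck_on_SucI[OF assms(2) bounded_linear.has_derivative[OF assms(1) Ck_on_SucD(1)[OF Suc.prems]]])
      (use Suc.IH[OF Ck_on_SucD(2)[OF Suc.prems]] in auto)
qed

lemma Ck_on_add:
  assumes "open S" "Ck_on k S f" "Ck_on k S g"
  shows "Ck_on k S (\<lambda>x. f x + g x)"
  using assms(2,3)
proof (induction k arbitrary: f g)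
  case 0
  then show ?case by (simp add: continuous_on_add)
next
  case (Suc k)
  show ?case
    by (rule Ck_on_SucI[OF assms(1) has_derivative_add[OF Ck_on_SucD(1)[OF Suc.prems(1)] Ck_on_SucD(1)[OF Suc.prems(2)]]])
      (use Suc.IH[OF Ck_on_SucD(2)[OF Suc.prems(1)] Ck_on_SucD(2)[OF Suc.prems(2)]] in auto)
qed

lemma Ck_on_mult:
  fixes f g :: "'b::euclidean_space \<Rightarrow> real"
  assumes "open S" "Ck_on k S f" "Ck_on k S g"
  shows "Ck_on k S (\<lambda>x. f x * g x)"
  using assms(2,3)
proof (induction k arbitrary: f g)
  case 0
  then show ?case by (simp add: continuous_on_mult)
next
  case (Suc k)
  show ?case
    by (rule Ck_on_SucI[OF assms(1) has_derivative_mult[OF Ck_on_SucD(1)[OF Suc.prems(1)]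
            Ck_on_SucD(1)[OF Suc.prems(2)]]], assumption, assumption)
      (rule Ck_on_add[OF assms(1) Suc.IH[OF Ck_on_Suc_imp[OF Suc.prems(1)] Ck_on_SucD(2)[OF Suc.prems(2)]]
            Suc.IH[OF Ck_on_SucD(2)[OF Suc.prems(1)] Ck_on_Suc_imp[OF Suc.prems(2)]]])
qed

lemma Ck_on_minus:
  fixes f :: "'b::euclidean_space \<Rightarrow> real"
  assumes "open S" "Ck_on k S f"
  shows "Ck_on k S (\<lambda>x. - f x)"
  using Ck_on_linear[OF bounded_linear_minus[OF bounded_linear_ident] assms] .

text \<open>The derivative of 1/f is - (1/f) df (1/f), made of 1/f itself and df, so order k of the
  claim supplies what order k + 1 needs.\<close>

lemma Ck_on_inverse:
  fixes f :: "'b::euclidean_space \<Rightarrow> real"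
  assumes "open S" "Ck_on k S f" "\<And>x. x \<in> S \<Longrightarrow> f x \<noteq> 0"
  shows "Ck_on k S (\<lambda>x. inverse (f x))"
  using assms(2)
proof (induction k)
  case 0
  then show ?case using assms(3) by (simp add: continuous_on_inverse)
next
  case (Suc k)
  have i: "Ck_on k S (\<lambda>x. inverse (f x))"
    using Suc.IH[OF Ck_on_Suc_imp[OF Suc.prems]] .
  show ?case
  proof (rule Ck_on_SucI[OF assms(1)])
    fix x assume x: "x \<in> S"
    show "((\<lambda>x. inverse (f x)) has_derivative
        (\<lambda>v. - (inverse (f x) * frechet_derivative f (at x) v * inverse (f x)))) (at x)"
      using Deriv.has_derivative_inverse[OF assms(3)[OF x] Ck_on_SucD(1)[OF Suc.prems x]] .
  next
    fix v
    show "Ck_on k S (\<lambda>x. - (inverse (f x) * frechet_derivative f (at x) v * inverse (f x)))"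
      using i Ck_on_SucD(2)[OF Suc.prems] by (intro Ck_on_minus Ck_on_mult assms(1))
  qed
qed

lemma Ck_on_exp:
  fixes f :: "'b::euclidean_space \<Rightarrow> real"
  assumes "open S" "Ck_on k S f"
  shows "Ck_on k S (\<lambda>x. exp (f x))"
  using assms(2)
proof (induction k)
  case 0
  then show ?case by (simp add: continuous_on_exp)
next
  case (Suc k)
  have i: "Ck_on k S (\<lambda>x. exp (f x))"
    using Suc.IH[OF Ck_on_Suc_imp[OF Suc.prems]] .
  show ?case
  proof (rule Ck_on_SucI[OF assms(1)])
    fix x assume x: "x \<in> S"
    show "((\<lambda>x. exp (f x)) has_derivative
        (\<lambda>v. exp (f x) * frechet_derivative f (at x) v)) (at x)"
      using has_derivative_exp[OF Ck_on_SucD(1)[OF Suc.prems x]] by (simp add: mult.commute)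
  next
    fix v
    show "Ck_on k S (\<lambda>x. exp (f x) * frechet_derivative f (at x) v)"
      using i Ck_on_SucD(2)[OF Suc.prems] by (intro Ck_on_mult assms(1))
  qed
qed

text \<open>The powers of \<open>inverse t\<close> make the family closed under differentiation.\<close>

definition flat_exp :: "nat \<Rightarrow> real \<Rightarrow> real"
  where "flat_exp n t = (if t \<le> 0 then 0 else exp (- inverse t) * inverse t ^ n)"

text \<open>Up to the factor \<open>fact n\<close> the left side is one term of the exponential
  series, all of whose terms are nonnegative.\<close>

lemma power_le_fact_exp: "0 \<le> (u::real) \<Longrightarrow> u ^ n \<le> fact n * exp u"
proof -
  assume u: "0 \<le> u"
  have "(\<Sum>k\<in>{n}. inverse (fact k) *\<^sub>R u ^ k) \<le> (\<Sum>k. inverse (fact k) *\<^sub>R u ^ k)"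
    by (rule sum_le_suminf[OF summable_exp_generic]) (use u in auto)
  then show ?thesis
    by (simp add: exp_def field_simps)
qed

text \<open>With u = 1/t the previous bound for the exponent n + 2 leaves a factor t^2. This makes
  the difference quotient of \<open>flat_exp n\<close> at 0 tend to 0.\<close>

lemma flat_exp_bound: "\<bar>flat_exp n t\<bar> \<le> fact (n + 2) * t\<^sup>2"
proof (cases "t \<le> 0")
  case False
  define u where "u = inverse t"
  have u: "0 < u" using False by (simp add: u_def)
  have "u ^ (n + 2) \<le> fact (n + 2) * exp u"
    using power_le_fact_exp[of u "n + 2"] u by simp
  then have "u ^ (n + 2) * (exp (- u) * inverse (u\<^sup>2))
      \<le> fact (n + 2) * exp u * (exp (- u) * inverse (u\<^sup>2))"
    by (rule mult_right_mono) simp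
  moreover have "u ^ (n + 2) * (exp (- u) * inverse (u\<^sup>2)) = exp (- u) * u ^ n"
    using u by (simp add: power_add power2_eq_square field_simps)
  moreover have "exp u * (exp (- u) * inverse (u\<^sup>2)) = inverse (u\<^sup>2)"
    by (simp add: exp_minus)
  ultimately have "exp (- u) * u ^ n \<le> fact (n + 2) * inverse (u\<^sup>2)"
    by (metis mult.assoc)
  then show ?thesis
    using False by (simp add: flat_exp_def u_def power_inverse)
qed (simp add: flat_exp_def)

lemma flat_exp_derivative:
  "(flat_exp n has_real_derivative flat_exp (n + 2) t - real n * flat_exp (n + 1) t) (at t)"
proof -
  consider "t < 0" | "t = 0" | "t > 0" by linarith
  then show ?thesis
  proof cases
    case 1
    have "((\<lambda>t. 0) has_real_derivative 0) (at t)" by simp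
    then have "(flat_exp n has_real_derivative 0) (at t)"
      by (rule has_field_derivative_transform_within_open[where S = "{..<0}"])
        (use 1 in \<open>auto simp: flat_exp_def\<close>)
    with 1 show ?thesis by (simp add: flat_exp_def)
  next
    case 2
    have "((\<lambda>h. flat_exp n h / h) \<longlongrightarrow> 0) (at 0)"
    proof (rule Lim_null_comparison)
      show "\<forall>\<^sub>F h in at 0. norm (flat_exp n h / h) \<le> fact (n + 2) * \<bar>h\<bar>"
        using flat_exp_bound[of n]
        by (auto simp: eventually_at_filter abs_divide divide_le_eq power2_eq_square
            mult.assoc simp flip: abs_mult intro!: always_eventually)
      have "((\<lambda>h. fact (n + 2) * \<bar>h\<bar>) \<longlongrightarrow> fact (n + 2) * \<bar>0::real\<bar>) (at 0)"
        by (intro tendsto_intros)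
      then show "((\<lambda>h. fact (n + 2) * \<bar>h\<bar>) \<longlongrightarrow> 0) (at (0::real))" by simp
    qed
    then show ?thesis
      using 2 by (simp add: DERIV_def flat_exp_def)
  next
    case 3
    have "((\<lambda>t. exp (- inverse t) * inverse t ^ n) has_real_derivative
        flat_exp (n + 2) t - real n * flat_exp (n + 1) t) (at t)"
      \<comment> \<open>The power rule produces the exponent \<open>n - 1\<close>;
        \<open>power_eq_if\<close> separates \<open>n = 0\<close>, where this subtraction
        truncates.\<close>
      using 3 power_eq_if[of "inverse t" n] by (auto intro!: derivative_eq_intros
          simp: flat_exp_def power2_eq_square algebra_simps)
    then show ?thesis
      by (rule has_field_derivative_transform_within_open[where S = "{0<..}"])
        (use 3 in \<open>auto simp: flat_exp_def\<close>)
  qed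
qed

lemma Ck_on_flat_exp:
  fixes f :: "'b::euclidean_space \<Rightarrow> real"
  assumes "open S" "Ck_on k S f"
  shows "Ck_on k S (\<lambda>x. flat_exp n (f x))"
  using assms(2)
proof (induction k arbitrary: n)
  case 0
  have "continuous_on UNIV (flat_exp n)"
    by (meson DERIV_isCont continuous_at_imp_continuous_on flat_exp_derivative)
  with 0 show ?case
    by (auto intro: continuous_on_compose2[where t = UNIV])
next
  case (Suc k)
  have i: "Ck_on k S (\<lambda>x. flat_exp m (f x))" for m
    using Suc.IH[OF Ck_on_Suc_imp[OF Suc.prems]] .
  show ?case
  proof (rule Ck_on_SucI[OF assms(1)])
    fix x assume x: "x \<in> S"
    show "((\<lambda>x. flat_exp n (f x)) has_derivative
        (\<lambda>v. (flat_exp (n + 2) (f x) + (- real n) * flat_exp (n + 1) (f x))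
          * frechet_derivative f (at x) v)) (at x)"
      using has_derivative_compose[OF Ck_on_SucD(1)[OF Suc.prems x]
          flat_exp_derivative[of n "f x", unfolded has_field_derivative_def]]
      by (simp add: o_def)
  next
    fix v
    show "Ck_on k S (\<lambda>x. (flat_exp (n + 2) (f x) + (- real n) * flat_exp (n + 1) (f x))
          * frechet_derivative f (at x) v)"
      using i Ck_on_SucD(2)[OF Suc.prems]
      by (intro Ck_on_mult Ck_on_add Ck_on_const assms(1))
  qed
qed

section \<open>The algebra of smooth functions\<close>

lemma fscale_zero [simp]: "fscale (\<lambda>x. 0) X = 0"
  by (simp add: fscale_def fun_eq_iff)

lemma fscale_0_right [simp]: "fscale h 0 = 0"
  by (simp add: fscale_def fun_eq_iff scaleR_fun_def)

lemma fscale_eval: "fscale h X x f = h x * X x f"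
  by (simp add: fscale_def scaleR_fun_def)

lemma fscale_at: "fscale h X x = h x *\<^sub>R X x"
  by (simp add: fscale_def)

lemma fscale_one: "(\<And>y. h y = 1) \<Longrightarrow> fscale h X = X"
  by (simp add: fscale_def)

locale smooth_manifold =
  fixes A :: "'a::{t2_space,second_countable_topology} chart set"
  assumes atlas: "smooth_atlas A"
begin

abbreviation "F \<equiv> smooth_functions A"
abbreviation "V \<equiv> vector_fields A"

lemma chart:
  assumes "(U, \<phi>) \<in> A"
  shows "open U" "open (\<phi> ` U)" "continuous_on U \<phi>"
    and "continuous_on (\<phi> ` U) (inv_into U \<phi>)"
    and "x \<in> U \<Longrightarrow> inv_into U \<phi> (\<phi> x) = x"
proof -
  have c: "open U \<and> open (\<phi> ` U) \<and> homeomorphism U (\<phi> ` U) \<phi> (inv_into U \<phi>)"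
    using atlas assms unfolding smooth_atlas_def is_chart_def by blast
  then show "open U" "open (\<phi> ` U)" "continuous_on U \<phi>"
      "continuous_on (\<phi> ` U) (inv_into U \<phi>)"
    by (auto simp: homeomorphism_def)
  show "x \<in> U \<Longrightarrow> inv_into U \<phi> (\<phi> x) = x"
    using c by (simp add: homeomorphism_def)
qed

lemma chart_open_preimage:
  assumes "(U, \<phi>) \<in> A" "open W"
  shows "open (\<phi> ` U \<inter> inv_into U \<phi> -` W)"
  using chart[OF assms(1)] assms(2) continuous_open_preimage by blast

lemma chart_preimage_eq:
  assumes "(U, \<phi>) \<in> A"
  shows "\<phi> ` U \<inter> inv_into U \<phi> -` W = \<phi> ` (U \<inter> W)"
  using chart(5)[OF assms] by auto

lemma chart_at: obtains U \<phi> where "(U, \<phi>) \<in> A" "x \<in> U"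
proof -
  have "x \<in> (\<Union>c\<in>A. fst c)"
    using atlas by (simp add: smooth_atlas_def)
  then show thesis
    using that by (metis UN_E prod.collapse)
qed

lemma F_iff: "f \<in> F \<longleftrightarrow> (\<forall>(U, \<phi>)\<in>A. \<forall>k. Ck_on k (\<phi> ` U) (\<lambda>p. f (inv_into U \<phi> p)))"
  by (simp add: smooth_functions_def smooth_on_def o_def)

lemma F_const [simp]: "(\<lambda>x. c) \<in> F"
  unfolding F_iff by (simp add: Ck_on_const)

lemma F_add [simp]: "f \<in> F \<Longrightarrow> g \<in> F \<Longrightarrow> (\<lambda>x. f x + g x) \<in> F"
  unfolding F_iff using chart(2) by (fast intro: Ck_on_add)

lemma F_mult [simp]: "f \<in> F \<Longrightarrow> g \<in> F \<Longrightarrow> (\<lambda>x. f x * g x) \<in> F"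
  unfolding F_iff using chart(2) by (fast intro: Ck_on_mult)

lemma F_exp: "f \<in> F \<Longrightarrow> (\<lambda>x. exp (f x)) \<in> F"
  unfolding F_iff using chart(2) by (fast intro: Ck_on_exp)

lemma F_flat_exp: "f \<in> F \<Longrightarrow> (\<lambda>x. flat_exp n (f x)) \<in> F"
  unfolding F_iff using chart(2) by (fast intro: Ck_on_flat_exp)

lemma F_inverse:
  assumes "f \<in> F" "\<And>x. f x \<noteq> 0"
  shows "(\<lambda>x. inverse (f x)) \<in> F"
  using assms(1) unfolding F_iff
  by (auto intro!: Ck_on_inverse chart(2) simp: assms(2))

lemma F_minus [simp]: "f \<in> F \<Longrightarrow> (\<lambda>x. - f x) \<in> F"
  using F_mult[OF F_const[of "-1"]] by simp

lemma F_diff [simp]: "f \<in> F \<Longrightarrow> g \<in> F \<Longrightarrow> (\<lambda>x. f x - g x) \<in> F"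
  using F_add[OF _ F_minus] by simp

lemma F_divide [simp]: "f \<in> F \<Longrightarrow> (\<lambda>x. f x / c) \<in> F"
  using F_mult[OF F_const[of "inverse c"]] by (simp add: divide_inverse mult.commute)

lemma F_local:
  assumes "\<And>x. \<exists>g\<in>F. eventually (\<lambda>y. f y = g y) (nhds x)"
  shows "f \<in> F"
  unfolding F_iff
proof (clarify)
  fix U \<phi> k assume U: "(U, \<phi>) \<in> A"
  show "Ck_on k (\<phi> ` U) (\<lambda>p. f (inv_into U \<phi> p))"
  proof (rule Ck_on_local)
    fix p assume p: "p \<in> \<phi> ` U"
    obtain g where g: "g \<in> F" "eventually (\<lambda>y. f y = g y) (nhds (inv_into U \<phi> p))"
      using assms by blast
    then obtain W where W: "open W" "inv_into U \<phi> p \<in> W" "\<And>y. y \<in> W \<Longrightarrow> f y = g y"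
      unfolding eventually_nhds by blast
    have "Ck_on k (\<phi> ` U) (\<lambda>p. g (inv_into U \<phi> p))"
      using g(1) U unfolding F_iff by blast
    then have "Ck_on k (\<phi> ` U \<inter> inv_into U \<phi> -` W) (\<lambda>p. g (inv_into U \<phi> p))"
      by (rule Ck_on_subset) blast
    then show "\<exists>W' g'. open W' \<and> p \<in> W' \<and> Ck_on k W' g' \<and>
        (\<forall>q\<in>W'. f (inv_into U \<phi> q) = g' q)"
      using chart_open_preimage[OF U W(1)] p W(2,3)
      by (intro exI[of _ "\<phi> ` U \<inter> inv_into U \<phi> -` W"]
          exI[of _ "\<lambda>p. g (inv_into U \<phi> p)"]) auto
  qed
qed

text \<open>The choice \<open>q = 1\<close> gives a bump function, the other choices give cut-off coordinate functions.\<close>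

lemma chart_cutoff_smooth:
  assumes U: "(U, \<phi>) \<in> A" and x: "x \<in> U" and c: "0 < c" "cball (\<phi> x) c \<subseteq> \<phi> ` U"
    and qlin: "(\<exists>j. q = (\<lambda>p. p $ j)) \<or> q = (\<lambda>p. 1)"
  defines "B \<equiv> \<lambda>p. flat_exp 0 (c\<^sup>2 + - (\<Sum>i\<in>UNIV. (p $ i + - (\<phi> x $ i)) * (p $ i + - (\<phi> x $ i))))"
  shows "(\<lambda>y. if y \<in> U then q (\<phi> y) * B (\<phi> y) else 0) \<in> F"
    and "y \<in> U \<Longrightarrow> y \<notin> inv_into U \<phi> ` cball (\<phi> x) c \<Longrightarrow> B (\<phi> y) = 0"
proof -
  define h where "h = (\<lambda>y. if y \<in> U then q (\<phi> y) * B (\<phi> y) else 0)"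
  define K where "K = inv_into U \<phi> ` cball (\<phi> x) c"
  \<comment> \<open>Extension by zero is smooth because the support lies in a closed set: in a
    Hausdorff space the compact image of the ball is closed.\<close>
  have "compact K"
    unfolding K_def
    by (rule compact_continuous_image[OF continuous_on_subset[OF chart(4)[OF U] c(2)]]) simp
  then have K: "closed K"
    by (rule compact_imp_closed)
  have B0: "B p = 0" if "p \<notin> cball (\<phi> x) c" for p
  proof -
    have "c < norm (p - \<phi> x)"
      using that by (simp add: dist_norm norm_minus_commute)
    then have "c\<^sup>2 < (norm (p - \<phi> x))\<^sup>2"
      using c(1) by (intro power_strict_mono) auto
    also have "\<dots> = (\<Sum>i\<in>UNIV. (p $ i - \<phi> x $ i) * (p $ i - \<phi> x $ i))"
      unfolding power2_norm_eq_inner inner_vec_def by simp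
    finally show ?thesis
      by (simp add: B_def flat_exp_def)
  qed
  have BK: "B (\<phi> y) = 0" if "y \<in> U" "y \<notin> K" for y
  proof (rule B0)
    show "\<phi> y \<notin> cball (\<phi> x) c"
      using that chart(5)[OF U that(1)] unfolding K_def by force
  qed
  have h0: "h y = 0" if "y \<notin> K" for y
    using BK that by (simp add: h_def)
  have KU: "K \<subseteq> U"
    using c(2) unfolding K_def by (auto simp: inv_into_into)
  have "h \<in> F"
    unfolding F_iff
  proof clarify
    fix W \<psi> k assume W: "(W, \<psi>) \<in> A"
    show "Ck_on k (\<psi> ` W) (\<lambda>p. h (inv_into W \<psi> p))"
    proof (rule Ck_on_local)
      fix p assume p: "p \<in> \<psi> ` W"
      show "\<exists>S g. open S \<and> p \<in> S \<and> Ck_on k S g \<and> (\<forall>y\<in>S. h (inv_into W \<psi> y) = g y)"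
      \<comment> \<open>Near a point of \<open>U\<close> the transition map expresses the function
        in the other chart; near any other point it vanishes, as the complement of \<open>K\<close>
        is a neighbourhood.\<close>
      proof (cases "inv_into W \<psi> p \<in> U")
        case True
        define S where "S = \<psi> ` (W \<inter> U)"
        define T where "T = (\<lambda>p. \<phi> (inv_into W \<psi> p))"
        have S: "open S"
          using chart_open_preimage[OF W chart(1)[OF U]]
          unfolding S_def chart_preimage_eq[OF W] .
        have "smooth_on S (\<phi> \<circ> inv_into W \<psi>)"
          using atlas U W unfolding smooth_atlas_def S_def by fast
        then have T: "Ck_on k S T"
          by (simp add: smooth_on_def T_def o_def)
        have Ti: "Ck_on k S (\<lambda>p. T p $ i)" for i
          by (rule Ck_on_linear[OF bounded_linear_vec_nth S T])
        have s: "Ck_on k S (\<lambda>p. \<Sum>i\<in>I. g i p)"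
          if "\<And>i. Ck_on k S (g i)" for I :: "5 set" and g :: "5 \<Rightarrow> real^5 \<Rightarrow> real"
          by (induction I rule: infinite_finite_induct)
            (simp_all add: that Ck_on_const Ck_on_add S)
        have "Ck_on k S (\<lambda>p. q (T p))"
          using qlin Ti by (auto simp: Ck_on_const)
        then have "Ck_on k S (\<lambda>p. q (T p) * B (T p))"
          unfolding B_def
          by (intro Ck_on_mult Ck_on_flat_exp Ck_on_add Ck_on_minus S s Ti Ck_on_const)
        moreover have "p \<in> S"
          using p True unfolding S_def chart_preimage_eq[OF W, symmetric] by blast
        moreover have "h (inv_into W \<psi> y) = q (T y) * B (T y)" if "y \<in> S" for y
          using that unfolding S_def chart_preimage_eq[OF W, symmetric] by (simp add: h_def T_def)
        ultimately show ?thesis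
          using S by blast
      next
        case False
        have "open (\<psi> ` W \<inter> inv_into W \<psi> -` (- K))"
          using chart_open_preimage[OF W] K by blast
        moreover have "p \<in> \<psi> ` W \<inter> inv_into W \<psi> -` (- K)"
          using False KU p by blast
        moreover have "\<forall>y\<in>\<psi> ` W \<inter> inv_into W \<psi> -` (- K). h (inv_into W \<psi> y) = 0"
          using h0 by blast
        ultimately show ?thesis
          using Ck_on_const by blast
      qed
    qed
  qed
  then show "(\<lambda>y. if y \<in> U then q (\<phi> y) * B (\<phi> y) else 0) \<in> F"
    by (simp add: h_def)
  show "y \<in> U \<Longrightarrow> y \<notin> inv_into U \<phi> ` cball (\<phi> x) c \<Longrightarrow> B (\<phi> y) = 0"
    using BK by (simp add: K_def)
qed

lemma F_isCont:
  assumes "f \<in> F"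
  shows "isCont f x"
proof -
  obtain U \<phi> where U: "(U, \<phi>) \<in> A" "x \<in> U"
    by (rule chart_at)
  have "Ck_on 0 (\<phi> ` U) (\<lambda>p. f (inv_into U \<phi> p))"
    using assms U(1) unfolding F_iff by blast
  then have "continuous_on U (\<lambda>y. f (inv_into U \<phi> (\<phi> y)))"
    using continuous_on_compose2[OF _ chart(3)[OF U(1)]] by force
  then have "continuous_on U f"
    using chart(5)[OF U(1)] by (simp cong: continuous_on_cong_simp)
  then show ?thesis
    using chart(1)[OF U(1)] U(2) continuous_on_eq_continuous_at by blast
qed

lemma F_eventually:
  assumes "f \<in> F" "open S" "f x \<in> S"
  shows "eventually (\<lambda>y. f y \<in> S) (nhds x)"
  using F_isCont[OF assms(1), of x] assms(2,3)
  unfolding continuous_at_open eventually_nhds by blast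

text \<open>The quotient of q by q^2 plus a flat term stands in for 1/q, which may be undefined far
  from \<open>x\<close>. Near \<open>x\<close> one has q^2 > c, the flat term vanishes and the
  product with \<open>q\<close> is 1; where \<open>q\<close> vanishes the flat term is positive and
  keeps the denominator nonzero.\<close>

lemma F_local_inverse:
  assumes q: "q \<in> F" and "q x \<noteq> 0"
  obtains p where "p \<in> F" "eventually (\<lambda>y. p y * q y = 1) (nhds x)"
proof
  define c where "c = q x * q x / 2"
  define D where "D = (\<lambda>y. q y * q y + flat_exp 0 (c - q y * q y))"
  have c: "0 < c" "c < q x * q x"
    using assms(2) by (simp_all add: c_def flip: power2_eq_square)
  have "D y \<noteq> 0" for y
  proof (cases "q y = 0")
    case True
    then show ?thesis using c by (simp add: D_def flat_exp_def)
  next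
    case False
    then have "0 < q y * q y" by (simp flip: power2_eq_square)
    moreover have "0 \<le> flat_exp 0 (c - q y * q y)" by (simp add: flat_exp_def)
    ultimately show ?thesis by (simp add: D_def)
  qed
  then show "(\<lambda>y. q y * inverse (D y)) \<in> F"
    using q unfolding D_def by (intro F_mult F_inverse F_add F_flat_exp F_diff F_const) auto
  have "eventually (\<lambda>y. q y * q y \<in> {c<..}) (nhds x)"
    using q c by (intro F_eventually F_mult) auto
  then show "eventually (\<lambda>y. q y * inverse (D y) * q y = 1) (nhds x)"
  proof eventually_elim
    case (elim y)
    then have "q y \<noteq> 0" using c by auto
    with elim show ?case by (simp add: D_def flat_exp_def field_simps)
  qed
qed

text \<open>The bump of \<open>chart_cutoff_smooth\<close> is only known to be nonzero at
  \<open>x\<close>; multiplying it by a local inverse makes it 1 near \<open>x\<close> without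
  enlarging its support.\<close>

lemma chart_cutoff_exists:
  assumes "open W" "x \<in> W"
  obtains U \<phi> b where "(U, \<phi>) \<in> A" "x \<in> U" "b \<in> F" "eventually (\<lambda>y. b y = 1) (nhds x)"
    "\<And>y. y \<notin> W \<Longrightarrow> b y = 0"
    "\<And>j. (\<lambda>y. if y \<in> U then \<phi> y $ j * b y else 0) \<in> F"
proof -
  obtain U \<phi> where U: "(U, \<phi>) \<in> A" "x \<in> U"
    by (rule chart_at)
  have "open (\<phi> ` (U \<inter> W))"
    using chart_open_preimage[OF U(1) assms(1)] chart_preimage_eq[OF U(1)] by simp
  then obtain c where c: "0 < c" "cball (\<phi> x) c \<subseteq> \<phi> ` (U \<inter> W)"
    using assms(2) U(2) open_contains_cball by (metis IntI imageI)
  then have cU: "cball (\<phi> x) c \<subseteq> \<phi> ` U" by blast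
  define B where "B = (\<lambda>p. flat_exp 0
    (c\<^sup>2 + - (\<Sum>i\<in>UNIV. (p $ i + - (\<phi> x $ i)) * (p $ i + - (\<phi> x $ i)))))"
  define h where "h = (\<lambda>y. if y \<in> U then B (\<phi> y) else 0)"
  have cutoff: "(\<lambda>y. if y \<in> U then q (\<phi> y) * B (\<phi> y) else 0) \<in> F"
    if "(\<exists>j. q = (\<lambda>p. p $ j)) \<or> q = (\<lambda>p. 1)" for q
    unfolding B_def by (rule chart_cutoff_smooth(1)[OF U c(1) cU that])
  have hF: "h \<in> F"
    using cutoff[of "\<lambda>p. 1"] by (simp add: h_def cong: if_cong)
  have hj: "(\<lambda>y. if y \<in> U then \<phi> y $ j * h y else 0) \<in> F" for j
  proof -
    have "(\<lambda>y. if y \<in> U then \<phi> y $ j * B (\<phi> y) else 0) \<in> F"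
      by (rule cutoff) blast
    moreover have "(\<lambda>y. if y \<in> U then \<phi> y $ j * B (\<phi> y) else 0)
        = (\<lambda>y. if y \<in> U then \<phi> y $ j * h y else 0)"
      by (auto simp: h_def)
    ultimately show ?thesis by simp
  qed
  have "h x \<noteq> 0"
    using U(2) c(1) by (simp add: h_def B_def flat_exp_def)
  then obtain p where p: "p \<in> F" "eventually (\<lambda>y. p y * h y = 1) (nhds x)"
    using F_local_inverse[OF hF] by blast
  show thesis
  proof (rule that[OF U, of "\<lambda>y. p y * h y"])
    show "(\<lambda>y. p y * h y) \<in> F" using p hF by simp
    show "eventually (\<lambda>y. p y * h y = 1) (nhds x)" by (rule p)
    show "(\<lambda>y. if y \<in> U then \<phi> y $ j * (p y * h y) else 0) \<in> F" for j
    proof -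
      have "(\<lambda>y. if y \<in> U then \<phi> y $ j * (p y * h y) else 0)
          = (\<lambda>y. p y * (if y \<in> U then \<phi> y $ j * h y else 0))"
        by auto
      then show ?thesis using F_mult[OF p(1) hj] by simp
    qed
    fix y assume "y \<notin> W"
    let ?K = "inv_into U \<phi> ` cball (\<phi> x) c"
    have "y \<notin> ?K"
      using c(2) \<open>y \<notin> W\<close> chart(5)[OF U(1)] by auto
    then show "p y * h y = 0"
      using chart_cutoff_smooth(2)[OF U c(1) cU] by (auto simp: h_def B_def)
  qed
qed

lemma bump_exists:
  assumes "eventually P (nhds x)"
  shows "\<exists>b\<in>F. eventually (\<lambda>y. b y = 1) (nhds x) \<and> b x = 1 \<and> (\<forall>y. \<not> P y \<longrightarrow> b y = 0)"
proof -
  obtain W where W: "open W" "x \<in> W" "\<And>y. y \<in> W \<Longrightarrow> P y"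
    using assms unfolding eventually_nhds by blast
  obtain b where b: "b \<in> F" "eventually (\<lambda>y. b y = 1) (nhds x)"
      "\<And>y. y \<notin> W \<Longrightarrow> b y = 0"
    using chart_cutoff_exists[OF W(1,2)] by metis
  have "b x = 1" using b(2) by (rule eventually_nhds_x_imp_x)
  then show ?thesis using b W(3) by blast
qed

section \<open>Tangent vectors and vector fields\<close>

lemma tangent_space_iff:
  "v \<in> tangent_space A x \<longleftrightarrow>
    (\<forall>f\<in>F. \<forall>g\<in>F. v (\<lambda>y. f y + g y) = v f + v g) \<and>
    (\<forall>f\<in>F. \<forall>g\<in>F. v (\<lambda>y. f y * g y) = f x * v g + g x * v f) \<and>
    (\<forall>c. \<forall>f\<in>F. v (\<lambda>y. c * f y) = c * v f) \<and> (\<forall>f. f \<notin> F \<longrightarrow> v f = 0)"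
  unfolding tangent_space_def plus_fun_def times_fun_def scaleR_fun_def real_scaleR_def by blast

lemma tangent:
  assumes "v \<in> tangent_space A x" 
  shows tangent_add: "f \<in> F \<Longrightarrow> g \<in> F \<Longrightarrow> v (\<lambda>y. f y + g y) = v f + v g"
    and tangent_mult: "f \<in> F \<Longrightarrow> g \<in> F \<Longrightarrow> v (\<lambda>y. f y * g y) = f x * v g + g x * v f"
    and tangent_scale: "f \<in> F \<Longrightarrow> v (\<lambda>y. c * f y) = c * v f"
    and tangent_nonsmooth: "h \<notin> F \<Longrightarrow> v h = 0"
    and tangent_const: "v (\<lambda>y. c) = 0"
    and tangent_minus: "f \<in> F \<Longrightarrow> v (\<lambda>y. - f y) = - v f"
    and tangent_diff: "f \<in> F \<Longrightarrow> g \<in> F \<Longrightarrow> v (\<lambda>y. f y - g y) = v f - v g"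
proof -
  note v = assms[unfolded tangent_space_iff]
  show add: "f \<in> F \<Longrightarrow> g \<in> F \<Longrightarrow> v (\<lambda>y. f y + g y) = v f + v g" for f g
    using v by blast
  show mult: "f \<in> F \<Longrightarrow> g \<in> F \<Longrightarrow> v (\<lambda>y. f y * g y) = f x * v g + g x * v f" for f g
    using v by blast
  show scale: "f \<in> F \<Longrightarrow> v (\<lambda>y. c * f y) = c * v f" for f c
    using v by blast
  show "h \<notin> F \<Longrightarrow> v h = 0"
    using v by blast
  have "v (\<lambda>y. 1 * 1) = 1 * v (\<lambda>y. 1) + 1 * v (\<lambda>y. 1)"
    by (rule mult) auto
  then have "v (\<lambda>y. 1) = 0" by simp
  then show "v (\<lambda>y. c) = 0"
    using scale[of "\<lambda>y. 1" c] by simp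
  show minus: "f \<in> F \<Longrightarrow> v (\<lambda>y. - f y) = - v f" for f
    using scale[of f "-1"] by simp
  show "f \<in> F \<Longrightarrow> g \<in> F \<Longrightarrow> v (\<lambda>y. f y - g y) = v f - v g"
    using add[of f "\<lambda>y. - g y"] minus[of g] by simp
qed

text \<open>For a bump function \<open>b\<close> that vanishes wherever \<open>f\<close> and
  \<open>g\<close> differ, \<open>b * (f - g)\<close> is identically zero. The Leibniz rule at
  \<open>x\<close>, where \<open>b\<close> is 1 and \<open>f - g\<close> is 0, leaves
  \<open>v f - v g\<close>.\<close>

lemma tangent_local:
  assumes v: "v \<in> tangent_space A x" and fg: "f \<in> F" "g \<in> F" "eventually (\<lambda>y. f y = g y) (nhds x)"
  shows "v f = v g"
proof -
  obtain b where b: "b \<in> F" "b x = 1" "\<forall>y. f y \<noteq> g y \<longrightarrow> b y = 0"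
    using bump_exists[OF fg(3)] by blast
  have "(\<lambda>y. b y * (f y - g y)) = (\<lambda>y. 0)"
    using b(3) by fastforce
  then have "0 = v (\<lambda>y. b y * (f y - g y))"
    using tangent_const[OF v] by metis
  also have "\<dots> = v f - v g"
    using eventually_nhds_x_imp_x[OF fg(3)] b fg by (simp add: tangent_mult[OF v] tangent_diff[OF v])
  finally show ?thesis by simp
qed

lemma subspace_tangent_space: "subspace (tangent_space A x)"
  unfolding subspace_def
proof (intro conjI ballI allI)
  show "0 \<in> tangent_space A x"
    by (simp add: tangent_space_iff)
next
  fix v w assume "v \<in> tangent_space A x" "w \<in> tangent_space A x"
  note t = tangent_add[OF this(1)] tangent_add[OF this(2)] tangent_mult[OF this(1)]
    tangent_mult[OF this(2)] tangent_scale[OF this(1)] tangent_scale[OF this(2)]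
    tangent_nonsmooth[OF this(1)] tangent_nonsmooth[OF this(2)]
    tangent_const[OF this(1)] tangent_const[OF this(2)]
  show "v + w \<in> tangent_space A x"
    unfolding tangent_space_iff plus_fun_apply
    by (intro conjI ballI allI impI) (simp_all add: t algebra_simps)
next
  fix k v assume "v \<in> tangent_space A x"
  note t = tangent_add[OF this(1)] tangent_mult[OF this(1)] tangent_scale[OF this(1)]
    tangent_nonsmooth[OF this(1)] tangent_const[OF this(1)]
  show "k *\<^sub>R v \<in> tangent_space A x"
    unfolding tangent_space_iff scaleR_fun_def real_scaleR_def
    by (intro conjI ballI allI impI) (simp_all add: t algebra_simps)
qed

text \<open>Partial derivatives in a chart, tested on cut-off coordinates, which near
  \<open>x\<close> are the true ones. They bound the dimension of the tangent space from below; the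
  bound from above comes from genericity.\<close>

lemma coordinate_tangent_vectors:
  obtains d :: "5 \<Rightarrow> 'a tangent" and c :: "5 \<Rightarrow> 'a \<Rightarrow> real"
  where "\<And>i. d i \<in> tangent_space A x" "\<And>j. c j \<in> F" "\<And>i j. d i (c j) = (if i = j then 1 else 0)"
proof -
  obtain U \<phi> b where U: "(U, \<phi>) \<in> A" "x \<in> U" and b: "b \<in> F" "eventually (\<lambda>y. b y = 1) (nhds x)"
    and c: "\<And>j. (\<lambda>y. if y \<in> U then \<phi> y $ j * b y else 0) \<in> F"
    using chart_cutoff_exists[of UNIV x] by auto
  define G where "G f = (\<lambda>p. f (inv_into U \<phi> p))" for f :: "'a \<Rightarrow> real"
  define D where "D f = frechet_derivative (G f) (at (\<phi> x))" for f
  \<comment> \<open>The value 0 off \<open>F\<close> is the normalisation built into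
    \<open>tangent_space\<close>.\<close>
  define d where "d i f = (if f \<in> F then D f (axis i 1) else 0)" for i f
  define c where "c j y = (if y \<in> U then \<phi> y $ j * b y else 0)" for j y
  have x: "inv_into U \<phi> (\<phi> x) = x" by (rule chart(5)[OF U])
  have D: "(G f has_derivative D f) (at (\<phi> x))" if "f \<in> F" for f
  proof -
    have "Ck_on (Suc 0) (\<phi> ` U) (G f)"
      using that U(1) unfolding F_iff G_def by blast
    then show ?thesis
      unfolding D_def by (rule Ck_on_SucD(1)) (use U in blast)
  qed
  have DI: "D f = D'" if "(G f has_derivative D') (at (\<phi> x))" for f D'
    unfolding D_def using frechet_derivative_at[OF that] by simp
  have add: "D (\<lambda>y. f y + g y) = (\<lambda>w. D f w + D g w)" if "f \<in> F" "g \<in> F" for f g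
    by (rule DI) (use has_derivative_add[OF D[OF that(1)] D[OF that(2)]] in \<open>simp add: G_def\<close>)
  have mult: "D (\<lambda>y. f y * g y) = (\<lambda>w. f x * D g w + D f w * g x)" if "f \<in> F" "g \<in> F" for f g
    by (rule DI) (use has_derivative_mult[OF D[OF that(1)] D[OF that(2)]] in \<open>simp add: G_def x\<close>)
  have scale: "D (\<lambda>y. k * f y) = (\<lambda>w. k * D f w)" if "f \<in> F" for f k
    by (rule DI) (use has_derivative_mult_right[OF D[OF that]] in \<open>simp add: G_def\<close>)
  have const: "D (\<lambda>y. k) = (\<lambda>w. 0)" for k
    by (rule DI) (simp add: G_def)
  show thesis
  proof (rule that[of d c])
    show "d i \<in> tangent_space A x" for i
      unfolding tangent_space_iff
      by (intro conjI ballI allI impI) (simp_all add: d_def add mult scale const)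
    show cF: "c j \<in> F" for j
      unfolding c_def by (rule c)
    fix i j
    show "d i (c j) = (if i = j then 1 else 0)"
    proof -
      obtain W where W: "open W" "x \<in> W" "\<And>y. y \<in> W \<Longrightarrow> b y = 1"
        using b(2) unfolding eventually_nhds by blast
      let ?S = "\<phi> ` U \<inter> inv_into U \<phi> -` W"
      have "((\<lambda>p. p $ j) has_derivative (\<lambda>p. p $ j)) (at (\<phi> x))"
        by (intro bounded_linear_imp_has_derivative bounded_linear_vec_nth)
      then have "(G (c j) has_derivative (\<lambda>p. p $ j)) (at (\<phi> x))"
        by (rule has_derivative_transform_within_open[OF _ chart_open_preimage[OF U(1) W(1)]])
          (use U W x in \<open>auto simp: G_def c_def chart(5)[OF U(1)]\<close>)
      then have "D (c j) = (\<lambda>p. p $ j)" by (rule DI)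
      then show ?thesis by (auto simp: d_def cF axis_def)
    qed
  qed
qed

lemma V_tangent: "X \<in> V \<Longrightarrow> X x \<in> tangent_space A x"
  by (simp add: vector_fields_def)

text \<open>A vector field takes the point before the function; in the opposite order the derivative
  is again a function, to which another field can be applied.\<close>

definition dir :: "'a vfield \<Rightarrow> ('a \<Rightarrow> real) \<Rightarrow> 'a \<Rightarrow> real"
  where "dir X f = (\<lambda>x. X x f)"

lemma dir_F [simp]: "X \<in> V \<Longrightarrow> f \<in> F \<Longrightarrow> dir X f \<in> F"
  by (simp add: dir_def vector_fields_def)

lemma V_F: "X \<in> V \<Longrightarrow> f \<in> F \<Longrightarrow> (\<lambda>x. X x f) \<in> F"
  using dir_F by (simp add: dir_def)

lemma dir_fun [simp]:
  assumes "X \<in> V" "f \<in> F"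
  shows "g \<in> F \<Longrightarrow> dir X (\<lambda>y. f y + g y) x = dir X f x + dir X g x"
    and "g \<in> F \<Longrightarrow> dir X (\<lambda>y. f y - g y) x = dir X f x - dir X g x"
    and "dir X (\<lambda>y. - f y) x = - dir X f x"
    and "dir X (\<lambda>y. c * f y) x = c * dir X f x"
    and "g \<in> F \<Longrightarrow> dir X (\<lambda>y. f y * g y) x = f x * dir X g x + g x * dir X f x"
  unfolding dir_def using assms
  by (simp_all add: tangent_add[OF V_tangent] tangent_diff[OF V_tangent] tangent_minus[OF V_tangent]
      tangent_scale[OF V_tangent] tangent_mult[OF V_tangent])

lemma dir_fun_eq:
  assumes "X \<in> V" "f \<in> F" "g \<in> F"
  shows "dir X (\<lambda>y. f y + g y) = (\<lambda>x. dir X f x + dir X g x)"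
    and "dir X (\<lambda>y. f y * g y) = (\<lambda>x. f x * dir X g x + g x * dir X f x)"
  using assms by (simp_all add: fun_eq_iff)

lemma dir_const [simp]: "X \<in> V \<Longrightarrow> dir X (\<lambda>y. c) x = 0"
  unfolding dir_def using tangent_const[OF V_tangent] .

lemma V_nonsmooth: "X \<in> V \<Longrightarrow> f \<notin> F \<Longrightarrow> dir X f x = 0"
  unfolding dir_def using tangent_nonsmooth[OF V_tangent] .

lemma dir_field [simp]:
  "dir (X + Y) f x = dir X f x + dir Y f x"
  "dir (X - Y) f x = dir X f x - dir Y f x"
  "dir (- X) f x = - dir X f x"
  "dir 0 f x = 0"
  "dir (fscale h X) f x = h x * dir X f x"
  "dir (lie_bracket X Y) f x = dir X (dir Y f) x - dir Y (dir X f) x"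
  by (simp_all add: dir_def fscale_def scaleR_fun_def lie_bracket_def)

lemma V_local:
  "X \<in> V \<Longrightarrow> f \<in> F \<Longrightarrow> g \<in> F \<Longrightarrow> eventually (\<lambda>y. f y = g y) (nhds x) \<Longrightarrow> dir X f x = dir X g x"
  unfolding dir_def using tangent_local[OF V_tangent] .

lemma V_I:
  assumes "\<And>x. X x \<in> tangent_space A x" "\<And>f. f \<in> F \<Longrightarrow> dir X f \<in> F"
  shows "X \<in> V"
  using assms by (simp add: vector_fields_def dir_def)

lemma dir_field_fun:
  "dir (X + Y) f = (\<lambda>x. dir X f x + dir Y f x)"
  "dir (X - Y) f = (\<lambda>x. dir X f x - dir Y f x)"
  "dir (fscale h X) f = (\<lambda>x. h x * dir X f x)"
  "dir (lie_bracket X Y) f = (\<lambda>x. dir X (dir Y f) x - dir Y (dir X f) x)"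
  by (simp_all add: fun_eq_iff)

lemma V_0 [simp]: "0 \<in> V"
  by (rule V_I) (simp_all add: subspace_0[OF subspace_tangent_space] dir_def)

lemma V_add [simp]: "X \<in> V \<Longrightarrow> Y \<in> V \<Longrightarrow> X + Y \<in> V"
  by (rule V_I) (simp_all add: subspace_add[OF subspace_tangent_space] V_tangent dir_field_fun)

lemma V_fscale [simp]: "h \<in> F \<Longrightarrow> X \<in> V \<Longrightarrow> fscale h X \<in> V"
  by (rule V_I)
    (simp_all add: fscale_def[of h X] subspace_scale[OF subspace_tangent_space] V_tangent
      dir_field_fun(3)[unfolded fscale_def])

lemma V_minus [simp]: "X \<in> V \<Longrightarrow> - X \<in> V"
proof -
  have "- X = fscale (\<lambda>x. -1) X" by (simp add: fun_eq_iff fscale_def scaleR_fun_def)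
  then show "X \<in> V \<Longrightarrow> - X \<in> V" by simp
qed

lemma V_diff [simp]: "X \<in> V \<Longrightarrow> Y \<in> V \<Longrightarrow> X - Y \<in> V"
  using V_add[OF _ V_minus] by simp

lemma V_bracket [simp]:
  assumes X: "X \<in> V" and Y: "Y \<in> V"
  shows "lie_bracket X Y \<in> V"
proof (rule V_I)
  show "dir (lie_bracket X Y) f \<in> F" if "f \<in> F" for f
    using assms that by (simp add: dir_field_fun)
  have e: "lie_bracket X Y x f = dir X (dir Y f) x - dir Y (dir X f) x" for x f
    by (simp add: lie_bracket_def dir_def)
  have l: "dir Z (\<lambda>y. f y + g y) = (\<lambda>x. dir Z f x + dir Z g x)"
      "dir Z (\<lambda>y. f y * g y) = (\<lambda>x. f x * dir Z g x + g x * dir Z f x)"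
      "dir Z (\<lambda>y. c * f y) = (\<lambda>x. c * dir Z f x)"
    if "f \<in> F" "g \<in> F" "Z \<in> V" for f g c Z
    using that by (simp_all add: fun_eq_iff)
  show "lie_bracket X Y x \<in> tangent_space A x" for x
    unfolding tangent_space_iff e
  proof (intro conjI ballI allI impI)
    fix f assume "f \<notin> F"
    then have "dir X f = (\<lambda>x. 0)" "dir Y f = (\<lambda>x. 0)"
      using assms by (simp_all add: fun_eq_iff V_nonsmooth)
    then show "dir X (dir Y f) x - dir Y (dir X f) x = 0"
      using assms by simp
  qed (use assms in \<open>simp_all add: l algebra_simps\<close>)
qed

lemma V_eqI:
  assumes "X \<in> V" "Y \<in> V" "\<And>x f. f \<in> F \<Longrightarrow> dir X f x = dir Y f x"
  shows "X = Y"
proof (intro ext)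
  fix x f
  have "dir X f x = dir Y f x"
    using assms by (cases "f \<in> F") (simp_all add: V_nonsmooth)
  then show "X x f = Y x f"
    by (simp add: dir_def)
qed

lemma bracket_anti: "lie_bracket X Y = - lie_bracket Y X"
  by (simp add: fun_eq_iff lie_bracket_def)

lemma bracket_self [simp]: "lie_bracket X X = 0"
  by (simp add: fun_eq_iff lie_bracket_def)

lemma bracket_add_left:
  "X \<in> V \<Longrightarrow> Y \<in> V \<Longrightarrow> Z \<in> V \<Longrightarrow> lie_bracket (X + Y) Z = lie_bracket X Z + lie_bracket Y Z"
  by (rule V_eqI) (simp_all add: dir_field_fun)

lemma bracket_add_right:
  "X \<in> V \<Longrightarrow> Y \<in> V \<Longrightarrow> Z \<in> V \<Longrightarrow> lie_bracket Z (X + Y) = lie_bracket Z X + lie_bracket Z Y"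
  by (rule V_eqI) (simp_all add: dir_field_fun)

lemma bracket_diff_left:
  "X \<in> V \<Longrightarrow> Y \<in> V \<Longrightarrow> Z \<in> V \<Longrightarrow> lie_bracket (X - Y) Z = lie_bracket X Z - lie_bracket Y Z"
  by (rule V_eqI) (simp_all add: dir_field_fun)

lemma bracket_diff_right:
  "X \<in> V \<Longrightarrow> Y \<in> V \<Longrightarrow> Z \<in> V \<Longrightarrow> lie_bracket Z (X - Y) = lie_bracket Z X - lie_bracket Z Y"
  by (rule V_eqI) (simp_all add: dir_field_fun)

lemma bracket_fscale_right:
  "X \<in> V \<Longrightarrow> Y \<in> V \<Longrightarrow> h \<in> F \<Longrightarrow>
    lie_bracket X (fscale h Y) = fscale h (lie_bracket X Y) + fscale (dir X h) Y"
  by (rule V_eqI) (simp_all add: dir_field_fun algebra_simps)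

lemma bracket_fscale_left:
  "X \<in> V \<Longrightarrow> Y \<in> V \<Longrightarrow> h \<in> F \<Longrightarrow>
    lie_bracket (fscale h X) Y = fscale h (lie_bracket X Y) - fscale (dir Y h) X"
  by (rule V_eqI) (simp_all add: dir_field_fun algebra_simps)

lemma bracket_jacobi:
  "X \<in> V \<Longrightarrow> Y \<in> V \<Longrightarrow> Z \<in> V \<Longrightarrow>
    lie_bracket X (lie_bracket Y Z) = lie_bracket (lie_bracket X Y) Z + lie_bracket Y (lie_bracket X Z)"
  by (rule V_eqI) (simp_all add: dir_field_fun)

lemma bracket_local:
  assumes "X \<in> V" "Y \<in> V" "X' \<in> V" "Y' \<in> V"
    and "eventually (\<lambda>y. X y = X' y) (nhds x)" "eventually (\<lambda>y. Y y = Y' y) (nhds x)"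
  shows "lie_bracket X Y x = lie_bracket X' Y' x"
proof
  fix f
  have X: "X x = X' x" "Y x = Y' x"
    using assms(5,6) by (auto dest: eventually_nhds_x_imp_x)
  show "lie_bracket X Y x f = lie_bracket X' Y' x f"
  proof (cases "f \<in> F")
    case True
    have "dir X' (dir Y f) x = dir X' (dir Y' f) x"
      by (rule V_local) (use assms True in \<open>simp_all add: dir_def eventually_mono V_F\<close>)
    moreover have "dir Y' (dir X f) x = dir Y' (dir X' f) x"
      by (rule V_local) (use assms True in \<open>simp_all add: dir_def eventually_mono V_F\<close>)
    ultimately show ?thesis
      by (simp add: lie_bracket_def dir_def X)
  qed (use assms V_nonsmooth[of "lie_bracket X Y" f x] V_nonsmooth[of "lie_bracket X' Y'" f x]
      in \<open>simp add: dir_def\<close>)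
qed

text \<open>The bracket of a section of \<open>T2\<close> with a section of \<open>H\<close>,
  explicit modulo \<open>H\<close>. Along the triple brackets the coefficients are free of
  derivatives, which is why the Levi bracket is a tensor; \<open>n = 0\<close> gives the bracket of
  two sections of \<open>H\<close>.\<close>

lemma lie_bracket_frame:
  assumes X: "X \<in> V" and Y: "Y \<in> V" and F: "h \<in> F" "k \<in> F" "l \<in> F" "m \<in> F" "n \<in> F"
  defines "Z \<equiv> lie_bracket X Y"
  shows "\<exists>p\<in>F. \<exists>q\<in>F. lie_bracket (fscale l X + fscale m Y + fscale n Z) (fscale h X + fscale k Y)
    = fscale p X + fscale q Y
      + fscale (\<lambda>x. l x * k x - m x * h x - h x * dir X n x - k x * dir Y n x) Z
      + fscale (\<lambda>x. - (h x * n x)) (lie_bracket X Z) + fscale (\<lambda>x. - (k x * n x)) (lie_bracket Y Z)"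
proof -
  have Z: "Z \<in> V" using X Y by (simp add: Z_def)
  show ?thesis
    by (rule bexI[of _ "\<lambda>x. l x * dir X h x + m x * dir Y h x + n x * dir Z h x - h x * dir X l x - k x * dir Y l x"],
        rule bexI[of _ "\<lambda>x. l x * dir X k x + m x * dir Y k x + n x * dir Z k x - h x * dir X m x - k x * dir Y m x"],
        rule V_eqI)
      (use F X Y Z in \<open>simp_all add: Z_def dir_field_fun dir_fun_eq algebra_simps\<close>)
qed

text \<open>Tangency and smoothness are local conditions. Objects that are unique at each point and
  have smooth representatives near it become global vector fields in this way.\<close>

lemma V_glue:
  assumes "\<And>x. \<exists>Y\<in>V. eventually (\<lambda>y. X y = Y y) (nhds x)"
  shows "X \<in> V"
proof (rule V_I)
  fix x
  obtain Y where "Y \<in> V" "eventually (\<lambda>y. X y = Y y) (nhds x)"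
    using assms by blast
  then show "X x \<in> tangent_space A x"
    using V_tangent[of Y x] eventually_nhds_x_imp_x by fastforce
next
  fix f assume "f \<in> F"
  show "dir X f \<in> F"
  proof (rule F_local)
    fix x
    obtain Y where Y: "Y \<in> V" "eventually (\<lambda>y. X y = Y y) (nhds x)"
      using assms by blast
    show "\<exists>g\<in>F. eventually (\<lambda>y. dir X f y = g y) (nhds x)"
      using Y(2) by (intro bexI[of _ "dir Y f"]) (auto simp: Y(1) \<open>f \<in> F\<close> dir_def[abs_def] V_F elim: eventually_mono)
  qed
qed

section \<open>One-forms and adapted frames\<close>

text \<open>Linear on all functionals, beyond tangent vectors: forms built from \<open>v f\<close>
  have this property, and linearity can then be used without checking tangency.\<close>

definition one_form :: "('a \<Rightarrow> 'a tangent \<Rightarrow> real) \<Rightarrow> bool"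
  where "one_form \<theta> \<longleftrightarrow> (\<forall>y. linear (\<theta> y)) \<and> (\<forall>X\<in>V. pairing \<theta> X \<in> F)"

lemma one_form_linear: "one_form \<theta> \<Longrightarrow> linear (\<theta> y)"
  by (simp add: one_form_def)

lemma one_form_F [simp]: "one_form \<theta> \<Longrightarrow> X \<in> V \<Longrightarrow> pairing \<theta> X \<in> F"
  by (simp add: one_form_def)

lemma one_formI:
  assumes "\<And>y v w. \<theta> y (v + w) = \<theta> y v + \<theta> y w" "\<And>y k v. \<theta> y (k *\<^sub>R v) = k * \<theta> y v"
    and "\<And>X. X \<in> V \<Longrightarrow> pairing \<theta> X \<in> F"
  shows "one_form \<theta>"
  unfolding one_form_def
proof (intro conjI allI ballI)
  show "linear (\<theta> y)" for y
    by (rule linearI) (simp_all only: assms real_scaleR_def)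
qed (rule assms(3))

lemma one_form_0: "one_form (\<lambda>y v. 0)"
  by (rule one_formI) (simp_all add: pairing_def)

lemma one_form_simps:
  assumes "one_form \<theta>"
  shows "\<theta> y (v + w) = \<theta> y v + \<theta> y w" "\<theta> y (v - w) = \<theta> y v - \<theta> y w"
    "\<theta> y (k *\<^sub>R v) = k * \<theta> y v" "\<theta> y (- v) = - \<theta> y v" "\<theta> y 0 = 0"
  using linear_add[OF one_form_linear[OF assms]] linear_diff[OF one_form_linear[OF assms]]
    linear_scale[OF one_form_linear[OF assms]] linear_neg[OF one_form_linear[OF assms]]
    linear_0[OF one_form_linear[OF assms]]
  by (simp_all only: real_scaleR_def)

lemma one_form_add:
  assumes "one_form \<theta>" "one_form \<theta>'"
  shows "one_form (\<lambda>y v. \<theta> y v + \<theta>' y v)"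
proof (rule one_formI)
  show "pairing (\<lambda>y v. \<theta> y v + \<theta>' y v) X \<in> F" if "X \<in> V" for X
    using F_add[OF one_form_F[OF assms(1) that] one_form_F[OF assms(2) that]]
    by (simp only: pairing_def)
qed (simp_all only: one_form_simps[OF assms(1)] one_form_simps[OF assms(2)] algebra_simps)

lemma one_form_scale:
  assumes "g \<in> F" "one_form \<theta>"
  shows "one_form (\<lambda>y v. g y * \<theta> y v)"
proof (rule one_formI)
  show "pairing (\<lambda>y v. g y * \<theta> y v) X \<in> F" if "X \<in> V" for X
    using F_mult[OF assms(1) one_form_F[OF assms(2) that]] by (simp only: pairing_def)
qed (simp_all only: one_form_simps[OF assms(2)] algebra_simps)

lemma one_form_diff:
  assumes "one_form \<theta>" "one_form \<theta>'"
  shows "one_form (\<lambda>y v. \<theta> y v - \<theta>' y v)"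
proof (rule one_formI)
  show "pairing (\<lambda>y v. \<theta> y v - \<theta>' y v) X \<in> F" if "X \<in> V" for X
    using F_diff[OF one_form_F[OF assms(1) that] one_form_F[OF assms(2) that]]
    by (simp only: pairing_def)
qed (simp_all only: one_form_simps[OF assms(1)] one_form_simps[OF assms(2)] algebra_simps)

lemma one_form_sum:
  assumes "\<And>i. i \<in> I \<Longrightarrow> one_form (\<theta> i)"
  shows "one_form (\<lambda>y v. \<Sum>i\<in>I. \<theta> i y v)"
  using assms
proof (induction I rule: infinite_finite_induct)
  case (insert i I)
  show ?case
    unfolding sum.insert[OF insert.hyps]
    by (rule one_form_add) (simp_all add: insert)
qed (simp_all add: one_form_0)

lemma one_form_differential:
  assumes "f \<in> F"
  shows "one_form (\<lambda>y v. v f)"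
proof (rule one_formI)
  show "pairing (\<lambda>y v. v f) X \<in> F" if "X \<in> V" for X
    using V_F[OF that assms] by (simp only: pairing_def)
qed (simp_all add: scaleR_fun_def)

text \<open>Gram-Schmidt with the differentials of functions in place of an inner product.\<close>

lemma coframe_exists:
  fixes e :: "nat \<Rightarrow> 'a vfield"
  assumes "\<And>i. i < k \<Longrightarrow> e i \<in> V" "\<And>i. i < k \<Longrightarrow> e i x \<notin> span ((\<lambda>j. e j x) ` {..<i})"
  shows "\<exists>w. (\<forall>i. one_form (w i)) \<and>
    eventually (\<lambda>y. \<forall>i<k. \<forall>j<k. w i y (e j y) = (if i = j then 1 else 0)) (nhds x)"
  using assms
proof (induction k)
  case 0
  show ?case using one_form_0 by (intro exI[of _ "\<lambda>i y v. 0"]) simp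
next
  case (Suc k)
  obtain w where w: "\<And>i. one_form (w i)"
    and wd: "eventually (\<lambda>y. \<forall>i<k. \<forall>j<k. w i y (e j y) = (if i = j then 1 else 0)) (nhds x)"
    using Suc.IH[OF Suc.prems(1) Suc.prems(2)] by auto
  define u where "u = e k x - (\<Sum>i<k. w i x (e k x) *\<^sub>R e i x)"
  have "(\<Sum>i<k. w i x (e k x) *\<^sub>R e i x) \<in> span ((\<lambda>j. e j x) ` {..<k})"
    by (intro span_sum span_scale span_base) auto
  then have "u \<noteq> 0"
    using Suc.prems(2)[of k] by (auto simp: u_def)
  then obtain f where f: "u f \<noteq> 0"
    by (auto simp: fun_eq_iff)
  have sum_apply: "(\<Sum>i\<in>I. g i *\<^sub>R v i) f = (\<Sum>i\<in>I. g i * v i f)"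
    for I :: "nat set" and g and v :: "nat \<Rightarrow> 'a tangent"
    by (induction I rule: infinite_finite_induct) (simp_all add: scaleR_fun_def)
  \<comment> \<open>\<open>u\<close> is a combination of tangent vectors, which are normalised to
    vanish on functions that are not smooth, so a function that detects \<open>u\<close> is
    smooth.\<close>
  have "f \<in> F"
  proof (rule ccontr)
    assume "f \<notin> F"
    then have "e i x f = 0" if "i \<le> k" for i
      using tangent_nonsmooth[OF V_tangent[OF Suc.prems(1)[of i]]] that by auto
    then have "u f = 0"
      by (simp add: u_def sum_apply)
    with f show False ..
  qed
  \<comment> \<open>The differential of \<open>f\<close> minus its components along the previous
    forms: near \<open>x\<close> it kills the earlier fields, and on \<open>e k\<close> at
    \<open>x\<close> it takes the value \<open>u f\<close>, which is nonzero.\<close>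
  define \<theta> where "\<theta> = (\<lambda>y v. v f - (\<Sum>i<k. dir (e i) f y * w i y v))"
  have \<theta>: "one_form \<theta>"
    unfolding \<theta>_def using \<open>f \<in> F\<close> w Suc.prems(1)
    by (intro one_form_diff one_form_differential one_form_sum one_form_scale) auto
  have ekV: "e k \<in> V" using Suc.prems(1) by simp
  have "pairing \<theta> (e k) x = u f"
    by (simp add: pairing_def \<theta>_def u_def sum_apply dir_def mult.commute)
  then obtain p where p: "p \<in> F" "eventually (\<lambda>y. p y * pairing \<theta> (e k) y = 1) (nhds x)"
    using F_local_inverse[of "pairing \<theta> (e k)" x] \<theta> ekV f by auto
  define W where "W = (\<lambda>y v. p y * \<theta> y v)"
  have W: "one_form W"
    unfolding W_def by (rule one_form_scale[OF p(1) \<theta>])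
  define w' where "w' i = (if i = k then W else (\<lambda>y v. w i y v - pairing (w i) (e k) y * W y v))" for i
  show ?case
  proof (intro exI[of _ w'] conjI allI)
    show "one_form (w' i)" for i
      unfolding w'_def using W w ekV by (auto intro!: one_form_diff one_form_scale)
    show "eventually (\<lambda>y. \<forall>i<Suc k. \<forall>j<Suc k. w' i y (e j y) = (if i = j then 1 else 0)) (nhds x)"
      using wd p(2)
    proof eventually_elim
      case (elim y)
      have Wj: "W y (e j y) = 0" if "j < k" for j
      proof -
        have "(\<Sum>i<k. dir (e i) f y * w i y (e j y)) = (\<Sum>i<k. if i = j then dir (e i) f y else 0)"
          by (rule sum.cong) (use elim(1) that in auto)
        then show ?thesis
          using that by (simp add: W_def \<theta>_def dir_def)
      qed
      have Wk: "W y (e k y) = 1"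
        using elim(2) by (simp add: W_def pairing_def)
      show ?case
        using elim(1) Wj Wk by (auto simp: w'_def less_Suc_eq pairing_def)
    qed
  qed
qed

text \<open>\<open>c i\<close> vanishes on every \<open>d j\<close> with j different from i but not
  on \<open>d i\<close>, so the five coordinate vectors are independent.\<close>

lemma five_not_spanned_by_four:
  assumes "finite S" "tangent_space A x \<subseteq> span S"
  shows "5 \<le> card S"
proof -
  obtain d :: "5 \<Rightarrow> 'a tangent" and c :: "5 \<Rightarrow> 'a \<Rightarrow> real"
    where d: "\<And>i. d i \<in> tangent_space A x" "\<And>i j. d i (c j) = (if i = j then 1 else 0)"
    using coordinate_tangent_vectors by metis
  have "inj d"
    by (rule injI) (metis d(2) zero_neq_one)
  have "independent (range d)"
  proof
    assume "dependent (range d)"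
    then obtain i where "d i \<in> span (range d - {d i})"
      unfolding dependent_def by blast
    moreover have "linear (\<lambda>v::'a tangent. v (c i))"
      by (simp add: linear_iff scaleR_fun_def)
    ultimately have "d i (c i) = 0"
      by (rule linear_eq_0_on_span[rotated 2]) (auto simp: d(2))
    then show False by (simp add: d(2))
  qed
  then have "card (range d) \<le> card S"
    using independent_span_bound[OF assms(1)] d(1) assms(2) by blast
  then show ?thesis
    using card_image[OF \<open>inj d\<close>] by simp
qed

end

section \<open>Frames adapted to the filtration of a generic distribution\<close>

locale generic = smooth_manifold +
  fixes H :: "'a \<Rightarrow> 'a tangent set"
  assumes generic: "generic_distribution A H"
begin

abbreviation "G \<equiv> sections A H"
abbreviation "G2 \<equiv> sections A (T2 A H)"

lemma subspace_H: "subspace (H x)"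
  and dim_H: "dim (H x) = 2"
  and H_local_frame: "\<exists>U. open U \<and> x \<in> U \<and>
        (\<exists>X\<in>vector_fields A. \<exists>Y\<in>vector_fields A. \<forall>y\<in>U. H y = span {X y, Y y})"
proof -
  have "(\<forall>x. subspace (H x) \<and> H x \<subseteq> tangent_space A x \<and> dim (H x) = 2) \<and>
     (\<forall>x. \<exists>U. open U \<and> x \<in> U \<and>
        (\<exists>X\<in>vector_fields A. \<exists>Y\<in>vector_fields A. \<forall>y\<in>U. H y = span {X y, Y y}))"
    using generic unfolding generic_distribution_def rank_two_distribution_def by (rule conjunct1)
  then show "subspace (H x)" "dim (H x) = 2"
    "\<exists>U. open U \<and> x \<in> U \<and>
        (\<exists>X\<in>vector_fields A. \<exists>Y\<in>vector_fields A. \<forall>y\<in>U. H y = span {X y, Y y})"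
    by simp_all
qed

lemma subspace_T2: "subspace (T2 A H x)"
  by (simp add: T2_def)

lemma G_V [simp]: "\<xi> \<in> G \<Longrightarrow> \<xi> \<in> V"
  unfolding sections_def by blast

lemma G2_V [simp]: "\<xi> \<in> G2 \<Longrightarrow> \<xi> \<in> V"
  unfolding sections_def by blast

lemma G_H: "\<xi> \<in> G \<Longrightarrow> \<xi> x \<in> H x"
  unfolding sections_def by blast

lemma G2_T2: "\<xi> \<in> G2 \<Longrightarrow> \<xi> x \<in> T2 A H x"
  unfolding sections_def by blast

definition frame_fields :: "'a vfield \<Rightarrow> 'a vfield \<Rightarrow> 'a vfield list" where
  "frame_fields X Y = (let Z = lie_bracket X Y in [X, Y, Z, lie_bracket X Z, lie_bracket Y Z])"

definition frame_at :: "'a vfield \<Rightarrow> 'a vfield \<Rightarrow> (nat \<Rightarrow> 'a \<Rightarrow> 'a tangent \<Rightarrow> real) \<Rightarrow> 'a \<Rightarrow> bool" where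
  "frame_at X Y w y \<longleftrightarrow>
     (\<forall>i<5. \<forall>j<5. w i y ((frame_fields X Y ! j) y) = (if i = j then 1 else 0)) \<and>
     H y = span {X y, Y y} \<and> T2 A H y = span {X y, Y y, lie_bracket X Y y} \<and>
     tangent_space A y = span ((\<lambda>j. (frame_fields X Y ! j) y) ` {..<5})"

text \<open>Near \<open>x\<close> all sections of \<open>H\<close> are combinations of
  \<open>X\<close> and \<open>Y\<close>, so brackets of two or three sections lie in the span of the
  five fields. Genericity makes this span the tangent space, the dimension bound makes the fields
  independent at \<open>x\<close>, and \<open>coframe_exists\<close> yields forms dual to them near
  \<open>x\<close>.\<close>

lemma frame_exists:
  obtains X Y w where "X \<in> G" "Y \<in> G" "\<And>i. one_form (w i)"
    "eventually (frame_at X Y w) (nhds x)"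
proof -
  obtain U X0 Y0 where U: "open U" "x \<in> U" "X0 \<in> V" "Y0 \<in> V" "\<forall>y\<in>U. H y = span {X0 y, Y0 y}"
    using H_local_frame[of x] by (elim exE conjE bexE) (simp only: that)
  have "eventually (\<lambda>y. y \<in> U) (nhds x)"
    using U by (intro eventually_nhds_in_open)
  \<comment> \<open>The given fields span \<open>H\<close> on \<open>U\<close> only. Multiplied by a
    bump function vanishing off \<open>U\<close> they become sections of \<open>H\<close> on the
    whole manifold, unchanged near \<open>x\<close>.\<close>
  then obtain c where c: "c \<in> F" "eventually (\<lambda>y. c y = 1) (nhds x)" "\<forall>y. y \<notin> U \<longrightarrow> c y = 0"
    using bump_exists by blast
  define X where "X = fscale c X0"
  define Y where "Y = fscale c Y0"
  have cH: "fscale c Z y \<in> H y" if "Z = X0 \<or> Z = Y0" for Z y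
  proof (cases "y \<in> U")
    case True
    then have "Z y \<in> H y"
      using that U(5) by (auto intro: span_base)
    then show ?thesis by (simp add: fscale_def subspace_scale[OF subspace_H])
  qed (simp add: fscale_def c(3) subspace_0[OF subspace_H])
  have XY: "X \<in> G" "Y \<in> G"
    unfolding sections_def X_def Y_def using cH V_fscale[OF c(1)] U(3,4) by blast+
  define Z where "Z = lie_bracket X Y"
  have V3: "X \<in> V" "Y \<in> V" "Z \<in> V"
    using XY by (simp_all add: Z_def)
  have H: "eventually (\<lambda>y. H y = span {X y, Y y}) (nhds x)"
    using c(2) \<open>eventually (\<lambda>y. y \<in> U) (nhds x)\<close>
    by eventually_elim (simp add: X_def Y_def fscale_def U(5))
  have Hx: "H x = span {X x, Y x}"
    using H by (rule eventually_nhds_x_imp_x)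
  have "2 \<le> card S" if "finite S" "H x \<subseteq> span S" for S
    using dim_le_card[OF that(2,1)] by (simp add: dim_H)
  from this[of "{X x}"] this[of "{Y x}"]
  have n: "\<not> H x \<subseteq> span {X x}" "\<not> H x \<subseteq> span {Y x}" by auto
  have ni: "X x \<noteq> 0" "Y x \<notin> span {X x}"
    using n span_insert_0[of "{Y x}"] span_redundant[of "Y x" "{X x}"] by (auto simp: Hx insert_commute)
  let ?e = "\<lambda>i::nat. if i = 0 then X else Y"
  have "\<exists>w. (\<forall>i. one_form (w i)) \<and>
      eventually (\<lambda>y. \<forall>i<2::nat. \<forall>j<2::nat. w i y (?e j y) = (if i = j then 1 else 0)) (nhds x)"
  proof (rule coframe_exists)
    show "?e i x \<notin> span ((\<lambda>j. ?e j x) ` {..<i})" if "i < 2" for i :: nat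
      using that ni by (auto simp: numeral_2_eq_2 less_Suc_eq lessThan_Suc)
  qed (use V3 in simp)
  then obtain a where a: "\<And>i. one_form (a i)"
    and ad: "eventually (\<lambda>y. \<forall>i<2::nat. \<forall>j<2::nat. a i y (?e j y) = (if i = j then 1 else 0)) (nhds x)"
    by blast
  \<comment> \<open>The expansion is stated for germs at every nearby \<open>y\<close>, since it is
    going to be inserted into brackets, which differentiate it.\<close>
  have exp2: "eventually (\<lambda>y. \<forall>\<xi>\<in>G. eventually (\<lambda>z. \<xi> z
      = (fscale (pairing (a 0) \<xi>) X + fscale (pairing (a 1) \<xi>) Y) z) (nhds y)) (nhds x)"
  proof -
    have "eventually (\<lambda>y. \<forall>\<xi>\<in>G. \<xi> y
      = (fscale (pairing (a 0) \<xi>) X + fscale (pairing (a 1) \<xi>) Y) y) (nhds x)"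
      using H ad
    proof eventually_elim
      case (elim y)
      have d: "a 0 y (X y) = 1" "a 0 y (Y y) = 0" "a 1 y (X y) = 0" "a 1 y (Y y) = 1"
        using elim(2)[rule_format, of 0 0] elim(2)[rule_format, of 0 1]
          elim(2)[rule_format, of 1 0] elim(2)[rule_format, of 1 1] by simp_all
      show ?case
      proof
        fix \<xi> assume "\<xi> \<in> G"
        then have "\<xi> y \<in> span {X y, Y y}"
          using G_H elim(1) by blast
        then obtain p where "\<xi> y - p *\<^sub>R X y \<in> span {Y y}"
          by (auto simp: span_insert[of "X y"])
        then obtain q where "\<xi> y - p *\<^sub>R X y = q *\<^sub>R Y y"
          by (auto simp: span_singleton)
        then have e: "\<xi> y = p *\<^sub>R X y + q *\<^sub>R Y y"
          by (simp add: algebra_simps)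
        have "a i y (\<xi> y) = p * a i y (X y) + q * a i y (Y y)" for i
          unfolding e using linear_add[OF one_form_linear[OF a]] linear_scale[OF one_form_linear[OF a]]
          by simp
        then show "\<xi> y = (fscale (pairing (a 0) \<xi>) X + fscale (pairing (a 1) \<xi>) Y) y"
          by (simp add: fscale_def pairing_def d e del: One_nat_def)
      qed
    qed
    then show ?thesis
      by (subst (asm) eventually_eventually[symmetric]) (auto elim!: eventually_mono)
  qed
  have pF: "pairing (a i) \<xi> \<in> F" if "\<xi> \<in> G" for i \<xi>
    using a that by simp
  let ?E = "\<lambda>\<xi>. fscale (pairing (a 0) \<xi>) X + fscale (pairing (a 1) \<xi>) Y"
  let ?f = "\<lambda>j y. (frame_fields X Y ! j) y"
  have ff: "(\<lambda>j. ?f j y) ` {..<5} = {X y, Y y, Z y, lie_bracket X Z y, lie_bracket Y Z y}" for y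
    by (auto simp: frame_fields_def Let_def Z_def lessThan_Suc eval_nat_numeral)
  have spans: "eventually (\<lambda>y. T2 A H y = span {X y, Y y, Z y} \<and>
      tangent_space A y = span ((\<lambda>j. ?f j y) ` {..<5})) (nhds x)"
    using exp2
  proof eventually_elim
    case (elim y)
    have b2: "\<exists>p\<in>F. \<exists>q\<in>F. \<exists>r\<in>F. eventually (\<lambda>z. lie_bracket \<xi> \<eta> z
        = (fscale p X + fscale q Y + fscale r Z) z) (nhds y)" if sec: "\<xi> \<in> G" "\<eta> \<in> G" for \<xi> \<eta>
    proof -
      have "eventually (\<lambda>z. eventually (\<lambda>z. \<xi> z = ?E \<xi> z) (nhds z)) (nhds y)"
          "eventually (\<lambda>z. eventually (\<lambda>z. \<eta> z = ?E \<eta> z) (nhds z)) (nhds y)"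
        using elim that by (simp_all add: eventually_eventually)
      then have "eventually (\<lambda>z. lie_bracket \<xi> \<eta> z = lie_bracket (?E \<xi>) (?E \<eta>) z) (nhds y)"
        by eventually_elim (rule bracket_local, use that a V3 in simp_all)
      moreover obtain p q where p: "p \<in> F" and q: "q \<in> F" and e: "lie_bracket (?E \<xi>) (?E \<eta>) = fscale p X + fscale q Y
          + fscale (\<lambda>x. pairing (a 0) \<xi> x * pairing (a 1) \<eta> x - pairing (a 1) \<xi> x * pairing (a 0) \<eta> x) Z"
        using lie_bracket_frame[OF V3(1,2) pF[OF sec(2), of 0] pF[OF sec(2), of 1]
            pF[OF sec(1), of 0] pF[OF sec(1), of 1] F_const[of 0]] V3(1,2)
        unfolding Z_def by auto
      moreover have r: "(\<lambda>x. pairing (a 0) \<xi> x * pairing (a 1) \<eta> x - pairing (a 1) \<xi> x * pairing (a 0) \<eta> x) \<in> F"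
        using pF[OF sec(1)] pF[OF sec(2)] by simp
      ultimately have "eventually (\<lambda>z. lie_bracket \<xi> \<eta> z = (fscale p X + fscale q Y
          + fscale (\<lambda>x. pairing (a 0) \<xi> x * pairing (a 1) \<eta> x - pairing (a 1) \<xi> x * pairing (a 0) \<eta> x) Z) z) (nhds y)"
        by (simp only: e)
      then show ?thesis by (rule bexI[OF bexI[OF bexI[OF _ r] q] p])
    qed
    have s2: "lie_bracket \<xi> \<eta> y \<in> span {X y, Y y, Z y}" if sec: "\<xi> \<in> G" "\<eta> \<in> G" for \<xi> \<eta>
    proof -
      obtain p q r where "lie_bracket \<xi> \<eta> y = (fscale p X + fscale q Y + fscale r Z) y"
        using b2[OF sec] eventually_nhds_x_imp_x by fast
      then show ?thesis
        by (simp add: fscale_def) (intro span_add span_scale span_base; simp)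
    qed
    have s1: "\<xi> y \<in> span {X y, Y y}" if "\<xi> \<in> G" for \<xi>
    proof -
      have "\<xi> y = (fscale (pairing (a 0) \<xi>) X + fscale (pairing (a 1) \<xi>) Y) y"
        using elim that by (auto dest: eventually_nhds_x_imp_x)
      then show ?thesis
        by (simp add: fscale_def) (intro span_add span_scale span_base; simp)
    qed
    have s3: "lie_bracket \<xi> (lie_bracket \<eta> \<gamma>) y \<in> span ((\<lambda>j. ?f j y) ` {..<5})"
      if sec: "\<xi> \<in> G" "\<eta> \<in> G" "\<gamma> \<in> G" for \<xi> \<eta> \<gamma>
    proof -
      obtain p q r where pqr: "p \<in> F" "q \<in> F" "r \<in> F"
          "eventually (\<lambda>z. lie_bracket \<eta> \<gamma> z = (fscale p X + fscale q Y + fscale r Z) z) (nhds y)"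
        using b2[OF sec(2,3)] by blast
      \<comment> \<open>\<open>lie_bracket_frame\<close> has the section of \<open>H\<close> as
        second argument, hence the reversed order and the sign.\<close>
      let ?B = "lie_bracket (fscale p X + fscale q Y + fscale r Z) (?E \<xi>)"
      have "lie_bracket \<xi> (lie_bracket \<eta> \<gamma>) y
          = lie_bracket (?E \<xi>) (fscale p X + fscale q Y + fscale r Z) y"
        by (rule bracket_local) (use that a V3 pqr elim in simp_all)
      also have "\<dots> = - ?B y"
        by (subst bracket_anti) (rule uminus_apply)
      finally have 1: "lie_bracket \<xi> (lie_bracket \<eta> \<gamma>) y = - ?B y" .
      obtain p' q' r' s t where 2: "?B
          = fscale p' X + fscale q' Y + fscale r' Z + fscale s (lie_bracket X Z) + fscale t (lie_bracket Y Z)"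
        using lie_bracket_frame[OF V3(1,2) pF[OF sec(1), of 0] pF[OF sec(1), of 1] pqr(1-3)]
        unfolding Z_def by blast
      have "?B y \<in> span ((\<lambda>j. ?f j y) ` {..<5})"
        unfolding ff 2 by (simp add: fscale_def) (intro span_add span_scale span_base; simp)
      then show ?thesis
        unfolding 1 by (rule span_neg)
    qed
    let ?S2 = "{\<xi> y |\<xi>. \<xi> \<in> G} \<union> {lie_bracket \<xi> \<eta> y |\<xi> \<eta>. \<xi> \<in> G \<and> \<eta> \<in> G}"
    let ?S3 = "{\<xi> y |\<xi>. \<xi> \<in> G} \<union> {lie_bracket \<xi> \<eta> y |\<xi> \<eta>. \<xi> \<in> G \<and> \<eta> \<in> G} \<union>
      {lie_bracket \<xi> (lie_bracket \<eta> \<gamma>) y |\<xi> \<eta> \<gamma>. \<xi> \<in> G \<and> \<eta> \<in> G \<and> \<gamma> \<in> G}"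
    have m: "span {X y, Y y} \<subseteq> span {X y, Y y, Z y}"
        "span {X y, Y y, Z y} \<subseteq> span ((\<lambda>j. ?f j y) ` {..<5})"
      unfolding ff by (rule span_mono; blast)+
    have "?S2 \<subseteq> span {X y, Y y, Z y}"
      using s1 s2 m(1) by auto
    moreover have "{X y, Y y, Z y} \<subseteq> ?S2"
      using XY unfolding Z_def by auto
    ultimately have T2: "T2 A H y = span {X y, Y y, Z y}"
      unfolding T2_def by (meson span_minimal span_mono subset_antisym subspace_span)
    have "?S3 \<subseteq> span ((\<lambda>j. ?f j y) ` {..<5})"
    proof -
      have "?S2 \<subseteq> span ((\<lambda>j. ?f j y) ` {..<5})"
        using \<open>?S2 \<subseteq> span {X y, Y y, Z y}\<close> m(2) by (rule subset_trans)
      moreover have "{lie_bracket \<xi> (lie_bracket \<eta> \<gamma>) y |\<xi> \<eta> \<gamma>. \<xi> \<in> G \<and> \<eta> \<in> G \<and> \<gamma> \<in> G}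
          \<subseteq> span ((\<lambda>j. ?f j y) ` {..<5})"
        using s3 by auto
      ultimately show ?thesis by (rule Un_least)
    qed
    moreover have "(\<lambda>j. ?f j y) ` {..<5} \<subseteq> ?S3"
    proof -
      have "{X y, Y y, Z y} \<subseteq> ?S3"
        using \<open>{X y, Y y, Z y} \<subseteq> ?S2\<close> by (rule le_supI1)
      moreover have "lie_bracket X Z y \<in> ?S3" "lie_bracket Y Z y \<in> ?S3"
        using XY unfolding Z_def by blast+
      ultimately show ?thesis unfolding ff by simp
    qed
    ultimately have "span ?S3 = span ((\<lambda>j. ?f j y) ` {..<5})"
      by (meson span_minimal span_mono subset_antisym subspace_span)
    moreover have "span ?S3 = tangent_space A y"
      using generic unfolding generic_distribution_def by (rule conjunct2[THEN spec])
    ultimately show ?case using T2 by simp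
  qed
  have Tx: "tangent_space A x = span ((\<lambda>j. ?f j x) ` {..<5})"
    using spans by (auto dest: eventually_nhds_x_imp_x)
  have FV: "frame_fields X Y ! i \<in> V" if "i < 5" for i
    using that V3 by (auto simp: frame_fields_def Let_def Z_def less_Suc_eq eval_nat_numeral)
  have "\<exists>w. (\<forall>i. one_form (w i)) \<and>
      eventually (\<lambda>y. \<forall>i<5. \<forall>j<5. w i y (?f j y) = (if i = j then 1 else 0)) (nhds x)"
  proof (rule coframe_exists[OF FV])
    fix i :: nat assume i: "i < 5"
    show "?f i x \<notin> span ((\<lambda>j. ?f j x) ` {..<i})"
    proof
      assume d: "?f i x \<in> span ((\<lambda>j. ?f j x) ` {..<i})"
      \<comment> \<open>If field \<open>i\<close> depended on its predecessors at \<open>x\<close>,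
        the other four would still span the tangent space.\<close>
      let ?S = "(\<lambda>j. ?f j x) ` ({..<5} - {i})"
      have "?f j x \<in> span ?S" if "j < 5" for j
      proof (cases "j = i")
        case True
        have "{..<i} \<subseteq> {..<5} - {i}" using i by auto
        then show ?thesis
          using d span_mono[OF image_mono] True by blast
      qed (use that in \<open>auto intro!: span_base\<close>)
      then have "tangent_space A x \<subseteq> span ?S"
        unfolding Tx by (intro span_minimal) auto
      then have "5 \<le> card ?S"
        by (intro five_not_spanned_by_four) auto
      also have "\<dots> \<le> card ({..<5} - {i})"
        by (rule card_image_le) simp
      also have "\<dots> = 4" using i by simp
      finally show False by simp
    qed
  qed
  then obtain w where w: "\<And>i. one_form (w i)"
      "eventually (\<lambda>y. \<forall>i<5. \<forall>j<5. w i y (?f j y) = (if i = j then 1 else 0)) (nhds x)"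
    by blast
  show thesis
  proof (rule that[OF XY w(1)])
    show "eventually (frame_at X Y w) (nhds x)"
      using spans w(2) H unfolding frame_at_def Z_def by eventually_elim blast
  qed
qed

text \<open>\<open>a\<close>, ..., \<open>e\<close> is the coframe dual to the frame \<open>X, Y, Z, [X, Z], [Y, Z]\<close>.\<close>

definition adapted where
  "adapted X Y a b c d e y \<longleftrightarrow> (let Z = lie_bracket X Y; U = lie_bracket X Z; W = lie_bracket Y Z in
     a y (X y) = 1 \<and> a y (Y y) = 0 \<and> a y (Z y) = 0 \<and> a y (U y) = 0 \<and> a y (W y) = 0 \<and>
     b y (X y) = 0 \<and> b y (Y y) = 1 \<and> b y (Z y) = 0 \<and> b y (U y) = 0 \<and> b y (W y) = 0 \<and>
     c y (X y) = 0 \<and> c y (Y y) = 0 \<and> c y (Z y) = 1 \<and> c y (U y) = 0 \<and> c y (W y) = 0 \<and>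
     d y (X y) = 0 \<and> d y (Y y) = 0 \<and> d y (Z y) = 0 \<and> d y (U y) = 1 \<and> d y (W y) = 0 \<and>
     e y (X y) = 0 \<and> e y (Y y) = 0 \<and> e y (Z y) = 0 \<and> e y (U y) = 0 \<and> e y (W y) = (1::real) \<and>
     H y = span {X y, Y y} \<and> T2 A H y = span {X y, Y y, Z y} \<and>
     (\<forall>v. v \<in> H y \<longleftrightarrow> v = a y v *\<^sub>R X y + b y v *\<^sub>R Y y) \<and>
     (\<forall>v. v \<in> T2 A H y \<longleftrightarrow> v = a y v *\<^sub>R X y + b y v *\<^sub>R Y y + c y v *\<^sub>R Z y) \<and>
     (\<forall>v. v \<in> tangent_space A y \<longleftrightarrow> v = a y v *\<^sub>R X y + b y v *\<^sub>R Y y + c y v *\<^sub>R Z y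
        + d y v *\<^sub>R U y + e y v *\<^sub>R W y))"

definition adapted_frame where
  "adapted_frame X Y a b c d e x \<longleftrightarrow> X \<in> G \<and> Y \<in> G \<and> one_form a \<and> one_form b \<and> one_form c \<and>
     one_form d \<and> one_form e \<and> eventually (adapted X Y a b c d e) (nhds x)"

lemma adapted_frame_exists: "\<exists>X Y a b c d e. adapted_frame X Y a b c d e x"
proof -
  obtain X Y w where XY: "X \<in> G" "Y \<in> G" and w: "\<And>i. one_form (w i)"
    and ev: "eventually (frame_at X Y w) (nhds x)"
    using frame_exists by blast
  define Z where "Z = lie_bracket X Y"
  define U where "U = lie_bracket X Z"
  define W where "W = lie_bracket Y Z"
  have "eventually (adapted X Y (w 0) (w 1) (w 2) (w 3) (w 4)) (nhds x)"
    using ev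
  proof eventually_elim
    case (elim y)
    have f: "frame_fields X Y ! 0 = X" "frame_fields X Y ! 1 = Y" "frame_fields X Y ! 2 = Z"
        "frame_fields X Y ! 3 = U" "frame_fields X Y ! 4 = W"
      by (simp_all add: frame_fields_def Let_def Z_def U_def W_def)
    have du: "w i y ((frame_fields X Y ! j) y) = (if i = j then 1 else 0)" if "i < 5" "j < 5" for i j
      using elim that unfolding frame_at_def by blast
    have five: "{..<5} = {0, 1, 2, 3, 4::nat}"
      by auto
    have sp: "H y = span {X y, Y y}" "T2 A H y = span {X y, Y y, Z y}"
        "tangent_space A y = span {X y, Y y, Z y, U y, W y}"
      using elim unfolding frame_at_def five image_insert image_empty f Z_def by simp_all
    have d: "w 0 y (X y) = 1" "w 0 y (Y y) = 0" "w 0 y (Z y) = 0" "w 0 y (U y) = 0" "w 0 y (W y) = 0"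
        "w 1 y (X y) = 0" "w 1 y (Y y) = 1" "w 1 y (Z y) = 0" "w 1 y (U y) = 0" "w 1 y (W y) = 0"
        "w 2 y (X y) = 0" "w 2 y (Y y) = 0" "w 2 y (Z y) = 1" "w 2 y (U y) = 0" "w 2 y (W y) = 0"
        "w 3 y (X y) = 0" "w 3 y (Y y) = 0" "w 3 y (Z y) = 0" "w 3 y (U y) = 1" "w 3 y (W y) = 0"
        "w 4 y (X y) = 0" "w 4 y (Y y) = 0" "w 4 y (Z y) = 0" "w 4 y (U y) = 0" "w 4 y (W y) = 1"
      using du[of 0 0] du[of 0 1] du[of 0 2] du[of 0 3] du[of 0 4]
        du[of 1 0] du[of 1 1] du[of 1 2] du[of 1 3] du[of 1 4]
        du[of 2 0] du[of 2 1] du[of 2 2] du[of 2 3] du[of 2 4]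
        du[of 3 0] du[of 3 1] du[of 3 2] du[of 3 3] du[of 3 4]
        du[of 4 0] du[of 4 1] du[of 4 2] du[of 4 3] du[of 4 4]
      unfolding f by simp_all
    \<comment> \<open>Reconstruction of a vector from its components: \<open>L\<close> is the
      identity on the five frame vectors, hence on their span.\<close>
    define L where "L = (\<lambda>v. w 0 y v *\<^sub>R X y + w 1 y v *\<^sub>R Y y
        + w 2 y v *\<^sub>R Z y + w 3 y v *\<^sub>R U y + w 4 y v *\<^sub>R W y)"
    have L: "linear L"
    proof (rule linearI)
      show "L (u + v) = L u + L v" for u v
        unfolding L_def by (simp only: one_form_simps[OF w] scaleR_add_left add_ac)
      show "L (k *\<^sub>R v) = k *\<^sub>R L v" for k v
        unfolding L_def by (simp only: one_form_simps[OF w] scaleR_add_right scaleR_scaleR)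
    qed
    have in5: "v \<in> span {X y, Y y, Z y, U y, W y} \<Longrightarrow> v = w 0 y v *\<^sub>R X y + w 1 y v *\<^sub>R Y y
        + w 2 y v *\<^sub>R Z y + w 3 y v *\<^sub>R U y + w 4 y v *\<^sub>R W y" for v
    proof -
      assume v: "v \<in> span {X y, Y y, Z y, U y, W y}"
      have "v = L v"
        by (rule linear_eq_on_span[OF linear_ident L _ v])
          (elim insertE emptyE; simp only: L_def d scaleR_zero_left scaleR_one add_0 add_0_right)
      then show ?thesis by (simp only: L_def)
    qed
    have in3: "w 3 y v = 0 \<and> w 4 y v = 0" if "v \<in> span {X y, Y y, Z y}" for v
      using linear_eq_0_on_span[OF one_form_linear[OF w, of 3] _ that]
        linear_eq_0_on_span[OF one_form_linear[OF w, of 4] _ that] d by auto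
    have in2: "w 2 y v = 0 \<and> w 3 y v = 0 \<and> w 4 y v = 0" if "v \<in> span {X y, Y y}" for v
      using linear_eq_0_on_span[OF one_form_linear[OF w, of 2] _ that]
        linear_eq_0_on_span[OF one_form_linear[OF w, of 3] _ that]
        linear_eq_0_on_span[OF one_form_linear[OF w, of 4] _ that] d by auto
    have m: "span {X y, Y y} \<subseteq> span {X y, Y y, Z y, U y, W y}"
        "span {X y, Y y, Z y} \<subseteq> span {X y, Y y, Z y, U y, W y}"
      by (rule span_mono; blast)+
    have H: "v \<in> H y \<longleftrightarrow> v = w 0 y v *\<^sub>R X y + w 1 y v *\<^sub>R Y y" for v
    proof
      assume "v \<in> H y"
      then have "v \<in> span {X y, Y y}" by (simp add: sp)
      then show "v = w 0 y v *\<^sub>R X y + w 1 y v *\<^sub>R Y y"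
        using in5[of v] in2[of v] m(1) by auto
    next
      assume v: "v = w 0 y v *\<^sub>R X y + w 1 y v *\<^sub>R Y y"
      show "v \<in> H y"
        unfolding sp by (subst v) (intro span_add span_scale span_base; simp)
    qed
    have T2: "v \<in> T2 A H y \<longleftrightarrow> v = w 0 y v *\<^sub>R X y + w 1 y v *\<^sub>R Y y + w 2 y v *\<^sub>R Z y" for v
    proof
      assume "v \<in> T2 A H y"
      then have "v \<in> span {X y, Y y, Z y}" by (simp add: sp)
      then show "v = w 0 y v *\<^sub>R X y + w 1 y v *\<^sub>R Y y + w 2 y v *\<^sub>R Z y"
        using in5[of v] in3[of v] m(2) by auto
    next
      assume v: "v = w 0 y v *\<^sub>R X y + w 1 y v *\<^sub>R Y y + w 2 y v *\<^sub>R Z y"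
      show "v \<in> T2 A H y"
        unfolding sp by (subst v) (intro span_add span_scale span_base; simp)
    qed
    have T: "v \<in> tangent_space A y \<longleftrightarrow> v = w 0 y v *\<^sub>R X y + w 1 y v *\<^sub>R Y y
        + w 2 y v *\<^sub>R Z y + w 3 y v *\<^sub>R U y + w 4 y v *\<^sub>R W y" for v
    proof
      assume "v \<in> tangent_space A y"
      then show "v = w 0 y v *\<^sub>R X y + w 1 y v *\<^sub>R Y y
        + w 2 y v *\<^sub>R Z y + w 3 y v *\<^sub>R U y + w 4 y v *\<^sub>R W y"
        using in5 by (simp only: sp)
    next
      assume v: "v = w 0 y v *\<^sub>R X y + w 1 y v *\<^sub>R Y y
        + w 2 y v *\<^sub>R Z y + w 3 y v *\<^sub>R U y + w 4 y v *\<^sub>R W y"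
      show "v \<in> tangent_space A y"
        unfolding sp by (subst v) (intro span_add span_scale span_base; simp)
    qed
    show ?case
      unfolding adapted_def Let_def Z_def[symmetric] U_def[symmetric] W_def[symmetric]
      using d sp H T2 T by (intro conjI allI) (simp_all only:)
  qed
  then show ?thesis
    using XY w unfolding adapted_frame_def by blast
qed

lemma G_I: "\<xi> \<in> V \<Longrightarrow> (\<And>x. \<xi> x \<in> H x) \<Longrightarrow> \<xi> \<in> G"
  unfolding sections_def by blast

lemma G2_I: "\<xi> \<in> V \<Longrightarrow> (\<And>x. \<xi> x \<in> T2 A H x) \<Longrightarrow> \<xi> \<in> G2"
  unfolding sections_def by blast

lemma G_0 [simp]: "0 \<in> G"
  by (rule G_I) (simp_all add: subspace_0[OF subspace_H])
lemma G_add [simp]: "\<xi> \<in> G \<Longrightarrow> \<eta> \<in> G \<Longrightarrow> \<xi> + \<eta> \<in> G"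
  by (rule G_I) (simp_all add: subspace_add[OF subspace_H] G_H)
lemma G_diff [simp]: "\<xi> \<in> G \<Longrightarrow> \<eta> \<in> G \<Longrightarrow> \<xi> - \<eta> \<in> G"
  by (rule G_I) (simp_all add: subspace_diff[OF subspace_H] G_H)
lemma G_fscale [simp]: "h \<in> F \<Longrightarrow> \<xi> \<in> G \<Longrightarrow> fscale h \<xi> \<in> G"
  by (rule G_I, simp) (simp add: fscale_def subspace_scale[OF subspace_H] G_H)

lemma H_T2: "v \<in> H x \<Longrightarrow> v \<in> T2 A H x"
proof -
  assume v: "v \<in> H x"
  obtain X Y a b c d e where f: "adapted_frame X Y a b c d e x"
    using adapted_frame_exists by blast
  then have "adapted X Y a b c d e x"
    unfolding adapted_frame_def by (blast dest: eventually_nhds_x_imp_x)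
  then have "H x = span {X x, Y x}" "T2 A H x = span {X x, Y x, lie_bracket X Y x}"
    unfolding adapted_def Let_def by blast+
  then show ?thesis
    using v span_mono[of "{X x, Y x}" "{X x, Y x, lie_bracket X Y x}"] by auto
qed

lemma G_G2 [simp]: "\<xi> \<in> G \<Longrightarrow> \<xi> \<in> G2"
  by (rule G2_I) (simp_all add: H_T2 G_H)
lemma G2_add [simp]: "\<xi> \<in> G2 \<Longrightarrow> \<eta> \<in> G2 \<Longrightarrow> \<xi> + \<eta> \<in> G2"
  by (rule G2_I) (simp_all add: subspace_add[OF subspace_T2] G2_T2)
lemma G2_minus [simp]: "\<xi> \<in> G2 \<Longrightarrow> - \<xi> \<in> G2"
  by (rule G2_I) (simp_all add: subspace_neg[OF subspace_T2] G2_T2)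
lemma G2_diff [simp]: "\<xi> \<in> G2 \<Longrightarrow> \<eta> \<in> G2 \<Longrightarrow> \<xi> - \<eta> \<in> G2"
  by (rule G2_I) (simp_all add: subspace_diff[OF subspace_T2] G2_T2)
lemma G2_fscale [simp]: "h \<in> F \<Longrightarrow> \<xi> \<in> G2 \<Longrightarrow> fscale h \<xi> \<in> G2"
  by (rule G2_I, simp) (simp add: fscale_def subspace_scale[OF subspace_T2] G2_T2)
lemma G2_bracket [simp]: "\<xi> \<in> G \<Longrightarrow> \<eta> \<in> G \<Longrightarrow> lie_bracket \<xi> \<eta> \<in> G2"
  by (rule G2_I, simp) (auto simp: T2_def intro!: span_base)

section \<open>The tensors determined by a generalized contact form\<close>

lemma adapted_frame_near:
  assumes "adapted_frame X Y a b c d e x"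
  shows "eventually (\<lambda>y. adapted_frame X Y a b c d e y) (nhds x)"
  using assms eventually_eventually[of "adapted X Y a b c d e" x] unfolding adapted_frame_def by simp

lemma adapted_frame_at:
  assumes "adapted_frame X Y a b c d e x"
  shows "adapted X Y a b c d e x" "X \<in> G" "Y \<in> G"
    "one_form a" "one_form b" "one_form c" "one_form d" "one_form e"
  using assms eventually_nhds_x_imp_x unfolding adapted_frame_def by blast+

lemma adapted_frame_G:
  assumes f: "adapted_frame X Y a b c d e x" and "\<xi> \<in> G"
  shows "eventually (\<lambda>y. \<xi> y = (fscale (pairing a \<xi>) X + fscale (pairing b \<xi>) Y) y) (nhds x)"
  using adapted_frame_near[OF f]
proof eventually_elim
  case (elim y)
  have "\<forall>v. v \<in> H y \<longleftrightarrow> v = a y v *\<^sub>R X y + b y v *\<^sub>R Y y"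
    using adapted_frame_at(1)[OF elim] unfolding adapted_def Let_def by blast
  then show ?case
    using G_H[OF assms(2), of y] by (simp add: fscale_def pairing_def)
qed

lemma adapted_frame_G2:
  assumes f: "adapted_frame X Y a b c d e x" and "\<rho> \<in> G2"
  shows "eventually (\<lambda>y. \<rho> y = (fscale (pairing a \<rho>) X + fscale (pairing b \<rho>) Y
    + fscale (pairing c \<rho>) (lie_bracket X Y)) y) (nhds x)"
  using adapted_frame_near[OF f]
proof eventually_elim
  case (elim y)
  have "\<forall>v. v \<in> T2 A H y \<longleftrightarrow> v = a y v *\<^sub>R X y + b y v *\<^sub>R Y y + c y v *\<^sub>R lie_bracket X Y y"
    using adapted_frame_at(1)[OF elim] unfolding adapted_def Let_def by blast
  then show ?case
    using G2_T2[OF assms(2), of y] by (simp add: fscale_def pairing_def)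
qed

end

locale contact = generic +
  fixes \<alpha> :: "'a \<Rightarrow> 'a tangent \<Rightarrow> real"
  assumes contact: "generalized_contact_form A H \<alpha>"
begin

lemma alpha_add: "v \<in> T2 A H y \<Longrightarrow> w \<in> T2 A H y \<Longrightarrow> \<alpha> y (v + w) = \<alpha> y v + \<alpha> y w"
  and alpha_scale: "v \<in> T2 A H y \<Longrightarrow> \<alpha> y (k *\<^sub>R v) = k * \<alpha> y v"
  and alpha_F [simp]: "\<rho> \<in> G2 \<Longrightarrow> pairing \<alpha> \<rho> \<in> F"
  and alpha_kernel: "{v \<in> T2 A H y. \<alpha> y v = 0} = H y"
  using contact unfolding generalized_contact_form_def dual_sections_def pairing_def by simp_all

lemma alpha_H: "v \<in> H y \<Longrightarrow> \<alpha> y v = 0"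
  using alpha_kernel by blast

lemma alpha_0: "\<alpha> y 0 = 0"
  by (rule alpha_H) (rule subspace_0[OF subspace_H])

lemma alpha_pairing [simp]:
  assumes "\<rho> \<in> G2"
  shows "\<sigma> \<in> G2 \<Longrightarrow> pairing \<alpha> (\<rho> + \<sigma>) y = pairing \<alpha> \<rho> y + pairing \<alpha> \<sigma> y"
    and "\<sigma> \<in> G2 \<Longrightarrow> pairing \<alpha> (\<rho> - \<sigma>) y = pairing \<alpha> \<rho> y - pairing \<alpha> \<sigma> y"
    and "pairing \<alpha> (- \<rho>) y = - pairing \<alpha> \<rho> y"
    and "pairing \<alpha> (fscale h \<rho>) y = h y * pairing \<alpha> \<rho> y"
proof -
  have neg: "pairing \<alpha> (- \<rho>) y = - pairing \<alpha> \<rho> y" if "\<rho> \<in> G2" for \<rho>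
    using alpha_scale[OF G2_T2[OF that], of y "-1"] by (simp add: pairing_def)
  have add: "pairing \<alpha> (\<rho> + \<sigma>) y = pairing \<alpha> \<rho> y + pairing \<alpha> \<sigma> y" if "\<rho> \<in> G2" "\<sigma> \<in> G2" for \<rho> \<sigma>
    using alpha_add[OF G2_T2[OF that(1)] G2_T2[OF that(2)]] by (simp add: pairing_def)
  show "pairing \<alpha> (- \<rho>) y = - pairing \<alpha> \<rho> y"
    using neg assms .
  show "\<sigma> \<in> G2 \<Longrightarrow> pairing \<alpha> (\<rho> + \<sigma>) y = pairing \<alpha> \<rho> y + pairing \<alpha> \<sigma> y"
    using add assms .
  show "\<sigma> \<in> G2 \<Longrightarrow> pairing \<alpha> (\<rho> - \<sigma>) y = pairing \<alpha> \<rho> y - pairing \<alpha> \<sigma> y"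
    using add[of \<rho> "- \<sigma>"] neg[of \<sigma>] assms by simp
  show "pairing \<alpha> (fscale h \<rho>) y = h y * pairing \<alpha> \<rho> y"
    using alpha_scale[OF G2_T2[OF assms], of y "h y"] by (simp add: pairing_def fscale_def)
qed

lemma alpha_pairing_G [simp]: "\<xi> \<in> G \<Longrightarrow> pairing \<alpha> \<xi> y = 0"
  by (simp add: pairing_def alpha_H G_H)

lemma G_if_alpha_0: "\<rho> \<in> G2 \<Longrightarrow> (\<And>y. pairing \<alpha> \<rho> y = 0) \<Longrightarrow> \<rho> \<in> G"
  by (rule G_I, simp) (simp add: alpha_kernel[symmetric] G2_T2 pairing_def)

definition levi :: "'a vfield \<Rightarrow> 'a vfield \<Rightarrow> 'a \<Rightarrow> real"
  where "levi \<xi> \<eta> = pairing \<alpha> (lie_bracket \<xi> \<eta>)"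

lemma levi_F [simp]: "\<xi> \<in> G \<Longrightarrow> \<eta> \<in> G \<Longrightarrow> levi \<xi> \<eta> \<in> F"
  by (simp add: levi_def)

lemma levi_anti: "\<xi> \<in> G \<Longrightarrow> \<eta> \<in> G \<Longrightarrow> levi \<xi> \<eta> y = - levi \<eta> \<xi> y"
  unfolding levi_def by (subst bracket_anti) simp

lemma levi_self [simp]: "levi \<xi> \<xi> y = 0"
  by (simp add: levi_def pairing_def alpha_0)

lemma levi_add_right [simp]:
  "\<xi> \<in> G \<Longrightarrow> \<eta> \<in> G \<Longrightarrow> \<gamma> \<in> G \<Longrightarrow> levi \<xi> (\<eta> + \<gamma>) y = levi \<xi> \<eta> y + levi \<xi> \<gamma> y"
  unfolding levi_def by (subst bracket_add_right) simp_all

lemma levi_add_left [simp]: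
  "\<xi> \<in> G \<Longrightarrow> \<eta> \<in> G \<Longrightarrow> \<gamma> \<in> G \<Longrightarrow> levi (\<eta> + \<gamma>) \<xi> y = levi \<eta> \<xi> y + levi \<gamma> \<xi> y"
  unfolding levi_def by (subst bracket_add_left) simp_all

lemma levi_diff_right [simp]:
  "\<xi> \<in> G \<Longrightarrow> \<eta> \<in> G \<Longrightarrow> \<gamma> \<in> G \<Longrightarrow> levi \<xi> (\<eta> - \<gamma>) y = levi \<xi> \<eta> y - levi \<xi> \<gamma> y"
  unfolding levi_def by (subst bracket_diff_right) simp_all

lemma levi_diff_left [simp]:
  "\<xi> \<in> G \<Longrightarrow> \<eta> \<in> G \<Longrightarrow> \<gamma> \<in> G \<Longrightarrow> levi (\<eta> - \<gamma>) \<xi> y = levi \<eta> \<xi> y - levi \<gamma> \<xi> y"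
  unfolding levi_def by (subst bracket_diff_left) simp_all

lemma levi_fscale_right [simp]:
  "\<xi> \<in> G \<Longrightarrow> \<eta> \<in> G \<Longrightarrow> h \<in> F \<Longrightarrow> levi \<xi> (fscale h \<eta>) y = h y * levi \<xi> \<eta> y"
  unfolding levi_def by (subst bracket_fscale_right) simp_all

lemma levi_fscale_left [simp]:
  "\<xi> \<in> G \<Longrightarrow> \<eta> \<in> G \<Longrightarrow> h \<in> F \<Longrightarrow> levi (fscale h \<xi>) \<eta> y = h y * levi \<xi> \<eta> y"
  unfolding levi_def by (subst bracket_fscale_left) simp_all

text \<open>The expansions in the frame hold near \<open>x\<close> and may be inserted into the
  bracket. Derivatives of the coefficients only multiply sections of \<open>H\<close>, so
  \<open>levi\<close> is an area form that depends on the values at \<open>x\<close> alone.\<close>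

lemma levi_frame:
  assumes f: "adapted_frame X Y a b c d e x" and "\<xi> \<in> G" "\<eta> \<in> G"
  shows "levi \<xi> \<eta> x = (pairing a \<xi> x * pairing b \<eta> x - pairing b \<xi> x * pairing a \<eta> x) * levi X Y x"
proof -
  note fr = adapted_frame_at[OF f]
  have "levi \<xi> \<eta> x = \<alpha> x (lie_bracket \<xi> \<eta> x)"
    by (simp add: levi_def pairing_def)
  also have "lie_bracket \<xi> \<eta> x = lie_bracket (fscale (pairing a \<xi>) X + fscale (pairing b \<xi>) Y)
      (fscale (pairing a \<eta>) X + fscale (pairing b \<eta>) Y) x"
    by (rule bracket_local) (use assms fr adapted_frame_G[OF f] in simp_all)
  also have "\<alpha> x \<dots> = levi (fscale (pairing a \<xi>) X + fscale (pairing b \<xi>) Y)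
      (fscale (pairing a \<eta>) X + fscale (pairing b \<eta>) Y) x"
    by (simp add: levi_def pairing_def)
  also have "\<dots> = (pairing a \<xi> x * pairing b \<eta> x - pairing b \<xi> x * pairing a \<eta> x) * levi X Y x"
    using fr(2-5) assms levi_anti[of Y X x] by (simp add: algebra_simps)
  finally show ?thesis .
qed

text \<open>The linear dependence of three vectors in a plane, with coefficients given by an area form.\<close>

lemma levi_plane:
  assumes "\<xi> \<in> G" "\<eta> \<in> G" "\<gamma> \<in> G"
  shows "fscale (levi \<xi> \<eta>) \<gamma> + fscale (levi \<eta> \<gamma>) \<xi> + fscale (levi \<gamma> \<xi>) \<eta> = 0"
proof
  fix x
  obtain X Y a b c d e where f: "adapted_frame X Y a b c d e x"
    using adapted_frame_exists by blast
  note l = levi_frame[OF f]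
  have v: "\<zeta> x = pairing a \<zeta> x *\<^sub>R X x + pairing b \<zeta> x *\<^sub>R Y x" if "\<zeta> \<in> G" for \<zeta>
    using eventually_nhds_x_imp_x[OF adapted_frame_G[OF f that]] by (simp add: fscale_def)
  show "(fscale (levi \<xi> \<eta>) \<gamma> + fscale (levi \<eta> \<gamma>) \<xi> + fscale (levi \<gamma> \<xi>) \<eta>) x = 0 x"
  proof
    fix g
    have "\<zeta> x g = pairing a \<zeta> x * X x g + pairing b \<zeta> x * Y x g" if "\<zeta> \<in> G" for \<zeta>
      using arg_cong[OF v[OF that], of "\<lambda>u. u g"] by (simp add: scaleR_fun_def)
    note w = this[OF assms(1)] this[OF assms(2)] this[OF assms(3)]
    show "(fscale (levi \<xi> \<eta>) \<gamma> + fscale (levi \<eta> \<gamma>) \<xi> + fscale (levi \<gamma> \<xi>) \<eta>) x g = 0 x g"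
      by (simp add: fscale_def scaleR_fun_def w l[OF assms(1,2)] l[OF assms(2,3)] l[OF assms(3,1)]
          algebra_simps)
  qed
qed

text \<open>The Pluecker relation, obtained by pairing \<open>levi_plane\<close> with \<delta>. It
  collapses sums such as l(\<xi>) levi(\<gamma>, \<eta>) + l(\<eta>) levi(\<xi>, \<gamma>) to
  l(\<gamma>) levi(\<xi>, \<eta>) for l = \<open>levi s\<close>.\<close>

lemma levi_plane_levi:
  assumes "\<xi> \<in> G" "\<eta> \<in> G" "\<gamma> \<in> G" "\<delta> \<in> G"
  shows "levi \<xi> \<eta> y * levi \<gamma> \<delta> y + levi \<eta> \<gamma> y * levi \<xi> \<delta> y + levi \<gamma> \<xi> y * levi \<eta> \<delta> y = 0"
proof -
  have "levi (fscale (levi \<xi> \<eta>) \<gamma> + fscale (levi \<eta> \<gamma>) \<xi> + fscale (levi \<gamma> \<xi>) \<eta>) \<delta> y = 0"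
    unfolding levi_plane[OF assms(1-3)] using levi_fscale_left[OF assms(4,4), of "\<lambda>x. 0"] by simp
  then show ?thesis using assms by simp
qed

text \<open>Otherwise \<open>lie_bracket X Y\<close> would lie at \<open>x\<close> in the kernel of
  \<alpha>, that is in \<open>H\<close>, whereas the coframe separates it from
  \<open>H\<close>.\<close>

lemma alpha_frame:
  assumes f: "adapted_frame X Y a b c d e x"
  shows "levi X Y x \<noteq> 0"
proof
  assume "levi X Y x = 0"
  moreover note fr = adapted_frame_at[OF f]
  moreover have "lie_bracket X Y x \<in> T2 A H x"
    using fr by (intro G2_T2) simp
  ultimately have "lie_bracket X Y x \<in> H x"
    using alpha_kernel[of x] unfolding levi_def pairing_def by blast
  then have "lie_bracket X Y x = a x (lie_bracket X Y x) *\<^sub>R X x + b x (lie_bracket X Y x) *\<^sub>R Y x"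
    using fr(1) unfolding adapted_def Let_def by blast
  moreover have "a x (lie_bracket X Y x) = 0" "b x (lie_bracket X Y x) = 0" "c x (lie_bracket X Y x) = 1"
    using fr(1) unfolding adapted_def Let_def by blast+
  ultimately show False
    using one_form_simps(5)[OF fr(6), of x] by simp
qed

text \<open>One vector of an adapted frame is rescaled; expansions in such a pair have no
  denominators.\<close>

lemma levi_unit_pair:
  obtains \<xi> \<eta> where "\<xi> \<in> G" "\<eta> \<in> G" "eventually (\<lambda>y. levi \<xi> \<eta> y = 1) (nhds x)"
proof -
  obtain X Y a b c d e where f: "adapted_frame X Y a b c d e x"
    using adapted_frame_exists by blast
  note fr = adapted_frame_at[OF f]
  obtain p where p: "p \<in> F" "eventually (\<lambda>y. p y * levi X Y y = 1) (nhds x)"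
    using F_local_inverse[OF levi_F[OF fr(2,3)] alpha_frame[OF f]] by blast
  then show thesis
    using that[of "fscale p X" Y] fr by simp
qed

text \<open>\<open>part1 \<zeta>\<close> is the component \<open>\<zeta>\<^sub>1\<close> of the decomposition. It does not involve the Reeb field: the sign
  comes from \<open>part1 [Z, X] = \<alpha>(Z) X\<close>.\<close>

definition pr1_at :: "'a \<Rightarrow> 'a tangent \<Rightarrow> 'a tangent" where
  "pr1_at y v = (let (X, Y, d, e) = (SOME (X, Y, d, e). \<exists>a b c. adapted_frame X Y a b c d e y)
     in - levi X Y y *\<^sub>R (d y v *\<^sub>R X y + e y v *\<^sub>R Y y))"

definition part1 :: "'a vfield \<Rightarrow> 'a vfield"
  where "part1 \<zeta> = (\<lambda>y. pr1_at y (\<zeta> y))"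

lemma pr1_at_frame:
  obtains X Y a b c d e where "adapted_frame X Y a b c d e y"
    "pr1_at y = (\<lambda>v. - levi X Y y *\<^sub>R (d y v *\<^sub>R X y + e y v *\<^sub>R Y y))"
proof -
  let ?P = "\<lambda>(X, Y, d, e). \<exists>a b c. adapted_frame X Y a b c d e y"
  obtain X Y d e where s: "(SOME t. ?P t) = (X, Y, d, e)"
    by (cases "SOME t. ?P t") auto
  have "\<exists>t. ?P t"
  proof -
    obtain X Y a b c d e where "adapted_frame X Y a b c d e y"
      using adapted_frame_exists by blast
    then show ?thesis by (intro exI[of _ "(X, Y, d, e)"]) auto
  qed
  then have "?P (SOME t. ?P t)"
    by (rule someI_ex)
  then obtain a b c where f: "adapted_frame X Y a b c d e y"
    unfolding s prod.case by blast
  show thesis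
    by (rule that[OF f]) (simp only: pr1_at_def[abs_def] s prod.case Let_def)
qed

lemma pr1_at_add: "pr1_at y (v + w) = pr1_at y v + pr1_at y w"
proof -
  obtain X Y a b c d e where f: "adapted_frame X Y a b c d e y"
    and p: "pr1_at y = (\<lambda>v. - levi X Y y *\<^sub>R (d y v *\<^sub>R X y + e y v *\<^sub>R Y y))"
    by (rule pr1_at_frame[of y])
  show ?thesis
    unfolding p by (simp only: one_form_simps[OF adapted_frame_at(7)[OF f]]
        one_form_simps[OF adapted_frame_at(8)[OF f]] scaleR_add_left scaleR_add_right add_ac)
qed

lemma pr1_at_scale: "pr1_at y (k *\<^sub>R v) = k *\<^sub>R pr1_at y v"
proof -
  obtain X Y a b c d e where f: "adapted_frame X Y a b c d e y"
    and p: "pr1_at y = (\<lambda>v. - levi X Y y *\<^sub>R (d y v *\<^sub>R X y + e y v *\<^sub>R Y y))"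
    by (rule pr1_at_frame[of y])
  show ?thesis
    unfolding p by (simp only: one_form_simps[OF adapted_frame_at(7)[OF f]]
        one_form_simps[OF adapted_frame_at(8)[OF f]] scaleR_add_right scaleR_scaleR mult_ac)
qed

lemma pr1_at_H: "pr1_at y v \<in> H y"
proof -
  obtain X Y a b c d e where f: "adapted_frame X Y a b c d e y"
    and p: "pr1_at y = (\<lambda>v. - levi X Y y *\<^sub>R (d y v *\<^sub>R X y + e y v *\<^sub>R Y y))"
    by (rule pr1_at_frame[of y])
  show ?thesis
    unfolding p using adapted_frame_at(2,3)[OF f]
    by (intro subspace_scale[OF subspace_H] subspace_add[OF subspace_H] G_H)
qed

lemma pr1_at_eq_0_iff:
  assumes "v \<in> tangent_space A y"
  shows "pr1_at y v = 0 \<longleftrightarrow> v \<in> T2 A H y"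
proof -
  obtain X Y a b c d e where f: "adapted_frame X Y a b c d e y"
    and p: "pr1_at y = (\<lambda>v. - levi X Y y *\<^sub>R (d y v *\<^sub>R X y + e y v *\<^sub>R Y y))"
    by (rule pr1_at_frame[of y])
  note fr = adapted_frame_at[OF f]
  define Z U W where ZUW: "Z = lie_bracket X Y" "U = lie_bracket X Z" "W = lie_bracket Y Z"
  have T2: "v \<in> T2 A H y \<longleftrightarrow> v = a y v *\<^sub>R X y + b y v *\<^sub>R Y y + c y v *\<^sub>R Z y"
    and T: "v = a y v *\<^sub>R X y + b y v *\<^sub>R Y y + c y v *\<^sub>R Z y + d y v *\<^sub>R U y + e y v *\<^sub>R W y"
    and du: "a y (X y) = 1" "a y (Y y) = 0" "b y (X y) = 0" "b y (Y y) = 1"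
      "d y (X y) = 0" "d y (Y y) = 0" "d y (Z y) = 0" "e y (X y) = 0" "e y (Y y) = 0" "e y (Z y) = 0"
    using fr(1) assms unfolding adapted_def Let_def ZUW by blast+
  show ?thesis
  proof
    assume "pr1_at y v = 0"
    then have z: "d y v *\<^sub>R X y + e y v *\<^sub>R Y y = 0"
      using alpha_frame[OF f] by (simp add: p)
    have "d y v = a y (d y v *\<^sub>R X y + e y v *\<^sub>R Y y)" "e y v = b y (d y v *\<^sub>R X y + e y v *\<^sub>R Y y)"
      by (simp_all add: one_form_simps[OF fr(4)] one_form_simps[OF fr(5)] du)
    then have "d y v = 0" "e y v = 0"
      unfolding z by (simp_all add: one_form_simps[OF fr(4)] one_form_simps[OF fr(5)])
    then show "v \<in> T2 A H y"
      using T unfolding T2 by simp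
  next
    assume "v \<in> T2 A H y"
    then have v: "v = a y v *\<^sub>R X y + b y v *\<^sub>R Y y + c y v *\<^sub>R Z y"
      unfolding T2 .
    have "d y v = 0" "e y v = 0"
      by (subst v, simp only: one_form_simps[OF fr(7)] one_form_simps[OF fr(8)] du mult_zero_right add_0)+
    then show "pr1_at y v = 0"
      unfolding p by simp
  qed
qed

text \<open>The frame in \<open>pr1_at\<close> is an arbitrary choice at each point; this formula
  describes the map without it. In [\<rho>, \<xi>] the coefficients of the triple brackets are -
  c(\<rho>) a(\<xi>) and - c(\<rho>) b(\<xi>), and c(\<rho>) times \<open>levi X Y\<close> is
  \<alpha>(\<rho>).\<close>

lemma part1_bracket [simp]:
  assumes \<rho>: "\<rho> \<in> G2" and \<xi>: "\<xi> \<in> G"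
  shows "part1 (lie_bracket \<rho> \<xi>) = fscale (pairing \<alpha> \<rho>) \<xi>"
proof
  fix y
  obtain X Y a b c d e where f: "adapted_frame X Y a b c d e y"
    and p: "pr1_at y = (\<lambda>v. - levi X Y y *\<^sub>R (d y v *\<^sub>R X y + e y v *\<^sub>R Y y))"
    by (rule pr1_at_frame[of y])
  note fr = adapted_frame_at[OF f]
  define Z where "Z = lie_bracket X Y"
  define U where "U = lie_bracket X Z"
  define W where "W = lie_bracket Y Z"
  have du: "d y (X y) = 0" "d y (Y y) = 0" "d y (Z y) = 0" "d y (U y) = 1" "d y (W y) = 0"
      "e y (X y) = 0" "e y (Y y) = 0" "e y (Z y) = 0" "e y (U y) = 0" "e y (W y) = 1"
    using fr(1) unfolding adapted_def Let_def Z_def U_def W_def by blast+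
  let ?\<rho> = "fscale (pairing a \<rho>) X + fscale (pairing b \<rho>) Y + fscale (pairing c \<rho>) Z"
  let ?\<xi> = "fscale (pairing a \<xi>) X + fscale (pairing b \<xi>) Y"
  have Fs: "pairing a \<xi> \<in> F" "pairing b \<xi> \<in> F" "pairing a \<rho> \<in> F" "pairing b \<rho> \<in> F" "pairing c \<rho> \<in> F"
    using fr(4-6) \<rho> \<xi> by simp_all
  have e: "eventually (\<lambda>y. \<rho> y = ?\<rho> y) (nhds y)" "eventually (\<lambda>y. \<xi> y = ?\<xi> y) (nhds y)"
    using adapted_frame_G2[OF f \<rho>] adapted_frame_G[OF f \<xi>] unfolding Z_def .
  have "lie_bracket \<rho> \<xi> y = lie_bracket ?\<rho> ?\<xi> y"
    by (rule bracket_local) (use e Fs fr(2,3) \<rho> \<xi> in \<open>simp_all add: Z_def\<close>)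
  moreover obtain p' q where "lie_bracket ?\<rho> ?\<xi> = fscale p' X + fscale q Y
      + fscale (\<lambda>x. pairing a \<rho> x * pairing b \<xi> x - pairing b \<rho> x * pairing a \<xi> x
          - pairing a \<xi> x * dir X (pairing c \<rho>) x - pairing b \<xi> x * dir Y (pairing c \<rho>) x) Z
      + fscale (\<lambda>x. - (pairing a \<xi> x * pairing c \<rho> x)) U
      + fscale (\<lambda>x. - (pairing b \<xi> x * pairing c \<rho> x)) W"
    using lie_bracket_frame[OF G_V[OF fr(2)] G_V[OF fr(3)] Fs] unfolding Z_def U_def W_def by blast
  ultimately have "d y (lie_bracket \<rho> \<xi> y) = - (pairing a \<xi> y * pairing c \<rho> y)"
      "e y (lie_bracket \<rho> \<xi> y) = - (pairing b \<xi> y * pairing c \<rho> y)"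
    by (simp_all add: fscale_def one_form_simps[OF fr(7)] one_form_simps[OF fr(8)] du)
  then have "pr1_at y (lie_bracket \<rho> \<xi> y)
      = (pairing c \<rho> y * levi X Y y) *\<^sub>R (pairing a \<xi> y *\<^sub>R X y + pairing b \<xi> y *\<^sub>R Y y)"
    unfolding p by (simp add: scaleR_add_right scaleR_diff_right mult_ac)
  also have "pairing a \<xi> y *\<^sub>R X y + pairing b \<xi> y *\<^sub>R Y y = \<xi> y"
    using eventually_nhds_x_imp_x[OF e(2)] by (simp add: fscale_def)
  also have "pairing c \<rho> y * levi X Y y = pairing \<alpha> \<rho> y"
  proof -
    have "pairing \<alpha> \<rho> y = pairing \<alpha> ?\<rho> y"
      using eventually_nhds_x_imp_x[OF e(1)] by (simp add: pairing_def)
    also have "\<dots> = pairing c \<rho> y * levi X Y y"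
      using fr(2,3) Fs by (simp add: Z_def levi_def)
    finally show ?thesis by simp
  qed
  finally show "part1 (lie_bracket \<rho> \<xi>) y = fscale (pairing \<alpha> \<rho>) \<xi> y"
    by (simp add: part1_def fscale_def)
qed

lemma part1_add [simp]: "part1 (\<zeta> + \<zeta>') = part1 \<zeta> + part1 \<zeta>'"
  by (simp add: part1_def pr1_at_add fun_eq_iff)

lemma part1_fscale [simp]: "part1 (fscale h \<zeta>) = fscale h (part1 \<zeta>)"
  unfolding part1_def fscale_def pr1_at_scale ..

lemma part1_minus [simp]: "part1 (- \<zeta>) = - part1 \<zeta>"
  using pr1_at_scale[of _ "-1"] by (simp add: part1_def fun_eq_iff)

lemma part1_diff [simp]: "part1 (\<zeta> - \<zeta>') = part1 \<zeta> - part1 \<zeta>'"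
  using part1_add[of \<zeta> "- \<zeta>'"] by simp

lemma part1_G2 [simp]: "\<rho> \<in> G2 \<Longrightarrow> part1 \<rho> = 0"
  using pr1_at_eq_0_iff[OF V_tangent] G2_T2 by (simp add: part1_def fun_eq_iff)

lemma G2_if_part1_0: "\<zeta> \<in> V \<Longrightarrow> part1 \<zeta> = 0 \<Longrightarrow> \<zeta> \<in> G2"
  using pr1_at_eq_0_iff[OF V_tangent] by (intro G2_I) (simp_all add: part1_def fun_eq_iff)

lemma part1_bracket' [simp]:
  "\<rho> \<in> G2 \<Longrightarrow> \<xi> \<in> G \<Longrightarrow> part1 (lie_bracket \<xi> \<rho>) = - fscale (pairing \<alpha> \<rho>) \<xi>"
  by (subst bracket_anti) (simp only: part1_minus part1_bracket)

text \<open>Frames chosen point by point do not show smoothness. On one fixed frame near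
  \<open>x\<close> the map is known from \<open>part1_bracket'\<close> and from its vanishing on
  \<open>T2\<close>, so linearity gives a smooth formula there.\<close>

lemma part1_G [simp]:
  assumes \<zeta>: "\<zeta> \<in> V"
  shows "part1 \<zeta> \<in> G"
proof (rule G_I)
  show "part1 \<zeta> y \<in> H y" for y
    by (simp add: part1_def pr1_at_H)
  show "part1 \<zeta> \<in> V"
  proof (rule V_glue)
    fix x
    obtain X Y a b c d e where f: "adapted_frame X Y a b c d e x"
      using adapted_frame_exists by blast
    note fr = adapted_frame_at[OF f]
    let ?L = "fscale (\<lambda>y. - (levi X Y y * pairing d \<zeta> y)) X + fscale (\<lambda>y. - (levi X Y y * pairing e \<zeta> y)) Y"
    have "eventually (\<lambda>y. part1 \<zeta> y = ?L y) (nhds x)"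
      using adapted_frame_near[OF f]
    proof eventually_elim
      case (elim y)
      define Z where "Z = lie_bracket X Y"
      define U where "U = lie_bracket X Z"
      define W where "W = lie_bracket Y Z"
      have v: "\<zeta> y = a y (\<zeta> y) *\<^sub>R X y + b y (\<zeta> y) *\<^sub>R Y y + c y (\<zeta> y) *\<^sub>R Z y
          + d y (\<zeta> y) *\<^sub>R U y + e y (\<zeta> y) *\<^sub>R W y"
        using adapted_frame_at(1)[OF elim] V_tangent[OF \<zeta>, of y]
        unfolding adapted_def Let_def Z_def U_def W_def by blast
      have "part1 X = 0" "part1 Y = 0" "part1 Z = 0"
        using fr(2,3) by (simp_all add: Z_def)
      moreover have "part1 U = - fscale (levi X Y) X" "part1 W = - fscale (levi X Y) Y"
        using fr(2,3) by (simp_all add: U_def W_def Z_def levi_def)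
      ultimately have "pr1_at y (X y) = 0" "pr1_at y (Y y) = 0" "pr1_at y (Z y) = 0"
          "pr1_at y (U y) = - levi X Y y *\<^sub>R X y" "pr1_at y (W y) = - levi X Y y *\<^sub>R Y y"
        unfolding part1_def fun_eq_iff[where 'a = 'a] by (simp_all add: fscale_def)
      then have "pr1_at y (\<zeta> y) = d y (\<zeta> y) *\<^sub>R (- levi X Y y *\<^sub>R X y) + e y (\<zeta> y) *\<^sub>R (- levi X Y y *\<^sub>R Y y)"
        by (subst v) (simp only: pr1_at_add pr1_at_scale scaleR_zero_right add_0)
      then show ?case
        by (simp add: part1_def fscale_def pairing_def mult.commute)
    qed
    moreover have "?L \<in> V"
      using fr \<zeta> by simp
    ultimately show "\<exists>Y\<in>V. eventually (\<lambda>y. part1 \<zeta> y = Y y) (nhds x)"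
      by blast
  qed
qed

section \<open>The generalized Reeb field\<close>

lemma levi_cong:
  assumes "\<xi> \<in> G" "\<eta> \<in> G" "\<xi>' \<in> G" "\<eta>' \<in> G" "\<xi> y = \<xi>' y" "\<eta> y = \<eta>' y"
  shows "levi \<xi> \<eta> y = levi \<xi>' \<eta>' y"
proof -
  obtain X Y a b c d e where f: "adapted_frame X Y a b c d e y"
    using adapted_frame_exists by blast
  show ?thesis
    unfolding levi_frame[OF f assms(1,2)] levi_frame[OF f assms(3,4)] pairing_def assms(5,6) ..
qed

text \<open>Cramer's rule in the plane \<open>H\<close>, with \<open>levi\<close> as
  determinant.\<close>

lemma plane_expand:
  assumes "X \<in> G" "Y \<in> G" "\<gamma> \<in> G"
  shows "fscale (levi X Y) \<gamma> = fscale (levi \<gamma> Y) X + fscale (levi X \<gamma>) Y"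
proof -
  have "fscale (levi X Y) \<gamma> + fscale (levi Y \<gamma>) X + fscale (levi \<gamma> X) Y = 0"
    using levi_plane assms by blast
  moreover have "fscale (levi Y \<gamma>) X = - fscale (levi \<gamma> Y) X" "fscale (levi \<gamma> X) Y = - fscale (levi X \<gamma>) Y"
    using levi_anti[of Y \<gamma>] levi_anti[of \<gamma> X] assms
    by (simp_all add: fun_eq_iff[where 'a = 'a] fscale_def)
  ultimately show ?thesis
    by (simp add: algebra_simps add_eq_0_iff2)
qed

lemma plane_expand_at:
  assumes "X \<in> G" "Y \<in> G" "\<gamma> \<in> G" "levi X Y y = 1"
  shows "\<gamma> y = levi \<gamma> Y y *\<^sub>R X y + levi X \<gamma> y *\<^sub>R Y y"
  using fun_cong[OF plane_expand[OF assms(1-3)], of y] assms(4) by (simp add: fscale_def)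

lemma levi_nondegenerate:
  assumes "\<sigma> \<in> G" "\<And>\<gamma>. \<gamma> \<in> G \<Longrightarrow> levi \<gamma> \<sigma> y = 0"
  shows "\<sigma> y = 0"
proof -
  obtain X Y where XY: "X \<in> G" "Y \<in> G" "eventually (\<lambda>y. levi X Y y = 1) (nhds y)"
    using levi_unit_pair by blast
  show ?thesis
    using plane_expand_at[OF XY(1,2) assms(1) eventually_nhds_x_imp_x[OF XY(3)]]
      assms(2)[OF XY(1)] assms(2)[OF XY(2)] levi_anti[OF assms(1) XY(2), of y] by simp
qed

text \<open>Alternating forms on a plane are multiples of the area form. \<open>P\<close> is a
  functional of sections, function-linear with coefficients evaluated at the single point
  \<open>y\<close>; skew symmetry carries linearity over to the second argument.\<close>

lemma alternating_form:
  assumes X: "X \<in> G" and Y: "Y \<in> G" and 1: "levi X Y y = 1"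
    and add: "\<And>\<xi> \<xi>' \<eta>. \<xi> \<in> G \<Longrightarrow> \<xi>' \<in> G \<Longrightarrow> \<eta> \<in> G \<Longrightarrow> P (\<xi> + \<xi>') \<eta> = P \<xi> \<eta> + (P \<xi>' \<eta> :: real)"
    and scale: "\<And>g \<xi> \<eta>. g \<in> F \<Longrightarrow> \<xi> \<in> G \<Longrightarrow> \<eta> \<in> G \<Longrightarrow> P (fscale g \<xi>) \<eta> = g y * P \<xi> \<eta>"
    and anti: "\<And>\<xi> \<eta>. \<xi> \<in> G \<Longrightarrow> \<eta> \<in> G \<Longrightarrow> P \<xi> \<eta> = - P \<eta> \<xi>"
    and "\<xi> \<in> G" "\<eta> \<in> G"
  shows "P \<xi> \<eta> = levi \<xi> \<eta> y * P X Y"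
proof -
  have expand: "P \<xi> \<eta> = levi \<xi> Y y * P X \<eta> + levi X \<xi> y * P Y \<eta>" if "\<xi> \<in> G" "\<eta> \<in> G" for \<xi> \<eta>
  proof -
    have "P \<xi> \<eta> = P (fscale (levi X Y) \<xi>) \<eta>"
      using scale[OF levi_F[OF X Y] that] 1 by simp
    also have "\<dots> = P (fscale (levi \<xi> Y) X + fscale (levi X \<xi>) Y) \<eta>"
      using plane_expand[OF X Y that(1)] by simp
    also have "\<dots> = levi \<xi> Y y * P X \<eta> + levi X \<xi> y * P Y \<eta>"
      using X Y that by (subst add) (simp_all add: scale)
    finally show ?thesis .
  qed
  have z: "P X X = 0" "P Y Y = 0" "P Y X = - P X Y"
    using anti[OF X X] anti[OF Y Y] anti[OF Y X] by simp_all
  have "P X \<eta> = levi X \<eta> y * P X Y" "P Y \<eta> = - levi \<eta> Y y * P X Y"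
    using expand[of \<eta> X] expand[of \<eta> Y] anti[of X \<eta>] anti[of Y \<eta>] X Y assms(8) z by simp_all
  then have "P \<xi> \<eta> = (levi \<xi> Y y * levi X \<eta> y - levi X \<xi> y * levi \<eta> Y y) * P X Y"
    using expand[OF assms(7,8)] by (simp add: algebra_simps)
  also have "levi \<xi> Y y * levi X \<eta> y - levi X \<xi> y * levi \<eta> Y y = levi \<xi> \<eta> y"
  proof -
    have "levi X Y y * levi \<xi> \<eta> y + levi Y \<xi> y * levi X \<eta> y + levi \<xi> X y * levi Y \<eta> y = 0"
      by (rule levi_plane_levi) fact+
    moreover have "levi Y \<xi> y = - levi \<xi> Y y" "levi \<xi> X y = - levi X \<xi> y" "levi Y \<eta> y = - levi \<eta> Y y"
      by (rule levi_anti; fact)+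
    ultimately show ?thesis
      using 1 by simp
  qed
  finally show ?thesis .
qed

text \<open>At a point with \<open>levi X Y = 1\<close> the section \<tau>(Y) X - \<tau>(X) Y solves
  the equation, by Cramer's rule. Nondegeneracy makes its value there independent of the pair, so
  \<sigma> may be chosen point by point and is smooth by gluing.\<close>

lemma levi_dual_exists:
  assumes \<tau>: "\<And>\<gamma>. \<gamma> \<in> G \<Longrightarrow> \<tau> \<gamma> \<in> F"
    and add: "\<And>\<gamma> \<gamma>' y. \<gamma> \<in> G \<Longrightarrow> \<gamma>' \<in> G \<Longrightarrow> \<tau> (\<gamma> + \<gamma>') y = \<tau> \<gamma> y + \<tau> \<gamma>' y"
    and scale: "\<And>g \<gamma> y. g \<in> F \<Longrightarrow> \<gamma> \<in> G \<Longrightarrow> \<tau> (fscale g \<gamma>) y = g y * \<tau> \<gamma> y"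
  obtains \<sigma> where "\<sigma> \<in> G" "\<And>\<gamma> y. \<gamma> \<in> G \<Longrightarrow> levi \<sigma> \<gamma> y = \<tau> \<gamma> y"
proof -
  define loc where "loc p = fscale (\<tau> (snd p)) (fst p) - fscale (\<tau> (fst p)) (snd p)" for p
  define ok where "ok p y \<longleftrightarrow> fst p \<in> G \<and> snd p \<in> G \<and> levi (fst p) (snd p) y = 1" for p y
  have locG: "loc p \<in> G" if "ok p y" for p y
    using that \<tau> by (simp add: ok_def loc_def)
  have levi_loc: "levi (loc p) \<gamma> y = \<tau> \<gamma> y" if p: "ok p y" and \<gamma>: "\<gamma> \<in> G" for p y \<gamma>
  proof -
    obtain X Y where XY: "p = (X, Y)" by fastforce
    then have G: "X \<in> G" "Y \<in> G" "levi X Y y = 1" using p by (simp_all add: ok_def)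
    have "\<tau> \<gamma> y = \<tau> (fscale (levi X Y) \<gamma>) y"
      using G \<gamma> by (simp add: scale)
    also have "\<dots> = levi \<gamma> Y y * \<tau> X y + levi X \<gamma> y * \<tau> Y y"
      unfolding plane_expand[OF G(1,2) \<gamma>] using G \<gamma> by (subst add) (simp_all add: scale)
    finally show ?thesis
      using G \<gamma> \<tau> levi_anti[OF G(2) \<gamma>, of y] by (simp add: loc_def XY)
  qed
  have uniq: "loc p y = loc q y" if "ok p y" "ok q y" for p q y
  proof -
    have "(loc p - loc q) y = 0"
    proof (rule levi_nondegenerate)
      show d: "loc p - loc q \<in> G" using that locG by simp
      show "levi \<gamma> (loc p - loc q) y = 0" if "\<gamma> \<in> G" for \<gamma>
        using levi_loc[OF \<open>ok p y\<close> that] levi_loc[OF \<open>ok q y\<close> that] that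
          locG[OF \<open>ok p y\<close>] locG[OF \<open>ok q y\<close>] levi_anti[OF that d, of y] by simp
    qed
    then show ?thesis by simp
  qed
  define \<sigma> where "\<sigma> y = loc (SOME p. ok p y) y" for y
  have \<sigma>: "\<sigma> y = loc p y" if "ok p y" for p y
    unfolding \<sigma>_def by (rule uniq[OF someI[of "\<lambda>p. ok p y"]]) (rule that)+
  have near: "\<exists>p. ok p x \<and> eventually (\<lambda>y. \<sigma> y = loc p y) (nhds x)" for x
  proof -
    obtain X Y where XY: "X \<in> G" "Y \<in> G" "eventually (\<lambda>y. levi X Y y = 1) (nhds x)"
      using levi_unit_pair by blast
    have "eventually (ok (X, Y)) (nhds x)"
      using XY(3) by eventually_elim (simp add: ok_def XY)
    moreover from this have "eventually (\<lambda>y. \<sigma> y = loc (X, Y) y) (nhds x)"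
      by eventually_elim (rule \<sigma>)
    ultimately show ?thesis
      using eventually_nhds_x_imp_x by blast
  qed
  have G: "\<sigma> \<in> G"
  proof (rule G_I)
    show "\<sigma> \<in> V"
      using near locG G_V by (intro V_glue) blast
    fix x
    obtain p where p: "ok p x" using near by blast
    show "\<sigma> x \<in> H x"
      unfolding \<sigma>[OF p] by (rule G_H[OF locG[OF p]])
  qed
  show thesis
  proof (rule that[OF G])
    fix \<gamma> y assume \<gamma>: "\<gamma> \<in> G"
    obtain p where p: "ok p y" using near by blast
    have "levi \<sigma> \<gamma> y = levi (loc p) \<gamma> y"
      by (rule levi_cong) (use G \<gamma> locG[OF p] \<sigma>[OF p] in simp_all)
    then show "levi \<sigma> \<gamma> y = \<tau> \<gamma> y"
      using levi_loc[OF p \<gamma>] by simp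
  qed
qed

text \<open>Applying \<open>part1\<close> to \<open>{\<nabla>\<^sub>\<xi> \<eta>, \<phi>} = q\<^sub>-\<^sub>3[\<xi>, [\<eta>, r]]\<close> changes the sign of both sides of this formula.\<close>

definition nab :: "'a vfield \<Rightarrow> 'a vfield \<Rightarrow> 'a vfield \<Rightarrow> 'a vfield"
  where "nab \<rho> \<xi> \<eta> = part1 (lie_bracket \<xi> (lie_bracket \<rho> \<eta>))"

lemma nab_G [simp]: "\<rho> \<in> G2 \<Longrightarrow> \<xi> \<in> G \<Longrightarrow> \<eta> \<in> G \<Longrightarrow> nab \<rho> \<xi> \<eta> \<in> G"
  by (simp add: nab_def)

text \<open>In the rule for \<open>fscale g \<eta>\<close> the derivative of \<open>g\<close> along
  \<rho> multiplies a section of \<open>H\<close> whose bracket with \<xi> lies in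
  \<open>T2\<close>, so \<open>part1\<close> removes it; the derivative along \<xi> survives with
  the factor \<open>pairing \<alpha> \<rho>\<close>.\<close>

lemma nab_linear:
  assumes "\<rho> \<in> G2" "\<xi> \<in> G" "\<eta> \<in> G"
  shows nab_add_left: "\<gamma> \<in> G \<Longrightarrow> nab \<rho> (\<xi> + \<gamma>) \<eta> = nab \<rho> \<xi> \<eta> + nab \<rho> \<gamma> \<eta>"
    and nab_diff_left: "\<gamma> \<in> G \<Longrightarrow> nab \<rho> (\<xi> - \<gamma>) \<eta> = nab \<rho> \<xi> \<eta> - nab \<rho> \<gamma> \<eta>"
    and nab_add_right: "\<gamma> \<in> G \<Longrightarrow> nab \<rho> \<xi> (\<eta> + \<gamma>) = nab \<rho> \<xi> \<eta> + nab \<rho> \<xi> \<gamma>"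
    and nab_fscale_left: "g \<in> F \<Longrightarrow> nab \<rho> (fscale g \<xi>) \<eta> = fscale g (nab \<rho> \<xi> \<eta>)"
    and nab_fscale_right: "g \<in> F \<Longrightarrow> nab \<rho> \<xi> (fscale g \<eta>)
      = fscale g (nab \<rho> \<xi> \<eta>) + fscale (\<lambda>x. pairing \<alpha> \<rho> x * dir \<xi> g x) \<eta>"
  unfolding nab_def using assms
  by (simp_all add: bracket_add_left bracket_add_right bracket_diff_left bracket_diff_right
      bracket_fscale_left bracket_fscale_right fun_eq_iff[where 'a = 'a] fun_eq_iff[where 'b = real]
      fscale_eval mult_ac)

lemma nab_shift:
  assumes "\<rho> \<in> G2" "\<sigma> \<in> G" "\<xi> \<in> G" "\<eta> \<in> G"
  shows "nab (\<rho> + \<sigma>) \<xi> \<eta> = nab \<rho> \<xi> \<eta> - fscale (levi \<sigma> \<eta>) \<xi>"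
  unfolding nab_def using assms by (simp add: bracket_add_left bracket_add_right levi_def)

lemma nab_local:
  assumes "\<rho> \<in> G2" "\<rho>' \<in> G2" "\<xi> \<in> G" "\<eta> \<in> G" "eventually (\<lambda>z. \<rho> z = \<rho>' z) (nhds y)"
  shows "nab \<rho> \<xi> \<eta> y = nab \<rho>' \<xi> \<eta> y"
proof -
  have "eventually (\<lambda>z. eventually (\<lambda>z. \<rho> z = \<rho>' z) (nhds z)) (nhds y)"
    using assms(5) by (simp add: eventually_eventually)
  then have "eventually (\<lambda>z. lie_bracket \<rho> \<eta> z = lie_bracket \<rho>' \<eta> z) (nhds y)"
    by eventually_elim (rule bracket_local, use assms in simp_all)
  then have "lie_bracket \<xi> (lie_bracket \<rho> \<eta>) y = lie_bracket \<xi> (lie_bracket \<rho>' \<eta>) y"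
    using assms by (intro bracket_local) simp_all
  then show ?thesis
    by (simp add: nab_def part1_def)
qed

text \<open>For \<rho> with \<alpha>(\<rho>) = 1 this is the covariant derivative of the area form
  along \<gamma>.\<close>

definition defect :: "'a vfield \<Rightarrow> 'a vfield \<Rightarrow> 'a vfield \<Rightarrow> 'a vfield \<Rightarrow> 'a \<Rightarrow> real"
  where "defect \<rho> \<gamma> \<xi> \<eta> y = dir \<gamma> (levi \<xi> \<eta>) y - levi (nab \<rho> \<gamma> \<xi>) \<eta> y - levi \<xi> (nab \<rho> \<gamma> \<eta>) y"

text \<open>A condition on the germ of \<rho> at \<open>y\<close>: the normalisation is imposed
  nearby, since \<open>nab\<close> differentiates \<rho>.\<close>

definition reeb_at :: "'a vfield \<Rightarrow> 'a \<Rightarrow> bool"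
  where "reeb_at \<rho> y \<longleftrightarrow> eventually (\<lambda>z. pairing \<alpha> \<rho> z = 1) (nhds y) \<and>
    (\<forall>\<gamma>\<in>G. \<forall>\<xi>\<in>G. \<forall>\<eta>\<in>G. defect \<rho> \<gamma> \<xi> \<eta> y = 0)"

text \<open>By the Pluecker relation, a change of \<rho> along \<open>H\<close> alters the defect by
  a multiple of the area form with factor - \<open>levi \<gamma> \<sigma>\<close>. As
  \<open>levi\<close> is nondegenerate, this makes the Reeb condition solvable in exactly one
  way.\<close>

lemma defect_shift:
  assumes "\<rho> \<in> G2" "\<sigma> \<in> G" "\<gamma> \<in> G" "\<xi> \<in> G" "\<eta> \<in> G"
  shows "defect (\<rho> + \<sigma>) \<gamma> \<xi> \<eta> y = defect \<rho> \<gamma> \<xi> \<eta> y - levi \<gamma> \<sigma> y * levi \<xi> \<eta> y"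
proof -
  have "levi \<sigma> \<xi> y * levi \<gamma> \<eta> y + levi \<xi> \<gamma> y * levi \<sigma> \<eta> y + levi \<gamma> \<sigma> y * levi \<xi> \<eta> y = 0"
    by (rule levi_plane_levi) (use assms in simp_all)
  then show ?thesis
    using assms by (simp add: defect_def nab_shift algebra_simps)
qed

lemma defect_local:
  assumes "\<rho> \<in> G2" "\<rho>' \<in> G2" "\<gamma> \<in> G" "\<xi> \<in> G" "\<eta> \<in> G" "eventually (\<lambda>z. \<rho> z = \<rho>' z) (nhds y)"
  shows "defect \<rho> \<gamma> \<xi> \<eta> y = defect \<rho>' \<gamma> \<xi> \<eta> y"
  using assms levi_cong[of "nab \<rho> \<gamma> \<xi>" \<eta> "nab \<rho>' \<gamma> \<xi>" \<eta> y] levi_cong[of \<xi> "nab \<rho> \<gamma> \<eta>" \<xi> "nab \<rho>' \<gamma> \<eta>" y]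
    nab_local[of \<rho> \<rho>' \<gamma> \<xi> y] nab_local[of \<rho> \<rho>' \<gamma> \<eta> y]
  by (simp add: defect_def)

lemma reeb_at_local:
  assumes "\<rho> \<in> G2" "\<rho>' \<in> G2" "eventually (\<lambda>z. \<rho> z = \<rho>' z) (nhds y)" "reeb_at \<rho>' y"
  shows "reeb_at \<rho> y"
proof -
  have "eventually (\<lambda>z. pairing \<alpha> \<rho>' z = 1) (nhds y)"
    using assms(4) by (simp add: reeb_at_def)
  then have "eventually (\<lambda>z. pairing \<alpha> \<rho> z = 1) (nhds y)"
    using assms(3) by eventually_elim (simp add: pairing_def)
  then show ?thesis
    using assms(4) defect_local[OF assms(1,2) _ _ _ assms(3)] by (simp add: reeb_at_def)
qed

text \<open>Near \<open>y\<close> two candidates differ by a section of \<open>H\<close>, which by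
  \<open>defect_shift\<close> is \<open>levi\<close>-orthogonal to \<open>H\<close> at
  \<open>y\<close> and hence zero there. The bump function makes the difference a global section of
  \<open>H\<close>.\<close>

lemma reeb_at_unique:
  assumes \<rho>: "\<rho> \<in> G2" "\<rho>' \<in> G2" and r: "reeb_at \<rho> y" "reeb_at \<rho>' y"
  shows "\<rho> y = \<rho>' y"
proof -
  have "eventually (\<lambda>z. pairing \<alpha> \<rho> z = 1 \<and> pairing \<alpha> \<rho>' z = 1) (nhds y)"
    using r by (simp add: reeb_at_def eventually_conj)
  then obtain b where b: "b \<in> F" "eventually (\<lambda>z. b z = 1) (nhds y)" "b y = 1"
      "\<forall>z. \<not> (pairing \<alpha> \<rho> z = 1 \<and> pairing \<alpha> \<rho>' z = 1) \<longrightarrow> b z = 0"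
    using bump_exists by blast
  define \<sigma> where "\<sigma> = fscale b (\<rho>' - \<rho>)"
  have \<sigma>: "\<sigma> \<in> G"
  proof (rule G_if_alpha_0)
    show "\<sigma> \<in> G2" using \<rho> b by (simp add: \<sigma>_def)
    show "pairing \<alpha> \<sigma> z = 0" for z
      using b(4)[rule_format, of z] \<rho> by (auto simp: \<sigma>_def)
  qed
  have ev: "eventually (\<lambda>z. \<rho>' z = (\<rho> + \<sigma>) z) (nhds y)"
    using b(2) by eventually_elim (simp add: \<sigma>_def fscale_def)
  have "levi \<gamma> \<sigma> y = 0" if \<gamma>: "\<gamma> \<in> G" for \<gamma>
  proof -
    obtain X Y where XY: "X \<in> G" "Y \<in> G" "eventually (\<lambda>y. levi X Y y = 1) (nhds y)"
      using levi_unit_pair by blast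
    have "defect \<rho> \<gamma> X Y y = 0" "defect \<rho>' \<gamma> X Y y = 0"
      using r \<gamma> XY by (simp_all add: reeb_at_def)
    moreover have "defect \<rho>' \<gamma> X Y y = defect (\<rho> + \<sigma>) \<gamma> X Y y"
      by (rule defect_local) (use ev \<rho> \<sigma> \<gamma> XY in simp_all)
    ultimately show ?thesis
      using defect_shift[OF \<rho>(1) \<sigma> \<gamma> XY(1,2), of y] eventually_nhds_x_imp_x[OF XY(3)] by simp
  qed
  then have "\<sigma> y = 0"
    using levi_nondegenerate \<sigma> by blast
  then show ?thesis
    using b(3) by (simp add: \<sigma>_def fscale_def)
qed

lemma reeb_at_exists:
  obtains \<rho> where "\<rho> \<in> G2" "eventually (reeb_at \<rho>) (nhds x)"
proof -
  obtain X Y where X: "X \<in> G" and Y: "Y \<in> G" and XY: "eventually (\<lambda>y. levi X Y y = 1) (nhds x)"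
    using levi_unit_pair by blast
  define Z where "Z = lie_bracket X Y"
  have Z: "Z \<in> G2" using X Y by (simp add: Z_def)
  define \<tau> where "\<tau> \<gamma> = (\<lambda>y. - (levi (nab Z \<gamma> X) Y y + levi X (nab Z \<gamma> Y) y))" for \<gamma>
  have \<tau>: "\<tau> \<gamma> \<in> F" if "\<gamma> \<in> G" for \<gamma>
    using that X Y Z by (simp add: \<tau>_def)
  define \<sigma> where "\<sigma> = fscale (\<tau> X) Y - fscale (\<tau> Y) X"
  have \<sigma>: "\<sigma> \<in> G" using X Y \<tau> by (simp add: \<sigma>_def)
  \<comment> \<open>\<open>\<tau>\<close> is the defect of \<open>Z\<close>, and \<open>\<sigma>\<close> solves \<open>levi \<gamma> \<sigma> = \<tau> \<gamma>\<close>.\<close>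
  show thesis
  proof (rule that[of "Z + \<sigma>"])
    show "Z + \<sigma> \<in> G2" using Z \<sigma> by simp
    have "eventually (\<lambda>y. eventually (\<lambda>z. levi X Y z = 1) (nhds y)) (nhds x)"
      using XY by (simp add: eventually_eventually)
    then show "eventually (reeb_at (Z + \<sigma>)) (nhds x)"
    proof eventually_elim
      case (elim y)
      have 1: "levi X Y y = 1" using elim by (rule eventually_nhds_x_imp_x)
      have \<alpha>: "pairing \<alpha> (Z + \<sigma>) z = levi X Y z" for z
        using Z \<sigma> by (simp add: Z_def levi_def)
      have Z\<sigma>: "Z + \<sigma> \<in> G2" using Z \<sigma> by simp
      have d0: "dir \<gamma> (levi X Y) y = 0" if "\<gamma> \<in> G" for \<gamma>
        using V_local[OF G_V[OF that] levi_F[OF X Y] F_const elim] that by simp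
      have dZ: "defect Z \<gamma> X Y y = \<tau> \<gamma> y" if "\<gamma> \<in> G" for \<gamma>
        using d0[OF that] by (simp add: defect_def \<tau>_def)
      have DX: "defect (Z + \<sigma>) X X Y y = 0"
        using defect_shift[OF Z \<sigma> X X Y, of y] dZ[OF X] 1 X Y \<tau> by (simp add: \<sigma>_def)
      have DY: "defect (Z + \<sigma>) Y X Y y = 0"
        using defect_shift[OF Z \<sigma> Y X Y, of y] dZ[OF Y] 1 X Y \<tau> levi_anti[OF Y X, of y] by (simp add: \<sigma>_def)
      have D: "defect (Z + \<sigma>) \<gamma> X Y y = 0" if \<gamma>: "\<gamma> \<in> G" for \<gamma>
      proof -
        have "defect (Z + \<sigma>) \<gamma> X Y y = defect (Z + \<sigma>) (fscale (levi X Y) \<gamma>) X Y y"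
          using X Y Z\<sigma> \<gamma> 1 by (simp add: defect_def nab_fscale_left)
        also have "\<dots> = defect (Z + \<sigma>) (fscale (levi \<gamma> Y) X + fscale (levi X \<gamma>) Y) X Y y"
          by (simp add: plane_expand[OF X Y \<gamma>])
        also have "\<dots> = levi \<gamma> Y y * defect (Z + \<sigma>) X X Y y + levi X \<gamma> y * defect (Z + \<sigma>) Y X Y y"
          using X Y Z\<sigma> \<gamma> by (simp add: defect_def nab_fscale_left nab_add_left algebra_simps)
        finally show ?thesis by (simp add: DX DY)
      qed
      show ?case
        unfolding reeb_at_def \<alpha>
      proof (intro conjI ballI)
        fix \<gamma> \<xi> \<eta> assume \<gamma>: "\<gamma> \<in> G" and "\<xi> \<in> G" "\<eta> \<in> G"
        \<comment> \<open>The defect is alternating and function-linear in \<xi> and \<eta>: the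
          derivative of a coefficient in \<open>dir \<gamma>\<close> cancels the Leibniz term of
          \<open>nab\<close>, since \<open>pairing \<alpha> (Z + \<sigma>)\<close> is 1 at
          \<open>y\<close>. So the pair \<open>X\<close>, \<open>Y\<close> decides.\<close>
        have "defect (Z + \<sigma>) \<gamma> \<xi> \<eta> y = levi \<xi> \<eta> y * defect (Z + \<sigma>) \<gamma> X Y y"
        proof (rule alternating_form[OF X Y 1])
          fix \<xi> \<xi>' \<eta> g assume G: "\<xi> \<in> G" "\<xi>' \<in> G" "\<eta> \<in> G"
          have l: "levi (\<xi> + \<xi>') \<eta> = (\<lambda>x. levi \<xi> \<eta> x + levi \<xi>' \<eta> x)"
            using G by (simp add: fun_eq_iff)
          show "defect (Z + \<sigma>) \<gamma> (\<xi> + \<xi>') \<eta> y = defect (Z + \<sigma>) \<gamma> \<xi> \<eta> y + defect (Z + \<sigma>) \<gamma> \<xi>' \<eta> y"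
            using G \<gamma> Z\<sigma> by (simp add: defect_def l nab_add_right)
        next
          fix \<xi> \<eta> g assume G: "\<xi> \<in> G" "\<eta> \<in> G" "g \<in> F"
          have l: "levi (fscale g \<xi>) \<eta> = (\<lambda>x. g x * levi \<xi> \<eta> x)"
            using G by (simp add: fun_eq_iff)
          show "defect (Z + \<sigma>) \<gamma> (fscale g \<xi>) \<eta> y = g y * defect (Z + \<sigma>) \<gamma> \<xi> \<eta> y"
            using G \<gamma> Z\<sigma> 1 X Y by (simp add: defect_def l nab_fscale_right \<alpha> algebra_simps)
        next
          fix \<xi> \<eta> assume G: "\<xi> \<in> G" "\<eta> \<in> G"
          have l: "levi \<xi> \<eta> = (\<lambda>x. - levi \<eta> \<xi> x)"
            using levi_anti[OF G] by (simp add: fun_eq_iff)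
          show "defect (Z + \<sigma>) \<gamma> \<xi> \<eta> y = - defect (Z + \<sigma>) \<gamma> \<eta> \<xi> y"
            using G \<gamma> Z\<sigma> levi_anti[of "nab (Z + \<sigma>) \<gamma> \<xi>" \<eta> y] levi_anti[of \<xi> "nab (Z + \<sigma>) \<gamma> \<eta>" y]
            by (simp add: defect_def l)
        qed fact+
        then show "defect (Z + \<sigma>) \<gamma> \<xi> \<eta> y = 0"
          by (simp add: D[OF \<gamma>])
      qed (rule elim)
    qed
  qed
qed

definition reeb :: "'a vfield \<Rightarrow> bool" where
  "reeb r \<longleftrightarrow> r \<in> G2 \<and> (\<forall>y. pairing \<alpha> r y = 1) \<and>
    (\<forall>\<gamma>\<in>G. \<forall>\<xi>\<in>G. \<forall>\<eta>\<in>G. \<forall>y. dir \<gamma> (levi \<xi> \<eta>) y = levi (nab r \<gamma> \<xi>) \<eta> y + levi \<xi> (nab r \<gamma> \<eta>) y)"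

lemma reeb_iff: "reeb r \<longleftrightarrow> r \<in> G2 \<and> (\<forall>y. reeb_at r y)"
proof -
  have "(\<forall>y. pairing \<alpha> r y = 1) \<longleftrightarrow> (\<forall>y. eventually (\<lambda>z. pairing \<alpha> r z = 1) (nhds y))"
    by (auto dest: eventually_nhds_x_imp_x)
  then show ?thesis
    unfolding reeb_def reeb_at_def defect_def by (auto simp: algebra_simps)
qed

lemma reeb_unique: "reeb r \<Longrightarrow> reeb r' \<Longrightarrow> r = r'"
  using reeb_at_unique unfolding reeb_iff by blast

text \<open>Solutions exist near each point and their values are unique at each point, so they fit
  together; the condition, being one on germs, passes to the glued field.\<close>

lemma reeb_exists: "\<exists>r. reeb r"
proof -
  define r where "r y = (THE v. \<exists>\<rho>\<in>G2. reeb_at \<rho> y \<and> \<rho> y = v)" for y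
  have r: "r y = \<rho> y" if "\<rho> \<in> G2" "reeb_at \<rho> y" for \<rho> y
    unfolding r_def using that reeb_at_unique by (intro the_equality) blast+
  have loc: "\<exists>\<rho>\<in>G2. eventually (\<lambda>y. r y = \<rho> y) (nhds x) \<and> reeb_at \<rho> x" for x
  proof -
    obtain \<rho> where \<rho>: "\<rho> \<in> G2" "eventually (reeb_at \<rho>) (nhds x)"
      by (rule reeb_at_exists)
    have "eventually (\<lambda>y. r y = \<rho> y) (nhds x)"
      using \<rho>(2) by eventually_elim (rule r[OF \<rho>(1)])
    then show ?thesis
      using \<rho> eventually_nhds_x_imp_x by blast
  qed
  have "r \<in> V"
    using loc G2_V by (intro V_glue) blast
  have G2: "r \<in> G2"
  proof (rule G2_I[OF \<open>r \<in> V\<close>])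
    fix x
    obtain \<rho> where \<rho>: "\<rho> \<in> G2" "reeb_at \<rho> x" using loc by blast
    show "r x \<in> T2 A H x"
      unfolding r[OF \<rho>] by (rule G2_T2[OF \<rho>(1)])
  qed
  have "reeb_at r x" for x
    using loc[of x] reeb_at_local[OF G2] by blast
  then show ?thesis
    using G2 unfolding reeb_iff by blast
qed

end

section \<open>Evaluation of the constructions\<close>

lemma coset_eq_iff:
  assumes "subspace S"
  shows "(\<lambda>w. u + w) ` S = (\<lambda>w. v + w) ` S \<longleftrightarrow> u - v \<in> S"
proof
  assume "(\<lambda>w. u + w) ` S = (\<lambda>w. v + w) ` S"
  moreover have "u + 0 \<in> (\<lambda>w. u + w) ` S"
    using subspace_0[OF assms] by blast
  ultimately obtain w where "w \<in> S" "u + 0 = v + w" by blast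
  then show "u - v \<in> S" by (simp add: algebra_simps)
next
  have sub: "(\<lambda>w. u + w) ` S \<subseteq> (\<lambda>w. v + w) ` S" if "u - v \<in> S" for u v
  proof
    fix z assume "z \<in> (\<lambda>w. u + w) ` S"
    then obtain w where "w \<in> S" "z = u + w" by blast
    then have "z = v + (u - v + w)" "u - v + w \<in> S"
      using subspace_add[OF assms that] by auto
    then show "z \<in> (\<lambda>w. v + w) ` S" by blast
  qed
  assume "u - v \<in> S"
  moreover from this have "v - u \<in> S"
    using subspace_neg[OF assms] by fastforce
  ultimately show "(\<lambda>w. u + w) ` S = (\<lambda>w. v + w) ` S"
    using sub by blast
qed

lemma qmap_eq_iff:
  assumes "\<And>x. subspace (W x)"
  shows "qmap W X = qmap W Y \<longleftrightarrow> (\<forall>x. X x - Y x \<in> W x)"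
  unfolding qmap_def fun_eq_iff[where 'a = 'a] coset_eq_iff[OF assms] ..

lemma q_add_qmap:
  assumes "\<And>x. subspace (W x)"
  shows "q_add (qmap W X) (qmap W Y) = qmap W (X + Y)"
proof
  fix x
  show "q_add (qmap W X) (qmap W Y) x = qmap W (X + Y) x"
  proof (intro equalityI subsetI)
    fix z assume "z \<in> q_add (qmap W X) (qmap W Y) x"
    then obtain u v where "u \<in> W x" "v \<in> W x" "z = (X x + u) + (Y x + v)"
      by (auto simp: q_add_def qmap_def)
    then have "z = (X + Y) x + (u + v)" "u + v \<in> W x"
      using subspace_add[OF assms] by (simp_all add: add_ac)
    then show "z \<in> qmap W (X + Y) x"
      unfolding qmap_def by blast
  next
    fix z assume "z \<in> qmap W (X + Y) x"
    then obtain u where "u \<in> W x" "z = (X x + u) + (Y x + 0)"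
      by (auto simp: qmap_def add_ac)
    then show "z \<in> q_add (qmap W X) (qmap W Y) x"
      unfolding q_add_def qmap_def using subspace_0[OF assms] by blast
  qed
qed

lemma q_scale_qmap:
  assumes "\<And>x. subspace (W x)"
  shows "q_scale W h (qmap W X) = qmap W (fscale h X)"
proof
  fix x
  show "q_scale W h (qmap W X) x = qmap W (fscale h X) x"
  proof (intro equalityI subsetI)
    fix z assume "z \<in> q_scale W h (qmap W X) x"
    then obtain u v where "u \<in> W x" "v \<in> W x" "z = h x *\<^sub>R (X x + u) + v"
      by (auto simp: q_scale_def qmap_def)
    then have "z = fscale h X x + (h x *\<^sub>R u + v)" "h x *\<^sub>R u + v \<in> W x"
      using subspace_add[OF assms subspace_scale[OF assms]]
      by (simp_all add: fscale_def scaleR_add_right add_ac)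
    then show "z \<in> qmap W (fscale h X) x"
      unfolding qmap_def by blast
  next
    fix z assume "z \<in> qmap W (fscale h X) x"
    then obtain u where "u \<in> W x" "z = h x *\<^sub>R (X x + 0) + u"
      by (auto simp: qmap_def fscale_def)
    then show "z \<in> q_scale W h (qmap W X) x"
      unfolding q_scale_def qmap_def using subspace_0[OF assms] by blast
  qed
qed

context contact
begin

text \<open>\<alpha> has kernel \<open>H\<close> in \<open>T2\<close> and so separates classes
  modulo \<open>H\<close>; together with \<open>part1\<close> modulo \<open>T2\<close> this turns
  equations of cosets into equations of functions and sections.\<close>

lemma qmap_H_eq_iff:
  assumes "\<rho> \<in> G2" "\<rho>' \<in> G2"
  shows "qmap H \<rho> = qmap H \<rho>' \<longleftrightarrow> pairing \<alpha> \<rho> = pairing \<alpha> \<rho>'"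
proof -
  have "\<rho> x - \<rho>' x \<in> H x \<longleftrightarrow> pairing \<alpha> \<rho> x = pairing \<alpha> \<rho>' x" for x
  proof -
    have m: "(\<rho> - \<rho>') x = \<rho> x - \<rho>' x"
      by (rule minus_apply)
    have t: "\<rho> x - \<rho>' x \<in> T2 A H x"
      using G2_T2[OF G2_diff[OF assms], of x] unfolding m .
    have "\<alpha> x (\<rho> x - \<rho>' x) = pairing \<alpha> \<rho> x - pairing \<alpha> \<rho>' x"
      using alpha_pairing(2)[OF assms, of x] unfolding pairing_def m .
    then show ?thesis
      unfolding alpha_kernel[of x, symmetric] mem_Collect_eq using t by (simp only: simp_thms right_minus_eq)
  qed
  then show ?thesis
    unfolding qmap_eq_iff[OF subspace_H] by (simp add: fun_eq_iff)
qed

lemma qmap_T2_eq_iff: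
  assumes "\<zeta> \<in> V" "\<zeta>' \<in> V"
  shows "qmap (T2 A H) \<zeta> = qmap (T2 A H) \<zeta>' \<longleftrightarrow> part1 \<zeta> = part1 \<zeta>'"
proof -
  have "\<zeta> x - \<zeta>' x \<in> T2 A H x \<longleftrightarrow> part1 (\<zeta> - \<zeta>') x = 0" for x
    using pr1_at_eq_0_iff[OF V_tangent[OF V_diff[OF assms]], of x]
    unfolding part1_def minus_apply by (simp only:)
  then show ?thesis
    unfolding qmap_eq_iff[OF subspace_T2] by (simp add: fun_eq_iff[where 'a = 'a])
qed

text \<open>Lifts of the same class have the same \<alpha>, and \<open>part1\<close> of the bracket
  with \<xi> depends on the lift only through \<alpha>, so the choice made by \<open>SOME\<close>
  disappears.\<close>

lemma levi12_qmap:
  assumes "\<rho> \<in> G2" "\<xi> \<in> G"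
  shows "levi12 A H \<xi> (qmap H \<rho>) = qmap (T2 A H) (lie_bracket \<xi> \<rho>)"
proof -
  define \<zeta> where "\<zeta> = (SOME \<zeta>. \<zeta> \<in> G2 \<and> qmap H \<zeta> = qmap H \<rho>)"
  have "\<zeta> \<in> G2 \<and> qmap H \<zeta> = qmap H \<rho>"
    unfolding \<zeta>_def by (rule someI[of _ \<rho>]) (simp add: assms)
  then have \<zeta>: "\<zeta> \<in> G2" "pairing \<alpha> \<zeta> = pairing \<alpha> \<rho>"
    using qmap_H_eq_iff assms(1) by blast+
  have "qmap (T2 A H) (lie_bracket \<xi> \<zeta>) = qmap (T2 A H) (lie_bracket \<xi> \<rho>)"
    using assms \<zeta> by (subst qmap_T2_eq_iff) simp_all
  then show ?thesis
    by (simp add: levi12_def \<zeta>_def)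
qed

lemma pconn_eq:
  assumes r: "r \<in> G2" "\<And>y. pairing \<alpha> r y = 1" and "\<xi> \<in> G" "\<eta> \<in> G"
  shows "pconn A H r \<xi> \<eta> = nab r \<xi> \<eta>"
proof -
  have iff: "levi12 A H \<delta> (qmap H r) = qmap (T2 A H) (lie_bracket \<xi> (lie_bracket \<eta> r)) \<longleftrightarrow>
      \<delta> = nab r \<xi> \<eta>" if "\<delta> \<in> G" for \<delta>
  proof -
    have "lie_bracket \<xi> (lie_bracket \<eta> r) = lie_bracket \<xi> (0 - lie_bracket r \<eta>)"
      using bracket_anti[of \<eta> r] by simp
    also have "\<dots> = lie_bracket \<xi> 0 - lie_bracket \<xi> (lie_bracket r \<eta>)"
      by (rule bracket_diff_right) (simp_all add: assms)
    finally have "part1 (lie_bracket \<xi> (lie_bracket \<eta> r)) = - nab r \<xi> \<eta>"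
      by (simp add: nab_def assms)
    moreover have "part1 (lie_bracket \<delta> r) = - \<delta>"
      using that r by (simp add: fscale_one)
    moreover have "lie_bracket \<delta> r \<in> V" "lie_bracket \<xi> (lie_bracket \<eta> r) \<in> V"
      using that assms by simp_all
    ultimately show ?thesis
      unfolding levi12_qmap[OF r(1) that] by (simp only: qmap_T2_eq_iff neg_equal_iff_equal)
  qed
  show ?thesis
    unfolding pconn_def
  proof (rule the_equality)
    show "nab r \<xi> \<eta> \<in> G \<and>
      levi12 A H (nab r \<xi> \<eta>) (qmap H r) = qmap (T2 A H) (lie_bracket \<xi> (lie_bracket \<eta> r))"
      using iff[of "nab r \<xi> \<eta>"] assms by simp
  qed (use iff in blast)
qed

text \<open>Every section of \<open>T2\<close> modulo \<open>H\<close> is a function times the class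
  of \<open>r\<close>. In this trivialisation a connection with that class parallel differentiates
  the function, and compatibility with the Levi bracket becomes the product rule for
  \<open>levi\<close>.\<close>

lemma self_parallel_iff:
  assumes r: "r \<in> G2" "\<And>y. pairing \<alpha> r y = 1"
  shows "self_parallel A H r \<longleftrightarrow> reeb r"
proof
  assume "self_parallel A H r"
  then obtain D where D: "induced_gr2_connection A H (pconn A H r) D"
    and par: "\<And>\<gamma>. \<gamma> \<in> G \<Longrightarrow> D \<gamma> (qmap H r) = qmap H 0"
    unfolding self_parallel_def by blast
  have leib: "D \<gamma> (q_scale H h \<phi>) = q_add (q_scale H (\<lambda>x. \<gamma> x h) \<phi>) (q_scale H h (D \<gamma> \<phi>))"
    if "h \<in> F" "\<gamma> \<in> G" "\<phi> \<in> gr2_sections A H" for h \<gamma> \<phi>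
    using D[unfolded induced_gr2_connection_def, THEN conjunct2, THEN conjunct2, THEN conjunct2,
        THEN conjunct2, THEN conjunct1] that by blast
  have br: "D \<gamma> (levi11 H \<xi> \<eta>)
      = q_add (levi11 H (pconn A H r \<gamma> \<xi>) \<eta>) (levi11 H \<xi> (pconn A H r \<gamma> \<eta>))"
    if "\<gamma> \<in> G" "\<xi> \<in> G" "\<eta> \<in> G" for \<gamma> \<xi> \<eta>
    using D[unfolded induced_gr2_connection_def, THEN conjunct2, THEN conjunct2, THEN conjunct2,
        THEN conjunct2, THEN conjunct2] that by blast
  have "dir \<gamma> (levi \<xi> \<eta>) y = levi (nab r \<gamma> \<xi>) \<eta> y + levi \<xi> (nab r \<gamma> \<eta>) y"
    if G: "\<gamma> \<in> G" "\<xi> \<in> G" "\<eta> \<in> G" for \<gamma> \<xi> \<eta> y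
  proof -
    have "qmap H (lie_bracket \<xi> \<eta>) = qmap H (fscale (levi \<xi> \<eta>) r)"
      using G r by (subst qmap_H_eq_iff) (simp_all add: levi_def fun_eq_iff)
    then have l: "levi11 H \<xi> \<eta> = q_scale H (levi \<xi> \<eta>) (qmap H r)"
      by (simp add: levi11_def q_scale_qmap[OF subspace_H])
    have "qmap H r \<in> gr2_sections A H"
      using r by (simp add: gr2_sections_def)
    then have "D \<gamma> (levi11 H \<xi> \<eta>)
        = q_add (q_scale H (dir \<gamma> (levi \<xi> \<eta>)) (qmap H r)) (q_scale H (levi \<xi> \<eta>) (qmap H 0))"
      unfolding l using leib[of "levi \<xi> \<eta>" \<gamma> "qmap H r"] par G by (simp add: dir_def)
    also have "\<dots> = qmap H (fscale (dir \<gamma> (levi \<xi> \<eta>)) r)"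
      by (simp add: q_scale_qmap[OF subspace_H] q_add_qmap[OF subspace_H])
    finally have "qmap H (fscale (dir \<gamma> (levi \<xi> \<eta>)) r)
        = qmap H (lie_bracket (nab r \<gamma> \<xi>) \<eta> + lie_bracket \<xi> (nab r \<gamma> \<eta>))"
      unfolding br[OF G] using G r by (simp add: pconn_eq levi11_def q_add_qmap[OF subspace_H])
    then have "pairing \<alpha> (fscale (dir \<gamma> (levi \<xi> \<eta>)) r)
        = pairing \<alpha> (lie_bracket (nab r \<gamma> \<xi>) \<eta> + lie_bracket \<xi> (nab r \<gamma> \<eta>))"
      using G r by (subst (asm) qmap_H_eq_iff) simp_all
    from fun_cong[OF this, of y] show ?thesis
      using G r by (simp add: levi_def)
  qed
  then show "reeb r"
    using r unfolding reeb_def by blast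
next
  assume reeb: "reeb r"
  define lift where "lift \<phi> = (SOME \<zeta>. \<zeta> \<in> G2 \<and> qmap H \<zeta> = \<phi>)" for \<phi>
  \<comment> \<open>The flat connection in which the class of \<open>r\<close> is parallel; \<alpha>
    of any lift is the coefficient of the class.\<close>
  define D where "D \<gamma> \<phi> = qmap H (fscale (dir \<gamma> (pairing \<alpha> (lift \<phi>))) r)" for \<gamma> \<phi>
  have D: "D \<gamma> (qmap H \<rho>) = qmap H (fscale (dir \<gamma> (pairing \<alpha> \<rho>)) r)" if "\<rho> \<in> G2" for \<gamma> \<rho>
  proof -
    have "lift (qmap H \<rho>) \<in> G2 \<and> qmap H (lift (qmap H \<rho>)) = qmap H \<rho>"
      unfolding lift_def by (rule someI[of _ \<rho>]) (simp add: that)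
    then have "pairing \<alpha> (lift (qmap H \<rho>)) = pairing \<alpha> \<rho>"
      using qmap_H_eq_iff that by blast
    then show ?thesis by (simp add: D_def)
  qed
  note q = q_scale_qmap[OF subspace_H] q_add_qmap[OF subspace_H]
  have lin: "pairing \<alpha> (\<rho> + \<rho>') = (\<lambda>y. pairing \<alpha> \<rho> y + pairing \<alpha> \<rho>' y)"
      "pairing \<alpha> (fscale h \<rho>) = (\<lambda>y. h y * pairing \<alpha> \<rho> y)" if "\<rho> \<in> G2" "\<rho>' \<in> G2" for \<rho> \<rho>' h
    using that by (simp_all add: fun_eq_iff)
  have "induced_gr2_connection A H (pconn A H r) D"
    unfolding induced_gr2_connection_def gr2_sections_def ball_simps
  proof (intro conjI ballI)
    fix \<gamma> \<rho> assume "\<gamma> \<in> G" "\<rho> \<in> G2"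
    then show "D \<gamma> (qmap H \<rho>) \<in> qmap H ` G2"
      unfolding D[OF \<open>\<rho> \<in> G2\<close>] using r by (intro imageI) simp
  next
    fix \<gamma> \<gamma>' \<rho> assume "\<gamma> \<in> G" "\<gamma>' \<in> G" "\<rho> \<in> G2"
    then show "D (\<gamma> + \<gamma>') (qmap H \<rho>) = q_add (D \<gamma> (qmap H \<rho>)) (D \<gamma>' (qmap H \<rho>))"
      using r by (simp add: D q, subst qmap_H_eq_iff) (simp_all add: fun_eq_iff dir_field_fun)
  next
    fix h \<gamma> \<rho> assume "h \<in> F" "\<gamma> \<in> G" "\<rho> \<in> G2"
    then show "D (fscale h \<gamma>) (qmap H \<rho>) = q_scale H h (D \<gamma> (qmap H \<rho>))"
      using r by (simp add: D q, subst qmap_H_eq_iff) (simp_all add: fun_eq_iff dir_field_fun)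
  next
    fix \<gamma> \<rho> \<rho>' assume "\<gamma> \<in> G" "\<rho> \<in> G2" "\<rho>' \<in> G2"
    then show "D \<gamma> (q_add (qmap H \<rho>) (qmap H \<rho>')) = q_add (D \<gamma> (qmap H \<rho>)) (D \<gamma> (qmap H \<rho>'))"
      using r by (simp add: D q, subst qmap_H_eq_iff) (simp_all add: fun_eq_iff lin dir_fun_eq)
  next
    fix h \<gamma> \<rho> assume "h \<in> F" "\<gamma> \<in> G" "\<rho> \<in> G2"
    then show "D \<gamma> (q_scale H h (qmap H \<rho>))
        = q_add (q_scale H (\<lambda>x. \<gamma> x h) (qmap H \<rho>)) (q_scale H h (D \<gamma> (qmap H \<rho>)))"
      using r by (simp add: D q flip: dir_def, subst qmap_H_eq_iff) (simp_all add: fun_eq_iff lin dir_fun_eq)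
  next
    fix \<gamma> \<xi> \<eta> assume "\<gamma> \<in> G" "\<xi> \<in> G" "\<eta> \<in> G"
    moreover from this have "dir \<gamma> (levi \<xi> \<eta>) y = levi (nab r \<gamma> \<xi>) \<eta> y + levi \<xi> (nab r \<gamma> \<eta>) y" for y
      using reeb unfolding reeb_def by blast
    ultimately show "D \<gamma> (levi11 H \<xi> \<eta>)
        = q_add (levi11 H (pconn A H r \<gamma> \<xi>) \<eta>) (levi11 H \<xi> (pconn A H r \<gamma> \<eta>))"
      using r by (simp add: D q levi11_def pconn_eq, subst qmap_H_eq_iff)
        (simp_all add: fun_eq_iff flip: levi_def)
  qed
  moreover have "D \<gamma> (qmap H r) = qmap H 0" if "\<gamma> \<in> G" for \<gamma>
  proof -
    have "pairing \<alpha> r = (\<lambda>y. 1)" using r by (simp add: fun_eq_iff)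
    then have "dir \<gamma> (pairing \<alpha> r) = (\<lambda>y. 0)"
      by (intro ext) (simp add: that)
    then show ?thesis by (simp add: D r)
  qed
  ultimately show "self_parallel A H r"
    unfolding self_parallel_def by blast
qed

lemma reeb_field: "reeb (reeb_field A H \<alpha>)"
proof -
  obtain r where r: "reeb r"
    using reeb_exists by blast
  have one: "pairing \<alpha> r = 1 \<longleftrightarrow> (\<forall>y. pairing \<alpha> r y = 1)" for r
    by (simp add: fun_eq_iff)
  have "reeb_field A H \<alpha> = r"
    unfolding reeb_field_def one
  proof (rule the_equality)
    show "r \<in> G2 \<and> (\<forall>y. pairing \<alpha> r y = 1) \<and> self_parallel A H r"
      using r self_parallel_iff[of r] by (simp add: reeb_def)
  next
    fix r' assume r': "r' \<in> G2 \<and> (\<forall>y. pairing \<alpha> r' y = 1) \<and> self_parallel A H r'"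
    then have "reeb r'"
      using self_parallel_iff[of r'] by blast
    then show "r' = r"
      using r by (rule reeb_unique)
  qed
  with r show ?thesis by simp
qed

end

section \<open>Extension, decomposition and curvature for a fixed Reeb field\<close>

locale contact_reeb = contact +
  fixes r :: "'a vfield"
  assumes reeb: "reeb r"
begin

lemma r_G2 [simp]: "r \<in> G2" and alpha_r [simp]: "pairing \<alpha> r y = 1"
  using reeb unfolding reeb_def by blast+

lemma dir_levi:
  assumes "\<gamma> \<in> G" "\<xi> \<in> G" "\<eta> \<in> G"
  shows "dir \<gamma> (levi \<xi> \<eta>) y = levi (nab r \<gamma> \<xi>) \<eta> y + levi \<xi> (nab r \<gamma> \<eta>) y"
  using reeb assms unfolding reeb_def by blast

lemma fscale_alpha_r [simp]: "fscale (pairing \<alpha> r) X = X"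
  by (rule fscale_one) simp

lemma reeb_field_eq: "reeb_field A H \<alpha> = r"
  using reeb_unique reeb_field reeb by blast

text \<open>If \<theta> extends \<alpha>, its values on \<open>r\<close> and on \<xi> in
  \<open>H\<close> are constant, so the vanishing of its exterior derivative on \<open>r\<close> and
  \<xi> says that \<theta> is 0 on [r, \<xi>]. Hence \<theta>(\<zeta>) can only be \<alpha> of the
  remainder after the bracket part is subtracted.\<close>

definition ext :: "'a vfield \<Rightarrow> 'a \<Rightarrow> real"
  where "ext \<zeta> = pairing \<alpha> (\<zeta> - lie_bracket r (part1 \<zeta>))"

lemma residue_G2 [simp]: "\<zeta> \<in> V \<Longrightarrow> \<zeta> - lie_bracket r (part1 \<zeta>) \<in> G2"
  by (rule G2_if_part1_0) simp_all

lemma ext_F [simp]: "\<zeta> \<in> V \<Longrightarrow> ext \<zeta> \<in> F"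
  by (simp add: ext_def)

lemma ext_add: "\<zeta> \<in> V \<Longrightarrow> \<zeta>' \<in> V \<Longrightarrow> ext (\<zeta> + \<zeta>') y = ext \<zeta> y + ext \<zeta>' y"
proof -
  assume z: "\<zeta> \<in> V" "\<zeta>' \<in> V"
  have "\<zeta> + \<zeta>' - lie_bracket r (part1 (\<zeta> + \<zeta>'))
      = (\<zeta> - lie_bracket r (part1 \<zeta>)) + (\<zeta>' - lie_bracket r (part1 \<zeta>'))"
    using z by (simp add: bracket_add_right)
  then show ?thesis
    unfolding ext_def using z by (simp only: alpha_pairing residue_G2)
qed

text \<open>The bracket differentiates \<open>h\<close>, but the extra term is a multiple of
  \<open>part1 \<zeta>\<close>, a section of \<open>H\<close>, on which \<alpha> vanishes.\<close>

lemma ext_fscale: "\<zeta> \<in> V \<Longrightarrow> h \<in> F \<Longrightarrow> ext (fscale h \<zeta>) y = h y * ext \<zeta> y"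
proof -
  assume z: "\<zeta> \<in> V" "h \<in> F"
  have "fscale h \<zeta> - lie_bracket r (part1 (fscale h \<zeta>))
      = fscale h (\<zeta> - lie_bracket r (part1 \<zeta>)) - fscale (dir r h) (part1 \<zeta>)"
    using z by (simp add: bracket_fscale_right fscale_at fun_eq_iff[where 'a = 'a] scaleR_diff_right)
  then show ?thesis
    unfolding ext_def using z by simp
qed

lemma ext_local:
  assumes "\<zeta> \<in> V" "\<zeta>' \<in> V" "eventually (\<lambda>y. \<zeta> y = \<zeta>' y) (nhds x)"
  shows "ext \<zeta> x = ext \<zeta>' x"
proof -
  have "eventually (\<lambda>y. part1 \<zeta> y = part1 \<zeta>' y) (nhds x)"
    using assms(3) by eventually_elim (simp add: part1_def)
  then have "lie_bracket r (part1 \<zeta>) x = lie_bracket r (part1 \<zeta>') x"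
    using assms by (intro bracket_local) simp_all
  then show ?thesis
    using eventually_nhds_x_imp_x[OF assms(3)] by (simp add: ext_def pairing_def)
qed

text \<open>Function-linearity and locality in a frame make \<open>ext\<close> pointwise, so it
  comes from a covector at each point.\<close>

lemma ext_cong:
  assumes "\<zeta> \<in> V" "\<zeta>' \<in> V" "\<zeta> x = \<zeta>' x"
  shows "ext \<zeta> x = ext \<zeta>' x"
proof -
  obtain X Y a b c d e where f: "adapted_frame X Y a b c d e x"
    using adapted_frame_exists by blast
  note fr = adapted_frame_at[OF f]
  define Z where "Z = lie_bracket X Y"
  define U where "U = lie_bracket X Z"
  define W where "W = lie_bracket Y Z"
  have ext: "ext \<zeta> x = a x (\<zeta> x) * ext X x + b x (\<zeta> x) * ext Y x + c x (\<zeta> x) * ext Z x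
      + d x (\<zeta> x) * ext U x + e x (\<zeta> x) * ext W x" if \<zeta>: "\<zeta> \<in> V" for \<zeta>
  proof -
    let ?E = "fscale (pairing a \<zeta>) X + fscale (pairing b \<zeta>) Y + fscale (pairing c \<zeta>) Z
      + fscale (pairing d \<zeta>) U + fscale (pairing e \<zeta>) W"
    have Fs: "pairing a \<zeta> \<in> F" "pairing b \<zeta> \<in> F" "pairing c \<zeta> \<in> F" "pairing d \<zeta> \<in> F" "pairing e \<zeta> \<in> F"
      using fr(4-8) \<zeta> by simp_all
    have Vs: "X \<in> V" "Y \<in> V" "Z \<in> V" "U \<in> V" "W \<in> V"
      using fr(2,3) by (simp_all add: Z_def U_def W_def)
    have "eventually (\<lambda>y. \<zeta> y = ?E y) (nhds x)"
      using adapted_frame_near[OF f]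
    proof eventually_elim
      case (elim y)
      have "\<zeta> y = a y (\<zeta> y) *\<^sub>R X y + b y (\<zeta> y) *\<^sub>R Y y + c y (\<zeta> y) *\<^sub>R Z y
          + d y (\<zeta> y) *\<^sub>R U y + e y (\<zeta> y) *\<^sub>R W y"
        using adapted_frame_at(1)[OF elim] V_tangent[OF \<zeta>, of y]
        unfolding adapted_def Let_def Z_def U_def W_def by blast
      then show ?case by (simp add: fscale_def pairing_def)
    qed
    then have "ext \<zeta> x = ext ?E x"
      using \<zeta> Fs Vs by (intro ext_local) simp_all
    also have "\<dots> = a x (\<zeta> x) * ext X x + b x (\<zeta> x) * ext Y x + c x (\<zeta> x) * ext Z x
      + d x (\<zeta> x) * ext U x + e x (\<zeta> x) * ext W x"
      using Fs Vs by (simp add: ext_add ext_fscale) (simp add: pairing_def)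
    finally show ?thesis .
  qed
  show ?thesis
    unfolding ext[OF assms(1)] ext[OF assms(2)] assms(3) ..
qed

lemma ext_G2 [simp]:
  assumes "\<rho> \<in> G2"
  shows "ext \<rho> y = pairing \<alpha> \<rho> y"
proof -
  have "lie_bracket r 0 = 0"
    using bracket_diff_right[of 0 0 r] by simp
  then show ?thesis
    using assms by (simp add: ext_def)
qed

lemma ext_bracket_r [simp]:
  assumes "\<xi> \<in> G"
  shows "ext (lie_bracket r \<xi>) y = 0"
proof -
  have "lie_bracket r \<xi> - lie_bracket r (part1 (lie_bracket r \<xi>)) = 0"
    using assms by simp
  then show ?thesis
    by (simp only: ext_def) simp
qed

lemma tangent_extends:
  assumes "v \<in> tangent_space A x"
  obtains \<zeta> where "\<zeta> \<in> V" "\<zeta> x = v" "v \<in> T2 A H x \<Longrightarrow> \<zeta> \<in> G2"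
proof -
  obtain X Y a b c d e where f: "adapted_frame X Y a b c d e x"
    using adapted_frame_exists by blast
  note fr = adapted_frame_at[OF f]
  define Z where "Z = lie_bracket X Y"
  define U where "U = lie_bracket X Z"
  define W where "W = lie_bracket Y Z"
  have ad: "v \<in> T2 A H x \<longleftrightarrow> v = a x v *\<^sub>R X x + b x v *\<^sub>R Y x + c x v *\<^sub>R Z x"
    "v = a x v *\<^sub>R X x + b x v *\<^sub>R Y x + c x v *\<^sub>R Z x + d x v *\<^sub>R U x + e x v *\<^sub>R W x"
    using fr(1) assms unfolding adapted_def Let_def Z_def U_def W_def by blast+
  show thesis
  proof (cases "v \<in> T2 A H x")
    case True
    show ?thesis
    proof (rule that[of "fscale (\<lambda>_. a x v) X + fscale (\<lambda>_. b x v) Y + fscale (\<lambda>_. c x v) Z"])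
      show "fscale (\<lambda>_. a x v) X + fscale (\<lambda>_. b x v) Y + fscale (\<lambda>_. c x v) Z \<in> G2"
        using fr(2,3) by (simp add: Z_def)
      then show "fscale (\<lambda>_. a x v) X + fscale (\<lambda>_. b x v) Y + fscale (\<lambda>_. c x v) Z \<in> V"
        by (rule G2_V)
      show "(fscale (\<lambda>_. a x v) X + fscale (\<lambda>_. b x v) Y + fscale (\<lambda>_. c x v) Z) x = v"
        using True ad(1) by (simp add: fscale_def)
    qed
  next
    case False
    show ?thesis
    proof (rule that[of "fscale (\<lambda>_. a x v) X + fscale (\<lambda>_. b x v) Y + fscale (\<lambda>_. c x v) Z
        + fscale (\<lambda>_. d x v) U + fscale (\<lambda>_. e x v) W"])
      show "fscale (\<lambda>_. a x v) X + fscale (\<lambda>_. b x v) Y + fscale (\<lambda>_. c x v) Z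
        + fscale (\<lambda>_. d x v) U + fscale (\<lambda>_. e x v) W \<in> V"
        using fr(2,3) by (simp add: Z_def U_def W_def)
      show "(fscale (\<lambda>_. a x v) X + fscale (\<lambda>_. b x v) Y + fscale (\<lambda>_. c x v) Z
        + fscale (\<lambda>_. d x v) U + fscale (\<lambda>_. e x v) W) x = v"
        using ad(2) by (simp add: fscale_def)
    qed (use False in blast)
  qed
qed

lemma sections_tangent: "sections A (tangent_space A) = V"
  unfolding sections_def using V_tangent by blast

lemma dir_alpha_r [simp]: "X \<in> V \<Longrightarrow> dir X (pairing \<alpha> r) y = 0"
proof -
  have "pairing \<alpha> r = (\<lambda>y. 1)" by (rule HOL.ext) simp
  then show "X \<in> V \<Longrightarrow> dir X (pairing \<alpha> r) y = 0" by (simp only: dir_const)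
qed

lemma canonical_extension_pairing:
  assumes "\<zeta> \<in> V"
  shows "pairing (canonical_extension A H \<alpha>) \<zeta> = ext \<zeta>"
proof -
  \<comment> \<open>By \<open>ext_cong\<close> the chosen extension of \<open>v\<close> does not
    matter; the value 0 elsewhere is the normalisation in
    \<open>canonical_extension\<close>.\<close>
  define \<theta> where "\<theta> y v = (if v \<in> tangent_space A y then ext (SOME \<zeta>. \<zeta> \<in> V \<and> \<zeta> y = v) y else 0)" for y v
  have \<theta>: "\<theta> y (\<zeta> y) = ext \<zeta> y" if \<zeta>: "\<zeta> \<in> V" for \<zeta> y
  proof -
    let ?\<zeta> = "SOME \<zeta>'. \<zeta>' \<in> V \<and> \<zeta>' y = \<zeta> y"
    have "?\<zeta> \<in> V \<and> ?\<zeta> y = \<zeta> y"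
      by (rule someI[of _ \<zeta>]) (simp add: \<zeta>)
    then have "ext ?\<zeta> y = ext \<zeta> y"
      using ext_cong \<zeta> by blast
    then show ?thesis
      using V_tangent[OF \<zeta>] by (simp add: \<theta>_def)
  qed
  have p\<theta>: "pairing \<theta> \<zeta> = ext \<zeta>" if "\<zeta> \<in> V" for \<zeta>
    using \<theta>[OF that] by (simp add: pairing_def)
  have "canonical_extension A H \<alpha> = \<theta>"
    unfolding canonical_extension_def reeb_field_eq
  proof (rule the_equality)
    show "\<theta> \<in> dual_sections A (tangent_space A) \<and> (\<forall>x v. v \<notin> tangent_space A x \<longrightarrow> \<theta> x v = 0) \<and>
      (\<forall>x. \<forall>v\<in>T2 A H x. \<theta> x v = \<alpha> x v) \<and> (\<forall>\<xi>\<in>G. ext_deriv \<theta> r \<xi> = 0)"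
    proof (intro conjI allI ballI impI)
      show "\<theta> \<in> dual_sections A (tangent_space A)"
        unfolding dual_sections_def sections_tangent mem_Collect_eq
      proof (intro conjI allI ballI)
        fix x v w assume "v \<in> tangent_space A x" "w \<in> tangent_space A x"
        then obtain \<zeta> \<zeta>' where "\<zeta> \<in> V" "\<zeta> x = v" "\<zeta>' \<in> V" "\<zeta>' x = w"
          using tangent_extends by metis
        then show "\<theta> x (v + w) = \<theta> x v + \<theta> x w"
          using \<theta>[of "\<zeta> + \<zeta>'" x] \<theta>[of \<zeta> x] \<theta>[of \<zeta>' x] ext_add[of \<zeta> \<zeta>' x] by simp
      next
        fix x k v assume "v \<in> tangent_space A x"
        then obtain \<zeta> where "\<zeta> \<in> V" "\<zeta> x = v"
          using tangent_extends by metis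
        then show "\<theta> x (k *\<^sub>R v) = k * \<theta> x v"
          using \<theta>[of "fscale (\<lambda>_. k) \<zeta>" x] \<theta>[of \<zeta> x] ext_fscale[of \<zeta> "\<lambda>_. k" x]
          by (simp add: fscale_at)
      next
        fix \<zeta> assume "\<zeta> \<in> V"
        then show "(\<lambda>x. \<theta> x (\<zeta> x)) \<in> F"
          by (simp add: \<theta>)
      qed
    next
      fix x v assume "v \<notin> tangent_space A x"
      then show "\<theta> x v = 0" by (simp add: \<theta>_def)
    next
      fix x v assume v: "v \<in> T2 A H x"
      have T2_tangent: "T2 A H x \<subseteq> tangent_space A x"
        unfolding T2_def by (rule span_minimal[OF _ subspace_tangent_space]) (auto simp: V_tangent)
      then obtain \<zeta> where "\<zeta> \<in> G2" "\<zeta> x = v"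
        using tangent_extends v by (metis subsetD)
      then show "\<theta> x v = \<alpha> x v"
        using \<theta>[of \<zeta> x] by (simp add: pairing_def)
    next
      fix \<xi> assume \<xi>: "\<xi> \<in> G"
      have z: "pairing \<theta> \<xi> = (\<lambda>y. 0)" "pairing \<theta> r = pairing \<alpha> r"
        using \<xi> by (simp_all add: p\<theta> fun_eq_iff)
      show "ext_deriv \<theta> r \<xi> = 0"
        unfolding ext_deriv_def z using \<xi> dir_const[of r 0] dir_alpha_r[of \<xi>]
        by (simp add: p\<theta> fun_eq_iff dir_def)
    qed
  next
    fix \<theta>'
    assume "\<theta>' \<in> dual_sections A (tangent_space A) \<and> (\<forall>x v. v \<notin> tangent_space A x \<longrightarrow> \<theta>' x v = 0) \<and>
      (\<forall>x. \<forall>v\<in>T2 A H x. \<theta>' x v = \<alpha> x v) \<and> (\<forall>\<xi>\<in>G. ext_deriv \<theta>' r \<xi> = 0)"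
    then have ds: "\<theta>' \<in> dual_sections A (tangent_space A)"
      and off: "\<And>x v. v \<notin> tangent_space A x \<Longrightarrow> \<theta>' x v = 0"
      and onT2: "\<And>x v. v \<in> T2 A H x \<Longrightarrow> \<theta>' x v = \<alpha> x v"
      and ed: "\<And>\<xi>. \<xi> \<in> G \<Longrightarrow> ext_deriv \<theta>' r \<xi> = 0"
      by blast+
    have add: "\<theta>' x (v + w) = \<theta>' x v + \<theta>' x w"
      if "v \<in> tangent_space A x" "w \<in> tangent_space A x" for x v w
      using ds that unfolding dual_sections_def by blast
    have pG2: "pairing \<theta>' \<rho> = pairing \<alpha> \<rho>" if "\<rho> \<in> G2" for \<rho>
      using onT2 G2_T2[OF that] by (simp add: pairing_def)
    have "\<theta>' x v = \<theta> x v" for x v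
    proof (cases "v \<in> tangent_space A x")
      case True
      then obtain \<zeta> where \<zeta>: "\<zeta> \<in> V" "\<zeta> x = v"
        using tangent_extends by metis
      let ?t = "part1 \<zeta>"
      have t: "?t \<in> G" using \<zeta> by simp
      have "pairing \<alpha> ?t = (\<lambda>y. 0)" using t by (simp add: fun_eq_iff)
      then have "pairing \<theta>' (lie_bracket r ?t) x = 0"
        using fun_cong[OF ed[OF t], of x] t dir_const[of r 0 x] dir_alpha_r[of ?t x]
        by (simp add: ext_deriv_def pG2 dir_def)
      then have "\<theta>' x (lie_bracket r ?t x) = 0"
        by (simp add: pairing_def)
      moreover have "\<theta>' x v = \<theta>' x ((\<zeta> - lie_bracket r ?t) x + lie_bracket r ?t x)"
        using \<zeta>(2) by simp
      moreover have "\<dots> = \<theta>' x ((\<zeta> - lie_bracket r ?t) x) + \<theta>' x (lie_bracket r ?t x)"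
        by (rule add[OF V_tangent[OF G2_V[OF residue_G2[OF \<zeta>(1)]]]
              V_tangent[OF V_bracket[OF G2_V[OF r_G2] G_V[OF t]]]])
      moreover have "\<theta>' x ((\<zeta> - lie_bracket r ?t) x) = ext \<zeta> x"
        using onT2[OF G2_T2[OF residue_G2[OF \<zeta>(1)]], of x] by (simp add: ext_def pairing_def)
      ultimately show ?thesis
        using \<theta>[OF \<zeta>(1), of x] \<zeta>(2) by simp
    qed (simp add: off \<theta>_def)
    then show "\<theta>' = \<theta>" by (intro HOL.ext)
  qed
  then show ?thesis
    using p\<theta> assms by simp
qed

definition part2 :: "'a vfield \<Rightarrow> 'a vfield"
  where "part2 \<zeta> = \<zeta> - lie_bracket r (part1 \<zeta>) - fscale (ext \<zeta>) r"

lemma part2_G [simp]: "\<zeta> \<in> V \<Longrightarrow> part2 \<zeta> \<in> G"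
  unfolding part2_def by (rule G_if_alpha_0) (simp_all add: ext_def)

text \<open>\<open>part1\<close> sends \<open>lie_bracket r \<xi>\<close> to \<xi> and kills
  \<open>r\<close> and \<open>H\<close>, so it recovers the first component of any decomposition;
  the second is then a difference.\<close>

lemma decomposition_eq:
  assumes "\<zeta> \<in> V"
  shows "decomposition A H \<alpha> \<zeta> = (part1 \<zeta>, part2 \<zeta>)"
  unfolding decomposition_def reeb_field_eq canonical_extension_pairing[OF assms]
proof (rule the_equality)
  show "fst (part1 \<zeta>, part2 \<zeta>) \<in> G \<and> snd (part1 \<zeta>, part2 \<zeta>) \<in> G \<and>
      \<zeta> = lie_bracket r (fst (part1 \<zeta>, part2 \<zeta>)) + fscale (ext \<zeta>) r + snd (part1 \<zeta>, part2 \<zeta>)"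
    using assms by (simp only: fst_conv snd_conv part1_G part2_G) (simp add: part2_def)
next
  fix p
  assume p: "fst p \<in> G \<and> snd p \<in> G \<and> \<zeta> = lie_bracket r (fst p) + fscale (ext \<zeta>) r + snd p"
  then have m: "fst p \<in> G" "snd p \<in> G" and e: "\<zeta> = lie_bracket r (fst p) + fscale (ext \<zeta>) r + snd p"
    by blast+
  have "part1 \<zeta> = part1 (lie_bracket r (fst p) + fscale (ext \<zeta>) r + snd p)"
    by (rule arg_cong[OF e])
  also have "\<dots> = fst p"
    using m by simp
  finally have "part1 \<zeta> = fst p" .
  moreover have "part2 \<zeta> = snd p"
    unfolding part2_def \<open>part1 \<zeta> = fst p\<close> by (subst (1) e) simp
  ultimately show "p = (part1 \<zeta>, part2 \<zeta>)"
    by (simp add: prod_eq_iff)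
qed

text \<open>Two signs cancel: \<open>part1 [\<delta>, r]\<close> is - \<delta>, and [\<gamma>, r] is
  - [r, \<gamma>].\<close>

lemma Psi_eq:
  assumes "\<gamma> \<in> G"
  shows "Psi A H \<alpha> \<gamma> = fscale (\<lambda>_. 1/2) (part1 (lie_bracket r (lie_bracket r \<gamma>)))"
proof -
  let ?P = "fscale (\<lambda>_. 1/2) (part1 (lie_bracket r (lie_bracket r \<gamma>)))"
  have V: "lie_bracket r (lie_bracket r \<gamma>) \<in> V" "lie_bracket r (lie_bracket \<gamma> r) \<in> V"
    using assms by simp_all
  have "lie_bracket r (lie_bracket \<gamma> r) = lie_bracket r (0 - lie_bracket r \<gamma>)"
    using bracket_anti[of \<gamma> r] by simp
  also have "\<dots> = lie_bracket r 0 - lie_bracket r (lie_bracket r \<gamma>)"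
    using assms by (intro bracket_diff_right) simp_all
  finally have p: "part1 (lie_bracket r (lie_bracket \<gamma> r)) = - part1 (lie_bracket r (lie_bracket r \<gamma>))"
    by simp
  have iff: "levi12 A H \<delta> (qmap H r)
      = q_scale (T2 A H) (\<lambda>_. 1/2) (qmap (T2 A H) (lie_bracket r (lie_bracket \<gamma> r))) \<longleftrightarrow> \<delta> = ?P"
    if "\<delta> \<in> G" for \<delta>
  proof -
    have "fscale (\<lambda>_. 1/2) (- X) = - fscale (\<lambda>_. 1/2) X" for X :: "'a vfield"
      by (simp add: fscale_at fun_eq_iff[where 'a = 'a])
    then have "part1 (fscale (\<lambda>_. 1/2) (lie_bracket r (lie_bracket \<gamma> r))) = - ?P"
      by (simp only: part1_fscale p)
    moreover have "part1 (lie_bracket \<delta> r) = - \<delta>"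
      using that by simp
    moreover have "lie_bracket \<delta> r \<in> V" "fscale (\<lambda>_. 1/2) (lie_bracket r (lie_bracket \<gamma> r)) \<in> V"
      using that V by simp_all
    ultimately show ?thesis
      unfolding levi12_qmap[OF r_G2 that] q_scale_qmap[OF subspace_T2]
      by (simp only: qmap_T2_eq_iff neg_equal_iff_equal)
  qed
  show ?thesis
    unfolding Psi_def reeb_field_eq Let_def
  proof (rule the_equality)
    show "?P \<in> G \<and> levi12 A H ?P (qmap H r)
      = q_scale (T2 A H) (\<lambda>_. 1/2) (qmap (T2 A H) (lie_bracket r (lie_bracket \<gamma> r)))"
      using iff[of ?P] V(1) by (simp only: G_fscale part1_G F_const simp_thms)
  qed (use iff in blast)
qed

definition curv :: "'a vfield \<Rightarrow> 'a vfield \<Rightarrow> 'a vfield \<Rightarrow> 'a vfield" where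
  "curv \<xi> \<eta> \<gamma> = nab r \<xi> (nab r \<eta> \<gamma>) - nab r \<eta> (nab r \<xi> \<gamma>)
     - nab r (lie_bracket \<xi> \<eta> - fscale (levi \<xi> \<eta>) r) \<gamma>"

lemma bracket_G [simp]: "\<xi> \<in> G \<Longrightarrow> \<eta> \<in> G \<Longrightarrow> lie_bracket \<xi> \<eta> - fscale (levi \<xi> \<eta>) r \<in> G"
  by (rule G_if_alpha_0) (simp_all flip: levi_def)

lemma curv_G [simp]: "\<xi> \<in> G \<Longrightarrow> \<eta> \<in> G \<Longrightarrow> \<gamma> \<in> G \<Longrightarrow> curv \<xi> \<eta> \<gamma> \<in> G"
  by (simp add: curv_def)

text \<open>As for an ordinary curvature, derivatives of the coefficients of \<xi> and \<eta> cancel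
  against those produced by the bracket. The scalar lemma is applied for each test function
  \<open>f\<close>; \<gamma> stays fixed, because the dependence on it is not
  function-linear.\<close>

lemma curv_alternating:
  assumes XY: "X \<in> G" "Y \<in> G" "levi X Y y = 1" and G: "\<xi> \<in> G" "\<eta> \<in> G" "\<gamma> \<in> G"
  shows "curv \<xi> \<eta> \<gamma> y = levi \<xi> \<eta> y *\<^sub>R curv X Y \<gamma> y"
proof
  fix f
  have "curv \<xi> \<eta> \<gamma> y f = levi \<xi> \<eta> y * curv X Y \<gamma> y f"
  proof (rule alternating_form[OF XY])
    fix \<xi> \<xi>' \<eta> assume "\<xi> \<in> G" "\<xi>' \<in> G" "\<eta> \<in> G"
    note G' = this G(3)
    have "lie_bracket (\<xi> + \<xi>') \<eta> - fscale (levi (\<xi> + \<xi>') \<eta>) r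
        = (lie_bracket \<xi> \<eta> - fscale (levi \<xi> \<eta>) r) + (lie_bracket \<xi>' \<eta> - fscale (levi \<xi>' \<eta>) r)"
      using G' by (simp add: bracket_add_left fun_eq_iff[where 'a = 'a] fscale_at scaleR_add_left)
    then have "curv (\<xi> + \<xi>') \<eta> \<gamma> = curv \<xi> \<eta> \<gamma> + curv \<xi>' \<eta> \<gamma>"
      unfolding curv_def using G' by (simp add: nab_add_left nab_add_right)
    then show "curv (\<xi> + \<xi>') \<eta> \<gamma> y f = curv \<xi> \<eta> \<gamma> y f + curv \<xi>' \<eta> \<gamma> y f"
      by simp
  next
    fix g \<xi> \<eta> assume "g \<in> F" "\<xi> \<in> G" "\<eta> \<in> G"
    note G' = this G(3)
    have "lie_bracket (fscale g \<xi>) \<eta> - fscale (levi (fscale g \<xi>) \<eta>) r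
        = fscale g (lie_bracket \<xi> \<eta> - fscale (levi \<xi> \<eta>) r) - fscale (dir \<eta> g) \<xi>"
      using G' by (simp add: bracket_fscale_left fun_eq_iff[where 'a = 'a] fscale_at scaleR_diff_right)
    then have c: "curv (fscale g \<xi>) \<eta> \<gamma> = fscale g (nab r \<xi> (nab r \<eta> \<gamma>))
        - (fscale g (nab r \<eta> (nab r \<xi> \<gamma>)) + fscale (\<lambda>x. pairing \<alpha> r x * dir \<eta> g x) (nab r \<xi> \<gamma>))
        - (fscale g (nab r (lie_bracket \<xi> \<eta> - fscale (levi \<xi> \<eta>) r) \<gamma>) - fscale (dir \<eta> g) (nab r \<xi> \<gamma>))"
      unfolding curv_def using G' by (simp only: nab_fscale_left nab_fscale_right nab_diff_left
          bracket_G G_fscale nab_G r_G2 dir_F G_V)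
    show "curv (fscale g \<xi>) \<eta> \<gamma> y f = g y * curv \<xi> \<eta> \<gamma> y f"
      unfolding c by (simp add: curv_def fscale_eval algebra_simps)
  next
    fix \<xi> \<eta> assume "\<xi> \<in> G" "\<eta> \<in> G"
    note G' = this G(3)
    have l: "fscale (levi \<xi> \<eta>) r = - fscale (levi \<eta> \<xi>) r"
      using levi_anti[OF G'(1,2)] by (simp add: fun_eq_iff[where 'a = 'a] fscale_at)
    have "lie_bracket \<xi> \<eta> - fscale (levi \<xi> \<eta>) r = 0 - (lie_bracket \<eta> \<xi> - fscale (levi \<eta> \<xi>) r)"
      unfolding l by (subst bracket_anti) simp
    then have "nab r (lie_bracket \<xi> \<eta> - fscale (levi \<xi> \<eta>) r) \<gamma>
        = nab r 0 \<gamma> - nab r (lie_bracket \<eta> \<xi> - fscale (levi \<eta> \<xi>) r) \<gamma>"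
      using G' by (simp only: nab_diff_left bracket_G G_0 r_G2)
    moreover have "nab r 0 \<gamma> = 0"
      using nab_diff_left[of r 0 \<gamma> 0] G' by simp
    ultimately show "curv \<xi> \<eta> \<gamma> y f = - curv \<eta> \<xi> \<gamma> y f"
      unfolding curv_def by simp
  qed (fact G)+
  then show "curv \<xi> \<eta> \<gamma> y f = (levi \<xi> \<eta> y *\<^sub>R curv X Y \<gamma> y) f"
    by (simp add: scaleR_fun_def)
qed

text \<open>Dividing by \<open>levi\<close> is done near a point with a unit pair;
  \<open>curv_alternating\<close> makes the quotient independent of the pair, and the local fields
  are glued.\<close>

lemma curv_levi_exists:
  assumes \<gamma>: "\<gamma> \<in> G"
  shows "\<exists>\<delta>\<in>G. \<forall>\<xi>\<in>G. \<forall>\<eta>\<in>G. curv \<xi> \<eta> \<gamma> = fscale (levi \<xi> \<eta>) \<delta>"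
proof -
  define \<delta> where "\<delta> y = (let p = SOME p. fst p \<in> G \<and> snd p \<in> G \<and> levi (fst p) (snd p) y = 1
    in curv (fst p) (snd p) \<gamma> y)" for y
  have \<delta>: "\<delta> y = curv X Y \<gamma> y" if XY: "X \<in> G" "Y \<in> G" "levi X Y y = 1" for X Y y
  proof -
    let ?p = "SOME p. fst p \<in> G \<and> snd p \<in> G \<and> levi (fst p) (snd p) y = 1"
    have "fst ?p \<in> G \<and> snd ?p \<in> G \<and> levi (fst ?p) (snd ?p) y = 1"
      by (rule someI[of _ "(X, Y)"]) (simp add: XY)
    then have "curv (fst ?p) (snd ?p) \<gamma> y = curv X Y \<gamma> y"
      using curv_alternating[OF XY _ _ \<gamma>, of "fst ?p" "snd ?p"] by simp
    then show ?thesis by (simp add: \<delta>_def Let_def)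
  qed
  have loc: "\<exists>X Y. X \<in> G \<and> Y \<in> G \<and> levi X Y x = 1 \<and> eventually (\<lambda>y. \<delta> y = curv X Y \<gamma> y) (nhds x)" for x
  proof -
    obtain X Y where XY: "X \<in> G" "Y \<in> G" "eventually (\<lambda>y. levi X Y y = 1) (nhds x)"
      using levi_unit_pair by blast
    have "eventually (\<lambda>y. \<delta> y = curv X Y \<gamma> y) (nhds x)"
      using XY(3) by eventually_elim (rule \<delta>[OF XY(1,2)])
    then show ?thesis
      using XY eventually_nhds_x_imp_x[OF XY(3)] by blast
  qed
  have "\<delta> \<in> G"
  proof (rule G_I)
    show "\<delta> \<in> V"
    proof (rule V_glue)
      fix x
      obtain X Y where "X \<in> G" "Y \<in> G" "eventually (\<lambda>y. \<delta> y = curv X Y \<gamma> y) (nhds x)"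
        using loc by blast
      then show "\<exists>Y\<in>V. eventually (\<lambda>y. \<delta> y = Y y) (nhds x)"
        using curv_G[OF _ _ \<gamma>] G_V by blast
    qed
    fix x
    obtain X Y where XY: "X \<in> G" "Y \<in> G" "levi X Y x = 1"
      using loc by blast
    show "\<delta> x \<in> H x"
      unfolding \<delta>[OF XY] using XY \<gamma> by (intro G_H) simp
  qed
  moreover have "curv \<xi> \<eta> \<gamma> = fscale (levi \<xi> \<eta>) \<delta>" if "\<xi> \<in> G" "\<eta> \<in> G" for \<xi> \<eta>
  proof
    fix x
    obtain X Y where XY: "X \<in> G" "Y \<in> G" "levi X Y x = 1"
      using loc by blast
    show "curv \<xi> \<eta> \<gamma> x = fscale (levi \<xi> \<eta>) \<delta> x"
      using curv_alternating[OF XY that \<gamma>] \<delta>[OF XY] by (simp add: fscale_def)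
  qed
  ultimately show ?thesis by blast
qed

lemma levi_multiple_unique:
  assumes "\<And>\<xi> \<eta>. \<xi> \<in> G \<Longrightarrow> \<eta> \<in> G \<Longrightarrow> fscale (levi \<xi> \<eta>) \<delta> = fscale (levi \<xi> \<eta>) \<delta>'"
  shows "\<delta> = \<delta>'"
proof
  fix x
  obtain X Y where XY: "X \<in> G" "Y \<in> G" "eventually (\<lambda>y. levi X Y y = 1) (nhds x)"
    using levi_unit_pair by blast
  show "\<delta> x = \<delta>' x"
    using fun_cong[OF assms[OF XY(1,2)], of x] eventually_nhds_x_imp_x[OF XY(3)]
    by (simp add: fscale_def)
qed

lemma Phi:
  assumes \<gamma>: "\<gamma> \<in> G"
  shows Phi_G [simp]: "Phi A H \<alpha> \<gamma> \<in> G"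
    and curv_Phi: "\<xi> \<in> G \<Longrightarrow> \<eta> \<in> G \<Longrightarrow> curv \<xi> \<eta> \<gamma> = fscale (levi \<xi> \<eta>) (Phi A H \<alpha> \<gamma>)"
proof -
  have c: "pconn A H r \<xi> (pconn A H r \<eta> \<gamma>) - pconn A H r \<eta> (pconn A H r \<xi> \<gamma>)
      - pconn A H r (lie_bracket \<xi> \<eta> - fscale (pairing \<alpha> (lie_bracket \<xi> \<eta>)) r) \<gamma> = curv \<xi> \<eta> \<gamma>"
    if "\<xi> \<in> G" "\<eta> \<in> G" for \<xi> \<eta>
    unfolding curv_def levi_def[symmetric] using that \<gamma> by (simp add: pconn_eq)
  obtain \<delta> where \<delta>: "\<delta> \<in> G" "\<forall>\<xi>\<in>G. \<forall>\<eta>\<in>G. curv \<xi> \<eta> \<gamma> = fscale (levi \<xi> \<eta>) \<delta>"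
    using curv_levi_exists[OF \<gamma>] by blast
  have "Phi A H \<alpha> \<gamma> = \<delta>"
    unfolding Phi_def reeb_field_eq Let_def
  proof (rule the_equality)
    show "\<delta> \<in> G \<and> (\<forall>\<xi>\<in>G. \<forall>\<eta>\<in>G. pconn A H r \<xi> (pconn A H r \<eta> \<gamma>) - pconn A H r \<eta> (pconn A H r \<xi> \<gamma>)
      - pconn A H r (lie_bracket \<xi> \<eta> - fscale (pairing \<alpha> (lie_bracket \<xi> \<eta>)) r) \<gamma>
      = fscale (pairing \<alpha> (lie_bracket \<xi> \<eta>)) \<delta>)"
      using \<delta> c by (simp add: levi_def)
  next
    fix \<delta>'
    assume "\<delta>' \<in> G \<and> (\<forall>\<xi>\<in>G. \<forall>\<eta>\<in>G. pconn A H r \<xi> (pconn A H r \<eta> \<gamma>) - pconn A H r \<eta> (pconn A H r \<xi> \<gamma>)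
      - pconn A H r (lie_bracket \<xi> \<eta> - fscale (pairing \<alpha> (lie_bracket \<xi> \<eta>)) r) \<gamma>
      = fscale (pairing \<alpha> (lie_bracket \<xi> \<eta>)) \<delta>')"
    then have "fscale (levi \<xi> \<eta>) \<delta>' = fscale (levi \<xi> \<eta>) \<delta>" if "\<xi> \<in> G" "\<eta> \<in> G" for \<xi> \<eta>
      using c[OF that] \<delta>(2) that by (simp add: levi_def)
    then show "\<delta>' = \<delta>" by (rule levi_multiple_unique)
  qed
  with \<delta> show "Phi A H \<alpha> \<gamma> \<in> G"
    "\<xi> \<in> G \<Longrightarrow> \<eta> \<in> G \<Longrightarrow> curv \<xi> \<eta> \<gamma> = fscale (levi \<xi> \<eta>) (Phi A H \<alpha> \<gamma>)"
    by simp_all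
qed

section \<open>Change of the generalized contact form\<close>

text \<open>The bracket of \<open>r\<close> with a multiple of \<open>r\<close> is again a multiple
  of \<open>r\<close>, so only the \<open>H\<close>-part of [\<xi>, \<eta>] contributes, and on
  \<open>H\<close> the map \<open>part1 [r, _]\<close> is the identity.\<close>

lemma part1_r_bracket:
  assumes "\<xi> \<in> G" "\<eta> \<in> G"
  shows "part1 (lie_bracket r (lie_bracket \<xi> \<eta>)) = lie_bracket \<xi> \<eta> - fscale (levi \<xi> \<eta>) r"
proof -
  let ?\<omega> = "lie_bracket \<xi> \<eta> - fscale (levi \<xi> \<eta>) r"
  have "lie_bracket r (lie_bracket \<xi> \<eta>) = lie_bracket r (?\<omega> + fscale (levi \<xi> \<eta>) r)"
    by simp
  also have "\<dots> = lie_bracket r ?\<omega> + (fscale (levi \<xi> \<eta>) (lie_bracket r r) + fscale (dir r (levi \<xi> \<eta>)) r)"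
    using assms by (subst bracket_add_right) (simp_all add: bracket_fscale_right)
  finally show ?thesis
    using assms by simp
qed

text \<open>\<open>part1\<close> of the Jacobi identity for \<open>r\<close>, \<xi>, \<eta>: the
  partial connection has no torsion once the \<open>r\<close>-part of the bracket is
  removed.\<close>

lemma torsion:
  assumes "\<xi> \<in> G" "\<eta> \<in> G"
  shows "nab r \<xi> \<eta> - nab r \<eta> \<xi> = lie_bracket \<xi> \<eta> - fscale (levi \<xi> \<eta>) r"
proof -
  have "lie_bracket r (lie_bracket \<xi> \<eta>) = - lie_bracket \<eta> (lie_bracket r \<xi>) + lie_bracket \<xi> (lie_bracket r \<eta>)"
    using bracket_jacobi[of r \<xi> \<eta>] bracket_anti[of "lie_bracket r \<xi>" \<eta>] assms by simp
  then have "part1 (lie_bracket r (lie_bracket \<xi> \<eta>)) = - nab r \<eta> \<xi> + nab r \<xi> \<eta>"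
    by (simp add: nab_def)
  then show ?thesis
    using part1_r_bracket[OF assms] by simp
qed

text \<open>For an ordinary curvature the second derivatives of \<open>g\<close> cancel against the
  derivative along [\<xi>, \<eta>]. Here the \<open>r\<close>-part of that bracket has been removed,
  so the derivative of \<open>g\<close> along \<open>r\<close> is left over.\<close>

lemma Phi_fscale:
  assumes \<gamma>: "\<gamma> \<in> G" and g: "g \<in> F"
  shows "Phi A H \<alpha> (fscale g \<gamma>) = fscale g (Phi A H \<alpha> \<gamma>) + fscale (dir r g) \<gamma>"
proof (rule levi_multiple_unique)
  fix \<xi> \<eta> assume G: "\<xi> \<in> G" "\<eta> \<in> G"
  let ?\<omega> = "lie_bracket \<xi> \<eta> - fscale (levi \<xi> \<eta>) r"
  have \<omega>: "?\<omega> \<in> G" using G by simp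
  have n: "nab r \<xi> (fscale g \<eta>) = fscale g (nab r \<xi> \<eta>) + fscale (dir \<xi> g) \<eta>" if "\<xi> \<in> G" "\<eta> \<in> G" "g \<in> F" for \<xi> \<eta> g
    using nab_fscale_right[OF r_G2 that(1,2,3)] by simp
  have c: "curv \<xi> \<eta> (fscale g \<gamma>)
      = (fscale g (nab r \<xi> (nab r \<eta> \<gamma>)) + fscale (dir \<xi> g) (nab r \<eta> \<gamma>)
          + (fscale (dir \<eta> g) (nab r \<xi> \<gamma>) + fscale (dir \<xi> (dir \<eta> g)) \<gamma>))
        - (fscale g (nab r \<eta> (nab r \<xi> \<gamma>)) + fscale (dir \<eta> g) (nab r \<xi> \<gamma>)
          + (fscale (dir \<xi> g) (nab r \<eta> \<gamma>) + fscale (dir \<eta> (dir \<xi> g)) \<gamma>))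
        - (fscale g (nab r ?\<omega> \<gamma>) + fscale (dir ?\<omega> g) \<gamma>)"
    unfolding curv_def using G \<gamma> g \<omega>
    by (simp only: n nab_add_right G_fscale nab_G r_G2 dir_F G_V)
  show "fscale (levi \<xi> \<eta>) (Phi A H \<alpha> (fscale g \<gamma>))
      = fscale (levi \<xi> \<eta>) (fscale g (Phi A H \<alpha> \<gamma>) + fscale (dir r g) \<gamma>)"
  proof (intro HOL.ext)
    fix x f
    have "curv \<xi> \<eta> (fscale g \<gamma>) x f = g x * curv \<xi> \<eta> \<gamma> x f + levi \<xi> \<eta> x * dir r g x * \<gamma> x f"
      unfolding c by (simp add: curv_def fscale_eval algebra_simps)
    then show "fscale (levi \<xi> \<eta>) (Phi A H \<alpha> (fscale g \<gamma>)) x f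
        = fscale (levi \<xi> \<eta>) (fscale g (Phi A H \<alpha> \<gamma>) + fscale (dir r g) \<gamma>) x f"
      using curv_Phi[OF \<gamma> G] curv_Phi[of "fscale g \<gamma>", OF _ G] \<gamma> g by (simp add: fscale_eval algebra_simps)
  qed
qed

definition prj :: "'a vfield \<Rightarrow> 'a vfield" where
  "prj \<zeta> = fscale (\<lambda>_. - 2/5) (Phi A H \<alpha> (part1 \<zeta>))
     + fscale (\<lambda>_. 7/10) (part1 (lie_bracket r (lie_bracket r (part1 \<zeta>)))) + part2 \<zeta>"

lemma prj_G [simp]: "\<zeta> \<in> V \<Longrightarrow> prj \<zeta> \<in> G"
  by (simp add: prj_def)

lemma proj_H_eq: "\<zeta> \<in> V \<Longrightarrow> proj_H A H \<alpha> \<zeta> = prj \<zeta>"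
  by (intro HOL.ext) (simp add: proj_H_def decomposition_eq Psi_eq prj_def scaleR_fun_def fscale_eval)

text \<open>\<alpha> vanishes on \<open>H\<close>, so on sections of \<open>H\<close> the exterior
  derivative of the extension is minus \<open>levi\<close>.\<close>

lemma g_metric_eq:
  assumes "\<zeta> \<in> V" "\<zeta>' \<in> V"
  shows "g_metric A H \<alpha> \<zeta> \<zeta>' x = - levi (part1 \<zeta>) (prj \<zeta>') x
    - 4/3 * ext \<zeta> x * ext \<zeta>' x - levi (part1 \<zeta>') (prj \<zeta>) x"
proof -
  have "ext_deriv (canonical_extension A H \<alpha>) \<xi> \<eta> x = - levi \<xi> \<eta> x" if "\<xi> \<in> G" "\<eta> \<in> G" for \<xi> \<eta>
  proof -
    have "ext \<xi> = (\<lambda>y. 0)" "ext \<eta> = (\<lambda>y. 0)"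
      using that by (simp_all add: fun_eq_iff)
    then show ?thesis
      using that dir_const[of \<xi> 0 x] dir_const[of \<eta> 0 x]
      by (simp add: ext_deriv_def canonical_extension_pairing levi_def dir_def)
  qed
  then show ?thesis
    using assms by (simp add: g_metric_def Let_def decomposition_eq proj_H_eq canonical_extension_pairing)
qed

end

text \<open>The last assumption is w = - levi(s, _)/4 on \<open>H\<close>, solved for the derivative
  of \<open>h\<close>. The factor 4 comes from requiring the area form of \<alpha>' to be parallel,
  which reads 4 w(\<gamma>) + levi(s, \<gamma>) = 0: one w(\<gamma>) arises from differentiating
  \<open>h\<close>, two from the term - w(\<gamma>) \<eta> of the new connection, once in each
  argument, and one from its term - w(\<eta>) \<gamma> by the Pluecker relation.\<close>

locale conformal_change = contact_reeb A H \<alpha> r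
  for A :: "'a::{t2_space,second_countable_topology} chart set" and H \<alpha> r +
  fixes \<alpha>' :: "'a \<Rightarrow> 'a tangent \<Rightarrow> real" and h :: "'a \<Rightarrow> real" and s :: "'a vfield"
  assumes contact': "generalized_contact_form A H \<alpha>'"
    and h_F [simp]: "h \<in> F" and h_nz [simp]: "h x \<noteq> 0"
    and alpha': "v \<in> T2 A H x \<Longrightarrow> \<alpha>' x v = h x * \<alpha> x v"
    and s_G [simp]: "s \<in> G"
    and s: "\<gamma> \<in> G \<Longrightarrow> dir \<gamma> h x = h x * (- levi s \<gamma> x / 4)"

sublocale conformal_change \<subseteq> c': contact A H \<alpha>'
  by unfold_locales (rule contact')

context conformal_change
begin

definition k :: "'a \<Rightarrow> real" where "k x = inverse (h x)"

lemma k_F [simp]: "k \<in> F"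
  unfolding k_def[abs_def] by (rule F_inverse) simp_all

lemma hk [simp]: "h x * k x = 1" "k x * h x = 1"
  by (simp_all add: k_def)

lemma dir_k: "X \<in> V \<Longrightarrow> h x * dir X k x = - (k x * dir X h x)"
proof -
  assume X: "X \<in> V"
  have "(\<lambda>x. h x * k x) = (\<lambda>x. 1)" by simp
  then have "dir X (\<lambda>x. h x * k x) x = 0"
    using X by (simp only: dir_const)
  then show ?thesis
    unfolding dir_fun(5)[OF X h_F k_F] by linarith
qed

definition w :: "'a vfield \<Rightarrow> 'a \<Rightarrow> real" where "w X x = k x * dir X h x"

lemma w_F [simp]: "X \<in> V \<Longrightarrow> w X \<in> F"
  unfolding w_def[abs_def] by simp

lemma w_G: "\<gamma> \<in> G \<Longrightarrow> w \<gamma> x = - levi s \<gamma> x / 4"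
  by (simp add: w_def s flip: mult.assoc)

lemma h_dir_k: "X \<in> V \<Longrightarrow> h x * dir X k x = - w X x"
  by (simp add: dir_k w_def)

lemma w_add: "w (X + Y) x = w X x + w Y x"
  by (simp add: w_def algebra_simps)

text \<open>In the derivatives of \<open>w\<close> the products of first derivatives are symmetric
  in \<open>X\<close> and \<open>Y\<close>, because dk is a multiple of dh.\<close>

lemma w_closed:
  assumes "X \<in> V" "Y \<in> V"
  shows "w (lie_bracket X Y) x = dir X (w Y) x - dir Y (w X) x"
proof -
  have "h x * (dir Y h x * dir X k x) = h x * (dir X h x * dir Y k x)"
    using dir_k[OF assms(1), of x] dir_k[OF assms(2), of x] by algebra
  then have "dir Y h x * dir X k x = dir X h x * dir Y k x"
    unfolding mult_cancel_left using h_nz by blast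
  then show ?thesis
    unfolding w_def[abs_def] using assms by (simp add: algebra_simps)
qed

definition R :: "'a vfield" where "R = r + s"

lemma R_G2 [simp]: "R \<in> G2" and alpha_R [simp]: "pairing \<alpha> R y = 1"
  by (simp_all add: R_def)

lemma w_R: "w R x = w r x"
  by (simp add: R_def w_add w_G)

lemma pairing_alpha' [simp]: "\<rho> \<in> G2 \<Longrightarrow> pairing \<alpha>' \<rho> y = h y * pairing \<alpha> \<rho> y"
  by (simp add: pairing_def alpha' G2_T2)

lemma levi': "\<xi> \<in> G \<Longrightarrow> \<eta> \<in> G \<Longrightarrow> c'.levi \<xi> \<eta> = (\<lambda>y. h y * levi \<xi> \<eta> y)"
  by (simp add: c'.levi_def levi_def fun_eq_iff)

text \<open>The new map kills \<open>\<zeta> - lie_bracket r (part1 \<zeta>)\<close>, which lies in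
  \<open>T2\<close>, and by \<open>part1_bracket\<close> it sends the bracket to \<alpha>'(r) = h
  times \<open>part1 \<zeta>\<close>.\<close>

lemma part1': "\<zeta> \<in> V \<Longrightarrow> c'.part1 \<zeta> = fscale h (part1 \<zeta>)"
proof -
  assume z: "\<zeta> \<in> V"
  have "c'.part1 (\<zeta> - lie_bracket r (part1 \<zeta>)) = 0"
    using z by (intro c'.part1_G2) simp
  moreover have "pairing \<alpha>' r = h"
    by (simp add: fun_eq_iff)
  ultimately show ?thesis
    using z by simp
qed

text \<open>Adding \<open>s\<close> contributes - levi(s, \<eta>) \<xi>, and differentiating 1/h
  contributes - w(\<xi>) \<eta> - w(\<eta>) \<xi>. With w = - levi(s, _)/4 the coefficients become -
  1 + 1/4 = - 3/4 and 1/4.\<close>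

lemma nab':
  assumes "\<xi> \<in> G" "\<eta> \<in> G"
  shows "c'.nab (fscale k R) \<xi> \<eta>
    = nab r \<xi> \<eta> + fscale (\<lambda>x. - (3/4) * levi s \<eta> x) \<xi> + fscale (\<lambda>x. 1/4 * levi s \<xi> x) \<eta>"
proof (intro HOL.ext)
  fix x f
  have 1: "fscale (pairing \<alpha> R) X = X" for X :: "'a vfield"
    by (rule fscale_one) simp
  have "lie_bracket \<xi> (lie_bracket (fscale k R) \<eta>)
      = (fscale k (lie_bracket \<xi> (lie_bracket R \<eta>)) + fscale (dir \<xi> k) (lie_bracket R \<eta>))
        - (fscale (dir \<eta> k) (lie_bracket \<xi> R) + fscale (dir \<xi> (dir \<eta> k)) R)"
    using assms by (simp add: bracket_fscale_left bracket_diff_right bracket_fscale_right)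
  then have "part1 (lie_bracket \<xi> (lie_bracket (fscale k R) \<eta>))
      = (fscale k (nab R \<xi> \<eta>) + fscale (dir \<xi> k) \<eta>) - fscale (dir \<eta> k) (- \<xi>)"
    using assms by (simp add: nab_def 1)
  moreover have "nab R \<xi> \<eta> = nab r \<xi> \<eta> - fscale (levi s \<eta>) \<xi>"
    unfolding R_def using assms by (simp add: nab_shift)
  ultimately have p: "part1 (lie_bracket \<xi> (lie_bracket (fscale k R) \<eta>))
      = (fscale k (nab r \<xi> \<eta> - fscale (levi s \<eta>) \<xi>) + fscale (dir \<xi> k) \<eta>) - fscale (dir \<eta> k) (- \<xi>)"
    by simp
  have "c'.nab (fscale k R) \<xi> \<eta> = fscale h (part1 (lie_bracket \<xi> (lie_bracket (fscale k R) \<eta>)))"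
    unfolding c'.nab_def by (rule part1') (use assms in simp)
  then have "c'.nab (fscale k R) \<xi> \<eta> x f = (h x * k x) * (nab r \<xi> \<eta> x f - levi s \<eta> x * \<xi> x f)
      + (h x * dir \<xi> k x) * \<eta> x f + (h x * dir \<eta> k x) * \<xi> x f"
    by (simp add: p fscale_eval algebra_simps del: hk)
  also have "\<dots> = nab r \<xi> \<eta> x f - 3/4 * levi s \<eta> x * \<xi> x f + 1/4 * levi s \<xi> x * \<eta> x f"
    using assms by (simp add: h_dir_k w_G algebra_simps)
  finally show "c'.nab (fscale k R) \<xi> \<eta> x f
      = (nab r \<xi> \<eta> + fscale (\<lambda>x. - (3/4) * levi s \<eta> x) \<xi> + fscale (\<lambda>x. 1/4 * levi s \<xi> x) \<eta>) x f"
    by (simp add: fscale_eval)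
qed

lemma reeb': "c'.reeb (fscale k R)"
  unfolding c'.reeb_def
proof (intro conjI ballI allI)
  show "fscale k R \<in> G2" by simp
  show "pairing \<alpha>' (fscale k R) y = 1" for y by simp
  fix \<gamma> \<xi> \<eta> y assume G: "\<gamma> \<in> G" "\<xi> \<in> G" "\<eta> \<in> G"
  have "levi s \<xi> y * levi \<gamma> \<eta> y + levi \<xi> \<gamma> y * levi s \<eta> y + levi \<gamma> s y * levi \<xi> \<eta> y = 0"
    by (rule levi_plane_levi) (use G in simp_all)
  \<comment> \<open>Turns the terms with \<open>levi s \<xi>\<close> and
    \<open>levi s \<eta>\<close> into a multiple of \<open>levi \<xi> \<eta>\<close>; the claim is
    then - 1/4 = 1/2 - 3/4.\<close>
  then have pl: "levi s \<gamma> y * levi \<xi> \<eta> y = levi s \<xi> y * levi \<gamma> \<eta> y + levi s \<eta> y * levi \<xi> \<gamma> y"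
    using levi_anti[OF G(1) s_G, of y] by (simp add: algebra_simps)
  have a: "dir \<gamma> (c'.levi \<xi> \<eta>) y = h y * (levi (nab r \<gamma> \<xi>) \<eta> y + levi \<xi> (nab r \<gamma> \<eta>) y
      - 1/4 * (levi s \<gamma> y * levi \<xi> \<eta> y))"
    using G by (simp add: levi' dir_levi s algebra_simps)
  have b: "c'.levi (c'.nab (fscale k R) \<gamma> \<xi>) \<eta> y + c'.levi \<xi> (c'.nab (fscale k R) \<gamma> \<eta>) y
      = h y * (levi (nab r \<gamma> \<xi>) \<eta> y + levi \<xi> (nab r \<gamma> \<eta>) y + 1/2 * (levi s \<gamma> y * levi \<xi> \<eta> y)
        - 3/4 * (levi s \<xi> y * levi \<gamma> \<eta> y + levi s \<eta> y * levi \<xi> \<gamma> y))"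
    using G by (simp add: levi' nab' algebra_simps)
  have "u + v - 1/4 * p = u + v + 1/2 * p - 3/4 * p" for u v p :: real
    by linarith
  then show "dir \<gamma> (c'.levi \<xi> \<eta>) y
      = c'.levi (c'.nab (fscale k R) \<gamma> \<xi>) \<eta> y + c'.levi \<xi> (c'.nab (fscale k R) \<gamma> \<eta>) y"
    unfolding a b pl[symmetric] by (simp only:)
qed

end

sublocale conformal_change \<subseteq> cr: contact_reeb A H \<alpha>' "fscale k R"
  by unfold_locales (rule reeb')

section \<open>Transformation of the decomposition, the curvature and the metric\<close>

context conformal_change
begin

lemma bracket_rescaled:
  assumes "t \<in> G"
  shows "lie_bracket (fscale k R) (fscale h t) = lie_bracket R t + fscale (w R) t + fscale (w t) R"
proof (intro HOL.ext)
  fix x f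
  have "lie_bracket (fscale k R) (fscale h t)
      = fscale h (fscale k (lie_bracket R t) - fscale (dir t k) R) + fscale (dir (fscale k R) h) t"
    using assms by (subst bracket_fscale_right) (simp_all add: bracket_fscale_left)
  then have "lie_bracket (fscale k R) (fscale h t) x f = (h x * k x) * lie_bracket R t x f
      - (h x * dir t k x) * R x f + (k x * dir R h x) * t x f"
    by (simp add: fscale_eval algebra_simps del: hk)
  then show "lie_bracket (fscale k R) (fscale h t) x f
      = (lie_bracket R t + fscale (w R) t + fscale (w t) R) x f"
    using assms h_dir_k[of t x] by (simp add: fscale_eval w_def[of R])
qed

lemma part1_rescaled: "\<zeta> \<in> V \<Longrightarrow> lie_bracket (fscale k R) (c'.part1 \<zeta>)
    = lie_bracket r (part1 \<zeta>) + lie_bracket s (part1 \<zeta>) + fscale (w R) (part1 \<zeta>) + fscale (w (part1 \<zeta>)) R"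
  by (simp add: part1' bracket_rescaled) (simp add: R_def bracket_add_left)

text \<open>With t = \<open>part1 \<zeta>\<close>, the bracket with \<open>s\<close> contributes -
  levi(s, t), and the rescaling inside the bracket contributes - w(t) = levi(s, t)/4.\<close>

lemma ext':
  assumes "\<zeta> \<in> V"
  shows "cr.ext \<zeta> y = h y * (ext \<zeta> y - 3/4 * levi s (part1 \<zeta>) y)"
proof -
  let ?t = "part1 \<zeta>"
  have "\<zeta> - lie_bracket (fscale k R) (c'.part1 \<zeta>)
      = (\<zeta> - lie_bracket r ?t) - lie_bracket s ?t - fscale (w R) ?t - fscale (w ?t) R"
    using assms by (simp add: part1_rescaled)
  then have "cr.ext \<zeta> y = h y * pairing \<alpha> ((\<zeta> - lie_bracket r ?t) - lie_bracket s ?t - fscale (w R) ?t - fscale (w ?t) R) y"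
    unfolding cr.ext_def using assms by (simp only: pairing_alpha' G2_diff residue_G2 G2_bracket G2_fscale
      s_G part1_G w_F G_V G2_V G_G2 R_G2)
  also have "\<dots> = h y * (ext \<zeta> y - levi s ?t y - w ?t y)"
    using assms by (simp add: ext_def levi_def)
  also have "\<dots> = h y * (ext \<zeta> y - 3/4 * levi s ?t y)"
    using assms by (simp add: w_G)
  finally show ?thesis .
qed

text \<open>The bracketed difference is the \<open>H\<close>-part of
  [s, \<open>part1 \<zeta>\<close>] and contains derivatives of \<open>s\<close>; it is kept intact
  in order to cancel in the projection.\<close>

lemma part2':
  assumes "\<zeta> \<in> V"
  shows "cr.part2 \<zeta> x f = part2 \<zeta> x f - ext \<zeta> x * s x f + levi s (part1 \<zeta>) x * s x f
    - (lie_bracket s (part1 \<zeta>) x f - levi s (part1 \<zeta>) x * r x f) - w r x * part1 \<zeta> x f"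
proof -
  let ?t = "part1 \<zeta>"
  have Rx: "R x f = r x f + s x f"
    by (simp add: R_def)
  have a: "cr.part2 \<zeta> x f = \<zeta> x f - lie_bracket r ?t x f - lie_bracket s ?t x f - w r x * ?t x f
      - w ?t x * R x f - cr.ext \<zeta> x * (k x * R x f)"
    unfolding cr.part2_def using assms by (simp add: part1_rescaled fscale_eval w_R)
  have b: "cr.ext \<zeta> x * (k x * R x f) = (h x * k x) * ((ext \<zeta> x - 3/4 * levi s ?t x) * R x f)"
    unfolding ext'[OF assms] by (simp only: mult_ac)
  show ?thesis
    unfolding a b using assms Rx
    by (simp add: part2_def fscale_eval w_G algebra_simps) (simp add: field_simps)
qed

text \<open>Derivatives of \<open>w R\<close> and \<open>w t\<close> only multiply sections of
  \<open>T2\<close>, which \<open>part1\<close> kills. Of the brackets with \<open>s\<close>, [r,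
  [s, t]] yields the \<open>H\<close>-part of [s, t], [s, [r, t]] yields \<open>nab r s t\<close>,
  and [s, [s, t]] the term quadratic in \<open>s\<close>.\<close>

lemma second_bracket':
  assumes t: "t \<in> G"
  shows "c'.part1 (lie_bracket (fscale k R) (lie_bracket (fscale k R) (fscale h t))) x f
    = part1 (lie_bracket r (lie_bracket r t)) x f + nab r s t x f
      + (lie_bracket s t x f - levi s t x * r x f) - levi s t x * s x f + w r x * t x f"
proof -
  let ?Q = "lie_bracket R t + fscale (w R) t + fscale (w t) R"
  have QV: "?Q \<in> V" using t by simp
  have a: "c'.part1 (lie_bracket (fscale k R) (lie_bracket (fscale k R) (fscale h t)))
      = fscale h (part1 (lie_bracket (fscale k R) ?Q))"
    unfolding bracket_rescaled[OF t] by (rule part1') (use QV in simp)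
  have b: "part1 (lie_bracket (fscale k R) ?Q) = fscale k (part1 (lie_bracket R ?Q))"
    unfolding bracket_fscale_left[OF G2_V[OF R_G2] QV k_F] by simp
  have 1: "c'.part1 (lie_bracket (fscale k R) (lie_bracket (fscale k R) (fscale h t))) x f
      = part1 (lie_bracket R ?Q) x f"
    unfolding a b fscale_eval by (simp flip: mult.assoc)
  have "lie_bracket R ?Q = lie_bracket R (lie_bracket R t)
      + (fscale (w R) (lie_bracket R t) + fscale (dir R (w R)) t) + fscale (dir R (w t)) R"
    using t by (simp add: bracket_add_right bracket_fscale_right)
  then have 2: "part1 (lie_bracket R ?Q) = part1 (lie_bracket R (lie_bracket R t)) + fscale (w R) t"
    using t by (simp add: fscale_one[of "pairing \<alpha> R"])
  have "lie_bracket R (lie_bracket R t) = (lie_bracket r (lie_bracket r t) + lie_bracket r (lie_bracket s t))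
      + (lie_bracket s (lie_bracket r t) + lie_bracket s (lie_bracket s t))"
    unfolding R_def using t by (simp add: bracket_add_left bracket_add_right)
  then have 3: "part1 (lie_bracket R (lie_bracket R t)) = (part1 (lie_bracket r (lie_bracket r t))
      + (lie_bracket s t - fscale (levi s t) r)) + (nab r s t - fscale (levi s t) s)"
    using t by (simp add: part1_r_bracket nab_def levi_def)
  show ?thesis
    unfolding 1 2 3 by (simp add: fscale_eval w_R algebra_simps)
qed

lemma w_fscale: "w (fscale g X) x = g x * w X x"
  by (simp add: w_def)

text \<open>The one-form \<open>w = d log h\<close> is closed; on \<open>H\<close> it is a multiple of \<open>levi s\<close>, so that
  closedness computes the trace of \<open>nab r _ s\<close>.\<close>

lemma trace_nab_s:
  assumes "\<xi> \<in> G" "\<eta> \<in> G"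
  shows "levi (nab r \<xi> s) \<eta> x - levi (nab r \<eta> s) \<xi> x = - 4 * levi \<xi> \<eta> x * w r x"
proof -
  let ?\<omega> = "lie_bracket \<xi> \<eta> - fscale (levi \<xi> \<eta>) r"
  have d: "dir \<xi> (w \<eta>) x = (- 1/4) * (levi (nab r \<xi> s) \<eta> x + levi s (nab r \<xi> \<eta>) x)"
    if "\<xi> \<in> G" "\<eta> \<in> G" for \<xi> \<eta>
  proof -
    have "w \<eta> = (\<lambda>x. (- 1/4) * levi s \<eta> x)"
      using that by (simp add: w_G fun_eq_iff)
    then have "dir \<xi> (w \<eta>) x = (- 1/4) * dir \<xi> (levi s \<eta>) x"
      using that by (simp only: dir_fun(4) levi_F s_G G_V)
    then show ?thesis using that by (simp only: dir_levi s_G)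
  qed
  have "lie_bracket \<xi> \<eta> = ?\<omega> + fscale (levi \<xi> \<eta>) r" by simp
  then have "w (lie_bracket \<xi> \<eta>) x = w ?\<omega> x + levi \<xi> \<eta> x * w r x"
    by (metis w_add w_fscale)
  also have "w ?\<omega> x = - levi s ?\<omega> x / 4"
    using assms by (simp only: w_G bracket_G)
  also have "levi s ?\<omega> x = levi s (nab r \<xi> \<eta>) x - levi s (nab r \<eta> \<xi>) x"
    unfolding torsion[OF assms, symmetric] using assms by simp
  finally show ?thesis
    using w_closed[of \<xi> \<eta> x] d[OF assms] d[OF assms(2,1)] assms by (simp add: field_simps)
qed

lemma nab'_nab':
  assumes "\<xi> \<in> G" "\<eta> \<in> G" "\<gamma> \<in> G"
  shows "c'.nab (fscale k R) \<xi> (c'.nab (fscale k R) \<eta> \<gamma>) x f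
    = nab r \<xi> (nab r \<eta> \<gamma>) x f - 3/4 * levi s \<gamma> x * nab r \<xi> \<eta> x f
      - 3/4 * (levi (nab r \<xi> s) \<gamma> x + levi s (nab r \<xi> \<gamma>) x) * \<eta> x f
      + 1/4 * levi s \<eta> x * nab r \<xi> \<gamma> x f
      + 1/4 * (levi (nab r \<xi> s) \<eta> x + levi s (nab r \<xi> \<eta>) x) * \<gamma> x f
      - 3/4 * (levi s (nab r \<eta> \<gamma>) x - 1/2 * levi s \<gamma> x * levi s \<eta> x) * \<xi> x f
      + 1/4 * levi s \<xi> x * (nab r \<eta> \<gamma> x f - 3/4 * levi s \<gamma> x * \<eta> x f + 1/4 * levi s \<eta> x * \<gamma> x f)"
proof -
  let ?M = "nab r \<eta> \<gamma> + fscale (\<lambda>x. - (3/4) * levi s \<gamma> x) \<eta> + fscale (\<lambda>x. 1/4 * levi s \<eta> x) \<gamma>"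
  have Fs: "(\<lambda>x. - (3/4) * levi s \<gamma> x) \<in> F" "(\<lambda>x. 1/4 * levi s \<eta> x) \<in> F"
    using assms by (intro F_mult F_const levi_F s_G; simp)+
  have M: "?M \<in> G" using assms Fs by (simp only: G_add G_fscale nab_G r_G2)
  have n: "nab r \<xi> (fscale g \<eta>) = fscale g (nab r \<xi> \<eta>) + fscale (dir \<xi> g) \<eta>" if "\<eta> \<in> G" "g \<in> F" for \<eta> g
    using nab_fscale_right[OF r_G2 assms(1) that] by simp
  have 1: "nab r \<xi> ?M = nab r \<xi> (nab r \<eta> \<gamma>)
      + (fscale (\<lambda>x. - (3/4) * levi s \<gamma> x) (nab r \<xi> \<eta>) + fscale (dir \<xi> (\<lambda>x. - (3/4) * levi s \<gamma> x)) \<eta>)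
      + (fscale (\<lambda>x. 1/4 * levi s \<eta> x) (nab r \<xi> \<gamma>) + fscale (dir \<xi> (\<lambda>x. 1/4 * levi s \<eta> x)) \<gamma>)"
    using assms Fs by (simp only: n nab_add_right G_add G_fscale nab_G r_G2)
  have 2: "dir \<xi> (\<lambda>x. - (3/4) * levi s \<gamma> x) x = - (3/4) * (levi (nab r \<xi> s) \<gamma> x + levi s (nab r \<xi> \<gamma>) x)"
      "dir \<xi> (\<lambda>x. 1/4 * levi s \<eta> x) x = 1/4 * (levi (nab r \<xi> s) \<eta> x + levi s (nab r \<xi> \<eta>) x)"
    using assms by (simp_all only: dir_fun(4) G_V levi_F s_G dir_levi)
  \<comment> \<open>The two products of values of \<open>levi s\<close> add up with - 3/4 + 1/4, the
    origin of 1/2 in the claim.\<close>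
  have 3: "levi s ?M x = levi s (nab r \<eta> \<gamma>) x + - (3/4) * levi s \<gamma> x * levi s \<eta> x + 1/4 * levi s \<eta> x * levi s \<gamma> x"
    using assms Fs by (simp only: levi_add_right levi_fscale_right G_add G_fscale nab_G r_G2 s_G)
  have "c'.nab (fscale k R) \<xi> (c'.nab (fscale k R) \<eta> \<gamma>)
      = nab r \<xi> ?M + fscale (\<lambda>x. - (3/4) * levi s ?M x) \<xi> + fscale (\<lambda>x. 1/4 * levi s \<xi> x) ?M"
    unfolding nab'[OF assms(2,3)] by (rule nab'[OF assms(1) M])
  then have "c'.nab (fscale k R) \<xi> (c'.nab (fscale k R) \<eta> \<gamma>) x f
      = nab r \<xi> ?M x f + - (3/4) * levi s ?M x * \<xi> x f + 1/4 * levi s \<xi> x * ?M x f"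
    by (simp only: plus_fun_apply fscale_eval)
  then show ?thesis
    unfolding 1 3 by (simp only: plus_fun_apply fscale_eval 2) (simp add: field_simps)
qed

text \<open>The conclusion is a linear combination of the hypotheses, with the coefficients shown in the proof. The
  three bracketed terms are the right hand sides of \<open>nab'_nab'\<close> (twice) and the connection term.\<close>

lemma curvature_identity:
  fixes X :: real
  assumes p2: "Lxg * Y = leg * n1 + Lxe * g" and p3: "Leg * X = lxg * n2 + Lex * g"
    and p4: "leg * n1 - lxg * n2 = - b * Ngs" and q1: "c * (a * Y - e * X) = c * (- b * S)"
    and q2: "c * (Nxe - Nex) = c * O'" and q3: "Ao * g = (Axe - Aex) * g"
    and q4: "(Lxe - Lex) * g = - 4 * b * u * g"
  shows "(NN1 - 3/4 * c * Nxe - 3/4 * (Lxg + Axg) * Y + 1/4 * e * Nxg + 1/4 * (Lxe + Axe) * g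
      - 3/4 * (Aeg - 1/2 * c * e) * X + 1/4 * a * (Neg - 3/4 * c * Y + 1/4 * e * g))
    - (NN2 - 3/4 * c * Nex - 3/4 * (Leg + Aeg) * X + 1/4 * a * Neg + 1/4 * (Lex + Aex) * g
      - 3/4 * (Axg - 1/2 * c * a) * Y + 1/4 * e * (Nxg - 3/4 * c * X + 1/4 * a * g))
    - (Nog - b * Nsg - 3/4 * c * (O' - b * S) + 1/4 * Ao * g)
    = NN1 - NN2 - Nog + b * (Nsg - 3/16 * c * S + 2 * u * g + 3/4 * Ngs)" (is "?L = ?R")
proof -
  have "?L - ?R = - 3/4 * (Lxg * Y - (leg * n1 + Lxe * g)) + 3/4 * (Leg * X - (lxg * n2 + Lex * g))
      - 3/4 * (leg * n1 - lxg * n2 - (- b * Ngs)) - 9/16 * (c * (a * Y - e * X) - c * (- b * S))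
      - 3/4 * (c * (Nxe - Nex) - c * O') - 1/4 * (Ao * g - (Axe - Aex) * g)
      - 1/2 * ((Lxe - Lex) * g - (- 4 * b * u * g))"
    by (simp add: field_simps)
  also have "\<dots> = 0"
    unfolding p2 p3 p4 q1 q2 q3 q4 by simp
  finally show ?thesis by (rule right_minus_eq[THEN iffD1])
qed

text \<open>The terms along \<xi> and \<eta> are not separately multiples of
  \<open>levi \<xi> \<eta>\<close>; the planar relations for \<open>s\<close>, \<open>N1\<close> and
  \<open>N2\<close> combine them into such multiples, and \<open>trace_nab_s\<close> evaluates the
  part along \<gamma>.\<close>

lemma curv':
  assumes G: "\<xi> \<in> G" "\<eta> \<in> G" "\<gamma> \<in> G"
  shows "cr.curv \<xi> \<eta> \<gamma> x f = curv \<xi> \<eta> \<gamma> x f + levi \<xi> \<eta> x * (nab r s \<gamma> x f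
    - 3/16 * levi s \<gamma> x * s x f + 2 * w r x * \<gamma> x f + 3/4 * nab r \<gamma> s x f)"
proof -
  let ?\<omega> = "lie_bracket \<xi> \<eta> - fscale (levi \<xi> \<eta>) r"
  let ?\<omega>' = "?\<omega> - fscale (levi \<xi> \<eta>) s"
  have \<omega>: "?\<omega> \<in> G" "?\<omega>' \<in> G" using G by simp_all
  \<comment> \<open>The factor \<open>h\<close> of the area form and the factor \<open>k\<close> of
    the Reeb field cancel, so the bracket is corrected only by the shift \<open>s\<close>.\<close>
  have o: "lie_bracket \<xi> \<eta> - fscale (c'.levi \<xi> \<eta>) (fscale k R) = ?\<omega>'"
  proof (intro HOL.ext)
    fix y g
    have "h y * levi \<xi> \<eta> y * (k y * R y g) = (h y * k y) * (levi \<xi> \<eta> y * R y g)"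
      by (simp only: mult_ac)
    then have "h y * levi \<xi> \<eta> y * (k y * R y g) = levi \<xi> \<eta> y * (r y g + s y g)"
      by (simp add: R_def)
    then show "(lie_bracket \<xi> \<eta> - fscale (c'.levi \<xi> \<eta>) (fscale k R)) y g = ?\<omega>' y g"
      using G by (simp add: levi' fscale_eval algebra_simps)
  qed
  have e0: "cr.curv \<xi> \<eta> \<gamma> x f = c'.nab (fscale k R) \<xi> (c'.nab (fscale k R) \<eta> \<gamma>) x f
      - c'.nab (fscale k R) \<eta> (c'.nab (fscale k R) \<xi> \<gamma>) x f - c'.nab (fscale k R) ?\<omega>' \<gamma> x f"
    unfolding cr.curv_def o by (simp only: minus_apply)
  have e3: "c'.nab (fscale k R) ?\<omega>' \<gamma> x f = nab r ?\<omega> \<gamma> x f - levi \<xi> \<eta> x * nab r s \<gamma> x f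
      - 3/4 * levi s \<gamma> x * (?\<omega> x f - levi \<xi> \<eta> x * s x f) + 1/4 * levi s ?\<omega> x * \<gamma> x f"
  proof -
    have "nab r ?\<omega>' \<gamma> = nab r ?\<omega> \<gamma> - fscale (levi \<xi> \<eta>) (nab r s \<gamma>)"
      using G \<omega> by (simp only: nab_diff_left nab_fscale_left r_G2 s_G G_fscale levi_F)
    moreover have "levi s ?\<omega>' x = levi s ?\<omega> x"
      using G \<omega> by (simp only: levi_diff_right levi_fscale_right s_G G_fscale levi_F levi_self)
    ultimately show ?thesis
      unfolding nab'[OF \<omega>(2) G(3)] by (simp add: fscale_eval)
  qed
  have \<omega>x: "nab r \<xi> \<eta> x f - nab r \<eta> \<xi> x f = ?\<omega> x f"
    using fun_cong[OF fun_cong[OF torsion[OF G(1,2)]], of x f] by (simp only: minus_apply)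
  have l\<omega>: "levi s ?\<omega> x = levi s (nab r \<xi> \<eta>) x - levi s (nab r \<eta> \<xi>) x"
    unfolding torsion[OF G(1,2), symmetric] using G by simp
  have plane: "levi a b x * c x f + levi b c x * a x f + levi c a x * b x f = 0"
    if "a \<in> G" "b \<in> G" "c \<in> G" for a b c
    using fun_cong[OF fun_cong[OF levi_plane[OF that]], of x f] by (simp add: fscale_eval)
  define N1 where "N1 = nab r \<xi> s"
  define N2 where "N2 = nab r \<eta> s"
  have N: "N1 \<in> G" "N2 \<in> G" using G by (simp_all add: N1_def N2_def)
  have anti: "levi \<eta> \<xi> x = - levi \<xi> \<eta> x" "levi \<eta> s x = - levi s \<eta> x" "levi \<xi> s x = - levi s \<xi> x"
      "levi \<gamma> \<xi> x = - levi \<xi> \<gamma> x" "levi \<eta> N1 x = - levi N1 \<eta> x" "levi \<xi> N2 x = - levi N2 \<xi> x"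
      "levi \<gamma> \<eta> x = - levi \<eta> \<gamma> x"
    using G N by (intro levi_anti; simp)+
  have p1: "levi s \<xi> x * \<eta> x f - levi s \<eta> x * \<xi> x f = - levi \<xi> \<eta> x * s x f"
    using plane[OF s_G G(1,2)] anti by (simp add: algebra_simps)
  have p2: "levi N1 \<gamma> x * \<eta> x f = levi \<eta> \<gamma> x * N1 x f + levi N1 \<eta> x * \<gamma> x f"
    using plane[OF N(1) G(3,2)] anti by (simp add: algebra_simps)
  have p3: "levi N2 \<gamma> x * \<xi> x f = levi \<xi> \<gamma> x * N2 x f + levi N2 \<xi> x * \<gamma> x f"
    using plane[OF N(2) G(3,1)] anti by (simp add: algebra_simps)
  \<comment> \<open>\<open>nab r _ s\<close> is function-linear in its direction, so it can be
    applied to the planar relation of \<xi>, \<eta> and \<gamma>.\<close>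
  have p4: "levi \<eta> \<gamma> x * N1 x f - levi \<xi> \<gamma> x * N2 x f = - levi \<xi> \<eta> x * nab r \<gamma> s x f"
  proof -
    have "nab r (fscale (levi \<xi> \<eta>) \<gamma> + fscale (levi \<eta> \<gamma>) \<xi> + fscale (levi \<gamma> \<xi>) \<eta>) s
        = fscale (levi \<xi> \<eta>) (nab r \<gamma> s) + fscale (levi \<eta> \<gamma>) N1 + fscale (levi \<gamma> \<xi>) N2"
      unfolding N1_def N2_def using G
      by (simp only: nab_add_left nab_fscale_left r_G2 s_G G_fscale levi_F G_add)
    moreover have "nab r 0 s = 0"
      using nab_diff_left[of r 0 s 0] by simp
    ultimately have "fscale (levi \<xi> \<eta>) (nab r \<gamma> s) + fscale (levi \<eta> \<gamma>) N1 + fscale (levi \<gamma> \<xi>) N2 = 0"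
      unfolding levi_plane[OF G] by simp
    from fun_cong[OF fun_cong[OF this], of x f] show ?thesis
      using anti by (simp add: fscale_eval algebra_simps)
  qed
  \<comment> \<open>Enters the curvature with the factor 1/4 - 3/4 = - 1/2 and so produces the term
    2 w(r) \<gamma>.\<close>
  have tr: "levi N1 \<eta> x - levi N2 \<xi> x = - 4 * levi \<xi> \<eta> x * w r x"
    unfolding N1_def N2_def by (rule trace_nab_s[OF G(1,2)])
  have q1: "levi s \<gamma> x * (levi s \<xi> x * \<eta> x f - levi s \<eta> x * \<xi> x f) = levi s \<gamma> x * (- levi \<xi> \<eta> x * s x f)"
    unfolding p1 ..
  have q2: "levi s \<gamma> x * (nab r \<xi> \<eta> x f - nab r \<eta> \<xi> x f) = levi s \<gamma> x * ?\<omega> x f"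
    unfolding \<omega>x ..
  have q3: "levi s ?\<omega> x * \<gamma> x f = (levi s (nab r \<xi> \<eta>) x - levi s (nab r \<eta> \<xi>) x) * \<gamma> x f"
    unfolding l\<omega> ..
  have q4: "(levi N1 \<eta> x - levi N2 \<xi> x) * \<gamma> x f = - 4 * levi \<xi> \<eta> x * w r x * \<gamma> x f"
    unfolding tr ..
  have cu: "curv \<xi> \<eta> \<gamma> x f = nab r \<xi> (nab r \<eta> \<gamma>) x f - nab r \<eta> (nab r \<xi> \<gamma>) x f - nab r ?\<omega> \<gamma> x f"
    by (simp add: curv_def)
  show ?thesis
    unfolding e0 e3 cu nab'_nab'[OF G] nab'_nab'[OF G(2,1,3)] N1_def[symmetric] N2_def[symmetric]
    by (rule curvature_identity[OF p2 p3 p4 q1 q2 q3 q4])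
qed

text \<open>Both curvatures are compared as multiples of the old area form; the new one is
  \<open>h\<close> times it, hence the factor on the left.\<close>

lemma Phi':
  assumes \<gamma>: "\<gamma> \<in> G"
  shows "fscale h (Phi A H \<alpha>' \<gamma>) = Phi A H \<alpha> \<gamma> + nab r s \<gamma> + fscale (\<lambda>x. - 3/16 * levi s \<gamma> x) s
    + fscale (\<lambda>x. 2 * w r x) \<gamma> + fscale (\<lambda>x. 3/4) (nab r \<gamma> s)"
proof (rule levi_multiple_unique)
  fix \<xi> \<eta> assume G: "\<xi> \<in> G" "\<eta> \<in> G"
  show "fscale (levi \<xi> \<eta>) (fscale h (Phi A H \<alpha>' \<gamma>)) = fscale (levi \<xi> \<eta>) (Phi A H \<alpha> \<gamma> + nab r s \<gamma>
    + fscale (\<lambda>x. - 3/16 * levi s \<gamma> x) s + fscale (\<lambda>x. 2 * w r x) \<gamma> + fscale (\<lambda>x. 3/4) (nab r \<gamma> s))"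
  proof (intro HOL.ext)
    fix x f
    have "levi \<xi> \<eta> x * (h x * Phi A H \<alpha>' \<gamma> x f) = cr.curv \<xi> \<eta> \<gamma> x f"
      unfolding cr.curv_Phi[OF \<gamma> G] levi'[OF G] fscale_eval by (simp only: mult_ac)
    also have "\<dots> = levi \<xi> \<eta> x * (Phi A H \<alpha> \<gamma> x f + (nab r s \<gamma> x f
        - 3/16 * levi s \<gamma> x * s x f + 2 * w r x * \<gamma> x f + 3/4 * nab r \<gamma> s x f))"
      unfolding curv'[OF G \<gamma>] curv_Phi[OF \<gamma> G] fscale_eval by (simp only: distrib_left)
    also have "Phi A H \<alpha> \<gamma> x f + (nab r s \<gamma> x f
        - 3/16 * levi s \<gamma> x * s x f + 2 * w r x * \<gamma> x f + 3/4 * nab r \<gamma> s x f)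
      = Phi A H \<alpha> \<gamma> x f + nab r s \<gamma> x f + - 3/16 * levi s \<gamma> x * s x f + 2 * w r x * \<gamma> x f + 3/4 * nab r \<gamma> s x f"
      by simp
    finally show "fscale (levi \<xi> \<eta>) (fscale h (Phi A H \<alpha>' \<gamma>)) x f = fscale (levi \<xi> \<eta>) (Phi A H \<alpha> \<gamma> + nab r s \<gamma>
    + fscale (\<lambda>x. - 3/16 * levi s \<gamma> x) s + fscale (\<lambda>x. 2 * w r x) \<gamma> + fscale (\<lambda>x. 3/4) (nab r \<gamma> s)) x f"
      by (simp only: fscale_eval plus_fun_apply)
  qed
qed

text \<open>By \<open>torsion\<close> the \<open>H\<close>-part of [s, t] is
  \<open>nab r s t - nab r t s\<close>, where t = \<open>part1 \<zeta>\<close>. So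
  \<open>nab r s t\<close> has the coefficient - 2/5 + 7/10 + 7/10 - 1 = 0 and
  \<open>nab r t s\<close> has - 3/10 - 7/10 + 1 = 0. For levi(s, t) s there remains 3/40 - 7/10 + 1
  = 3/8, and for w(r) t, with one more w(r) from \<open>Phi_fscale\<close>, - 6/5 + 7/10 - 1 = -
  3/2.\<close>

lemma prj':
  assumes \<zeta>: "\<zeta> \<in> V"
  shows "cr.prj \<zeta> x f = prj \<zeta> x f - ext \<zeta> x * s x f + 3/8 * levi s (part1 \<zeta>) x * s x f
    - 3/2 * w r x * part1 \<zeta> x f"
proof -
  let ?t = "part1 \<zeta>"
  have t: "?t \<in> G" using \<zeta> by simp
  have tV: "fscale h ?t = c'.part1 \<zeta>" using \<zeta> by (simp add: part1')
  have "Phi A H \<alpha>' (fscale h ?t) x f = h x * Phi A H \<alpha>' ?t x f + dir (fscale k R) h x * ?t x f"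
    unfolding cr.Phi_fscale[OF t h_F] by (simp add: fscale_eval)
  moreover have "dir (fscale k R) h x = w r x"
    unfolding w_R[symmetric] by (simp add: w_def)
  moreover have "h x * Phi A H \<alpha>' ?t x f = Phi A H \<alpha> ?t x f + nab r s ?t x f
      - 3/16 * levi s ?t x * s x f + 2 * w r x * ?t x f + 3/4 * nab r ?t s x f"
    using fun_cong[OF fun_cong[OF Phi'[OF t]], of x f] by (simp add: fscale_eval)
  ultimately have 1: "Phi A H \<alpha>' (fscale h ?t) x f = Phi A H \<alpha> ?t x f + nab r s ?t x f
      - 3/16 * levi s ?t x * s x f + 3 * w r x * ?t x f + 3/4 * nab r ?t s x f"
    by simp
  have 2: "nab r s ?t x f - nab r ?t s x f = lie_bracket s ?t x f - levi s ?t x * r x f"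
    using fun_cong[OF fun_cong[OF torsion[OF s_G t]], of x f] by (simp add: fscale_eval)
  have "cr.prj \<zeta> x f = - 2/5 * Phi A H \<alpha>' (fscale h ?t) x f
      + 7/10 * c'.part1 (lie_bracket (fscale k R) (lie_bracket (fscale k R) (fscale h ?t))) x f
      + cr.part2 \<zeta> x f"
    unfolding tV cr.prj_def by (simp only: plus_fun_apply fscale_eval)
  moreover have "prj \<zeta> x f = - 2/5 * Phi A H \<alpha> ?t x f
      + 7/10 * part1 (lie_bracket r (lie_bracket r ?t)) x f + part2 \<zeta> x f"
    unfolding prj_def by (simp only: plus_fun_apply fscale_eval)
  ultimately show ?thesis
    unfolding 1 second_bracket'[OF t] part2'[OF \<zeta>] 2[symmetric] by (simp add: field_simps)
qed

text \<open>The product of the extensions, with factor - 4/3, contributes - 3/4 times the product of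
  the two values of \<open>levi s\<close>, besides mixed terms with \<open>ext\<close>; the
  projections contribute the opposite, 3/8 each for that product. The terms with w(r) cancel because
  \<open>levi\<close> is skew.\<close>

lemma g_metric':
  assumes "\<zeta> \<in> V" "\<zeta>' \<in> V"
  shows "g_metric A H \<alpha>' \<zeta> \<zeta>' x = (h x)\<^sup>2 * g_metric A H \<alpha> \<zeta> \<zeta>' x"
proof -
  have prj: "cr.prj \<zeta> = prj \<zeta> + fscale (\<lambda>x. 3/8 * levi s (part1 \<zeta>) x - ext \<zeta> x) s
      - fscale (\<lambda>x. 3/2 * w r x) (part1 \<zeta>)" if "\<zeta> \<in> V" for \<zeta>
    using that by (intro HOL.ext) (simp add: prj' fscale_eval algebra_simps)
  have l: "c'.levi (c'.part1 \<zeta>) (cr.prj \<zeta>') x = (h x)\<^sup>2 * (levi (part1 \<zeta>) (prj \<zeta>') x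
      - (3/8 * levi s (part1 \<zeta>') x - ext \<zeta>' x) * levi s (part1 \<zeta>) x
      - 3/2 * w r x * levi (part1 \<zeta>) (part1 \<zeta>') x)" if "\<zeta> \<in> V" "\<zeta>' \<in> V" for \<zeta> \<zeta>'
    using that levi_anti[of "part1 \<zeta>" s x]
    by (simp add: part1' prj levi' power2_eq_square algebra_simps)
  show ?thesis
    unfolding cr.g_metric_eq[OF assms] g_metric_eq[OF assms] l[OF assms] l[OF assms(2,1)]
      ext'[OF assms(1)] ext'[OF assms(2)]
    using levi_anti[of "part1 \<zeta>'" "part1 \<zeta>" x] assms by (simp add: power2_eq_square field_simps)
qed

end

section \<open>Comparison of two arbitrary contact forms\<close>

lemma g_metric_rescaled:
  fixes A :: "'a::{t2_space,second_countable_topology} chart set"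
  assumes A: "smooth_atlas A" and H: "generic_distribution A H"
    and \<alpha>: "generalized_contact_form A H \<alpha>" and \<alpha>': "generalized_contact_form A H \<alpha>'"
    and h: "h \<in> smooth_functions A" "\<And>x. h x \<noteq> 0"
    and eq: "\<And>x v. v \<in> T2 A H x \<Longrightarrow> \<alpha>' x v = h x * \<alpha> x v"
    and \<zeta>: "\<zeta> \<in> vector_fields A" "\<zeta>' \<in> vector_fields A"
  shows "g_metric A H \<alpha>' \<zeta> \<zeta>' x = (h x)\<^sup>2 * g_metric A H \<alpha> \<zeta> \<zeta>' x"
proof -
  interpret contact A H \<alpha>
    by unfold_locales (fact A H \<alpha>)+
  obtain r where r: "reeb r"
    using reeb_exists by blast
  interpret contact_reeb A H \<alpha> r
    by unfold_locales (fact r)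
  \<comment> \<open>The one-form - 4 dh/h on \<open>H\<close>; \<open>levi_dual_exists\<close>
    represents it by the section \<open>s\<close> that the locale expects.\<close>
  define \<tau> where "\<tau> \<gamma> = (\<lambda>y. - 4 * (inverse (h y) * dir \<gamma> h y))" for \<gamma>
  obtain s where s: "s \<in> sections A H" "\<And>\<gamma> y. \<gamma> \<in> sections A H \<Longrightarrow> levi s \<gamma> y = \<tau> \<gamma> y"
  proof (rule levi_dual_exists[of \<tau>])
    show "\<tau> \<gamma> \<in> smooth_functions A" if "\<gamma> \<in> sections A H" for \<gamma>
      unfolding \<tau>_def using that h by (intro F_mult F_const F_inverse) simp_all
    show "\<tau> (\<gamma> + \<gamma>') y = \<tau> \<gamma> y + \<tau> \<gamma>' y" for \<gamma> \<gamma>' y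
      by (simp add: \<tau>_def algebra_simps)
    show "\<tau> (fscale g \<gamma>) y = g y * \<tau> \<gamma> y" for g \<gamma> y
      by (simp add: \<tau>_def)
  qed blast
  interpret conformal_change A H \<alpha> r \<alpha>' h s
  proof unfold_locales
    show "dir \<gamma> h x = h x * (- levi s \<gamma> x / 4)" if "\<gamma> \<in> sections A H" for \<gamma> x
      using s(2)[OF that, of x] h(2)[of x] by (simp add: \<tau>_def)
  qed (fact \<alpha>' h eq s)+
  show ?thesis
    by (rule g_metric'[OF \<zeta>])
qed

lemma contact_form_rescaled:
  fixes A :: "'a::{t2_space,second_countable_topology} chart set"
  assumes A: "smooth_atlas A" and H: "generic_distribution A H"
    and \<alpha>: "generalized_contact_form A H \<alpha>"
    and h: "h \<in> smooth_functions A" "\<And>x. h x \<noteq> 0"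
  shows "generalized_contact_form A H (\<lambda>x v. h x * \<alpha> x v)"
proof -
  interpret contact A H \<alpha>
    by unfold_locales (fact A H \<alpha>)+
  have "pairing (\<lambda>x v. h x * \<alpha> x v) \<rho> \<in> smooth_functions A" if "\<rho> \<in> sections A (T2 A H)" for \<rho>
    using F_mult[OF h(1) alpha_F[OF that]] by (simp add: pairing_def)
  moreover have "{v \<in> T2 A H x. h x * \<alpha> x v = 0} = H x" for x
    using alpha_kernel[of x] h(2)[of x] by simp
  ultimately show ?thesis
    unfolding generalized_contact_form_def dual_sections_def mem_Collect_eq pairing_def
    by (intro conjI allI ballI) (simp_all add: alpha_add alpha_scale distrib_left mult.left_commute)
qed

text \<open>Both forms induce nowhere vanishing functionals on the line bundle \<open>T2\<close>
  modulo \<open>H\<close>. In an adapted frame their ratio is that of the values on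
  \<open>lie_bracket X Y\<close>, which gives smoothness near each point.\<close>

lemma contact_forms_proportional:
  fixes A :: "'a::{t2_space,second_countable_topology} chart set"
  assumes A: "smooth_atlas A" and H: "generic_distribution A H"
    and \<alpha>: "generalized_contact_form A H \<alpha>" and \<beta>: "generalized_contact_form A H \<beta>"
  obtains h where "h \<in> smooth_functions A" "\<And>x. h x \<noteq> 0"
    "\<And>x v. v \<in> T2 A H x \<Longrightarrow> \<beta> x v = h x * \<alpha> x v"
proof -
  interpret contact A H \<alpha>
    by unfold_locales (fact A H \<alpha>)+
  interpret b: contact A H \<beta>
    by unfold_locales (fact \<beta>)
  define h where "h x = (SOME c. \<forall>v\<in>T2 A H x. \<beta> x v = c * \<alpha> x v)" for x
  have ratio: "(\<forall>v\<in>T2 A H x. \<beta> x v = c * \<alpha> x v) \<longleftrightarrow> c = b.levi X Y x / levi X Y x"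
    if f: "adapted_frame X Y a b c' d e x" for X Y a b c' d e x c
  proof -
    note fr = adapted_frame_at[OF f]
    have Z: "lie_bracket X Y \<in> sections A (T2 A H)" using fr by simp
    \<comment> \<open>A form vanishing on \<open>H\<close> is determined on \<open>T2\<close> by its
      value on \<open>lie_bracket X Y\<close>.\<close>
    have comp: "\<gamma> x v = c' x v * \<gamma> x (lie_bracket X Y x)"
      if v: "v \<in> T2 A H x" and \<gamma>: "contact A H \<gamma>" for v \<gamma>
    proof -
      interpret g: contact A H \<gamma> by (rule \<gamma>)
      have T: "X x \<in> T2 A H x" "Y x \<in> T2 A H x" "lie_bracket X Y x \<in> T2 A H x"
        using fr Z by (simp_all add: G2_T2)
      have "v = a x v *\<^sub>R X x + b x v *\<^sub>R Y x + c' x v *\<^sub>R lie_bracket X Y x"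
        using fr(1) v unfolding adapted_def Let_def by blast
      then have "\<gamma> x v = \<gamma> x (a x v *\<^sub>R X x + b x v *\<^sub>R Y x + c' x v *\<^sub>R lie_bracket X Y x)"
        by (rule arg_cong)
      also have "\<dots> = a x v * \<gamma> x (X x) + b x v * \<gamma> x (Y x) + c' x v * \<gamma> x (lie_bracket X Y x)"
        using T by (simp only: g.alpha_add g.alpha_scale subspace_add[OF subspace_T2]
            subspace_scale[OF subspace_T2])
      finally show ?thesis
        using fr(2,3) by (simp add: g.alpha_H G_H)
    qed
    have l: "levi X Y x = \<alpha> x (lie_bracket X Y x)" "b.levi X Y x = \<beta> x (lie_bracket X Y x)"
      by (simp_all add: levi_def b.levi_def pairing_def)
    have nz: "levi X Y x \<noteq> 0" by (rule alpha_frame[OF f])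
    show ?thesis
    proof
      assume "\<forall>v\<in>T2 A H x. \<beta> x v = c * \<alpha> x v"
      then have "b.levi X Y x = c * levi X Y x"
        unfolding l using G2_T2[OF Z] by blast
      then show "c = b.levi X Y x / levi X Y x" using nz by simp
    next
      assume c: "c = b.levi X Y x / levi X Y x"
      show "\<forall>v\<in>T2 A H x. \<beta> x v = c * \<alpha> x v"
      proof
        fix v assume v: "v \<in> T2 A H x"
        have "\<alpha> x v = c' x v * levi X Y x" "\<beta> x v = c' x v * b.levi X Y x"
          unfolding l using comp[OF v] contact_axioms b.contact_axioms by blast+
        then show "\<beta> x v = c * \<alpha> x v" using c nz by simp
      qed
    qed
  qed
  have h: "h x = b.levi X Y x / levi X Y x" if f: "adapted_frame X Y a b c d e x" for X Y a b c d e x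
    unfolding h_def ratio[OF f] by simp
  show thesis
  proof (rule that)
    show "h \<in> smooth_functions A"
    proof (rule F_local)
      fix x
      obtain X Y a b c d e where f: "adapted_frame X Y a b c d e x"
        using adapted_frame_exists by blast
      have XY: "X \<in> sections A H" "Y \<in> sections A H" using adapted_frame_at[OF f] by blast+
      obtain p where p: "p \<in> smooth_functions A" "eventually (\<lambda>y. p y * levi X Y y = 1) (nhds x)"
        using F_local_inverse[OF levi_F[OF XY] alpha_frame[OF f]] by blast
      have "eventually (\<lambda>y. h y = b.levi X Y y * p y) (nhds x)"
        using p(2) adapted_frame_near[OF f]
      proof eventually_elim
        case (elim y)
        then have "levi X Y y \<noteq> 0" by auto
        then have "p y = 1 / levi X Y y"
          using elim(1) by (simp add: eq_divide_eq)
        then show ?case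
          using h[OF elim(2)] by simp
      qed
      then show "\<exists>g\<in>smooth_functions A. eventually (\<lambda>y. h y = g y) (nhds x)"
        using p XY by (intro bexI[of _ "\<lambda>y. b.levi X Y y * p y"]) simp_all
    qed
    fix x
    obtain X Y a b c d e where f: "adapted_frame X Y a b c d e x"
      using adapted_frame_exists by blast
    show "h x \<noteq> 0"
      using h[OF f] alpha_frame[OF f] b.alpha_frame[OF f] by simp
    show "\<beta> x v = h x * \<alpha> x v" if "v \<in> T2 A H x" for v
      using ratio[OF f, of "h x"] h[OF f] that by blast
  qed
qed

theorem theorem8:
  fixes A :: "'a::{t2_space,second_countable_topology} chart set"
    and H :: "'a \<Rightarrow> 'a tangent set"
    and \<alpha> :: "'a \<Rightarrow> 'a tangent \<Rightarrow> real"
    and f :: "'a \<Rightarrow> real"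
  assumes "smooth_atlas A"
    and "generic_distribution A H"
    and "generalized_contact_form A H \<alpha>"
    and "f \<in> smooth_functions A"
  shows "generalized_contact_form A H (\<lambda>x v. exp (f x) * \<alpha> x v) \<and>
    (\<forall>\<zeta>\<in>vector_fields A. \<forall>\<zeta>'\<in>vector_fields A. \<forall>x.
       g_metric A H (\<lambda>x v. exp (f x) * \<alpha> x v) \<zeta> \<zeta>' x
         = exp (2 * f x) * g_metric A H \<alpha> \<zeta> \<zeta>' x) \<and>
    (\<forall>\<beta>. generalized_contact_form A H \<beta> \<longrightarrow>
       conformally_equivalent A (g_metric A H \<alpha>) (g_metric A H \<beta>))"
proof (intro conjI ballI allI impI)
  interpret smooth_manifold A
    by unfold_locales (fact assms)
  have e: "(\<lambda>x. exp (f x)) \<in> smooth_functions A"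
    using assms(4) by (rule F_exp)
  show c: "generalized_contact_form A H (\<lambda>x v. exp (f x) * \<alpha> x v)"
    by (rule contact_form_rescaled[OF assms(1-3) e]) simp
  show "g_metric A H (\<lambda>x v. exp (f x) * \<alpha> x v) \<zeta> \<zeta>' x = exp (2 * f x) * g_metric A H \<alpha> \<zeta> \<zeta>' x"
    if "\<zeta> \<in> vector_fields A" "\<zeta>' \<in> vector_fields A" for \<zeta> \<zeta>' x
    using g_metric_rescaled[OF assms(1-3) c e _ _ that, of x] by (simp add: exp_double)
  show "conformally_equivalent A (g_metric A H \<alpha>) (g_metric A H \<beta>)"
    if \<beta>: "generalized_contact_form A H \<beta>" for \<beta>
  proof -
    obtain h where h: "h \<in> smooth_functions A" "\<And>x. h x \<noteq> 0"
        "\<And>x v. v \<in> T2 A H x \<Longrightarrow> \<beta> x v = h x * \<alpha> x v"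
      using contact_forms_proportional[OF assms(1-3) \<beta>] by metis
    \<comment> \<open>The conformal factor is the square of the ratio, hence positive also where the
      ratio is negative.\<close>
    have "(\<lambda>x. (h x)\<^sup>2) \<in> smooth_functions A"
      unfolding power2_eq_square using h(1) by simp
    then show ?thesis
      unfolding conformally_equivalent_def
      by (rule bexI[rotated]) (use h(2) g_metric_rescaled[OF assms(1-3) \<beta> h] in simp)
  qed
qed

end
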